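(* Suppose that the coefficients $b_j,\sigma_j$ ($j=1,2$) are independent of $(y,v)$, i.e. $b_j(t,(y,v),\gamma)=b_j(t,\gamma)$ and $\sigma_j(t,(y,v),\gamma)=\sigma_j(t,\gamma)$ for all $(t,(y,v),\gamma)\in[0,T]\times(\mathbb R\times U)\times\mathcal P_2(\mathbb R\times U)$. Let $N\in\mathbb N$, let $u\in C(\overline{\mathcal O}_N)$ be a viscosity subsolution on $\mathcal O_N$ and $v\in C(\overline{\mathcal O}_N)$ a viscosity supersolution on $\mathcal O_N$ of the Master Bellman equation $$-\partial_t\vartheta(t,\mu_1,\mu_2)-\mathcal H\big(t,\mu_1,\mu_2,\partial_{\mu_1}\vartheta(t,\mu_1,\mu_2;\cdot),\partial_{\mu_2}\vartheta(t,\mu_1,\mu_2;\cdot)\big)=0,\qquad \vartheta(T,\mu_1,\mu_2)=\langle\mu_1,\Phi(\cdot,\mu_2)\rangle ,$$ satisfying $u(T,\mu_1,\mu_2)\le v(T,\mu_1,\mu_2)$ for every $(T,\mu_1,\mu_2)\in\overline{\mathcal O}_N$. Then $u\le v$ on $\overline{\mathcal O}_N$.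
   Context: Setting (dimension $n=d=1$). Fix $T>0$. $(\Omega,\mathcal F,\mathbb P)$ is the classical Wiener space: $\Omega=C_0([0,T];\mathbb R)$, $\mathbb P$ Wiener measure, $\mathcal F$ the completed Borel $\sigma$-field, $B$ the coordinate Brownian motion, $\mathbb F=(\mathcal F_s)$ its augmented filtration. $\mathbb P_\xi$ is the law of $\xi$; $\mathcal P_2(E)$ is the set of probability measures on $E$ with finite second moment, with the $2$-Wasserstein metric $\mathcal W_2$; $L^2(\mathcal F_t)$ is the set of real square-integrable $\mathcal F_t$-measurable random variables; $\langle\mu,f\rangle=\int f\,d\mu$. $U\subset\mathbb R$ is nonempty, bounded and closed. Standing assumptions. (A) $b_1,b_2,\sigma_1,\sigma_2:[0,T]\times(\mathbb R\times U)\times\mathcal P_2(\mathbb R\times U)\to\mathbb R$ are continuous, and there are $C_0,C>0$ such that for $\phi=b_1,b_2,\sigma_1,\sigma_2$, all $t\in[0,T]$, $x,x'\in\mathbb R$, $u\in U$, $\zeta,\zeta'\in L^2(\mathcal F_t)$, $\eta\in L^2(\mathcal F_t;U)$: $|\phi(t,(x,u),\mathbb P_{(\zeta,\eta)})|\le C_0$ and $|\phi(t,(x,u),\mathbb P_{(\zeta,\eta)})-\phi(t,(x',u),\mathbb P_{(\zeta',\eta)})|\le C(|x-x'|+\mathcal W_2(\mathbb P_{(\zeta,\eta)},\mathbb P_{(\zeta',\eta)}))$. (B) $\Phi:\mathbb R\times\mathcal P_2(\mathbb R)\to\mathbb R$ is Borel with $|\Phi(x,\mu)-\Phi(x',\mu')|\le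 C(|x-x'|+\mathcal W_2(\mu,\mu'))$ for some $C>0$. (C)(i) There are $\kappa_0>0$ and a finite set $\mathcal I\subset\mathbb N$ such that for all $s,s'\in[0,T]$, $u\in U$, $x\in\mathbb R$, $\gamma,\gamma'\in\mathcal P_2(\mathbb R\times U)$ with $\gamma(\mathbb R\times\cdot)=\gamma'(\mathbb R\times\cdot)$, and $\phi=b_1,b_2,\sigma_1,\sigma_2$: $|\phi(s,(x,u),\gamma)-\phi(s',(x,u),\gamma')|\le\kappa_0(|s-s'|+\sum_{i\in\mathcal I}|\langle\mu-\mu',x^i\rangle|)$, where $\mu=\gamma(\cdot\times U)$, $\mu'=\gamma'(\cdot\times U)$. (ii) For some $\delta>0$ (fixed from now on) and some $C$, $\sup_{\mu\in\mathcal P_2(\mathbb R)}|\Phi(x,\mu)|\le Ce^{\delta|x|}$ for all $x\in\mathbb R$. Domain. $e_\delta(x)=\exp(\delta(\sqrt{x^2+1}-1))$, $K^*=C_0\delta+\frac12C_0^2(\delta+\delta^2)$, $\mathcal O_N=\{(t,\mu_1,\mu_2)\in[0,T)\times\mathcal P_2(\mathbb R)^2:\langle\mu_i,e_\delta\rangle\le Ne^{K^*t},\ i=1,2\}$, and $\overline{\mathcal O}_N$ is the same with $t\in[0,T]$. Measures carry the topology of weak convergence. Measure derivative. $\frac{\delta\varphi}{\delta\mu}(\mu)(x)$ is a linear functional derivative of $\varphi$: a function continuous in $(\mu,x)$, of at most quadratic growth in $x$ uniformly for $\mu$ in bounded sets, with $\varphi(\mu')-\varphi(\mu)=\int_0^1\int\frac{\delta\varphi}{\delta\mu}(r\mu'+(1-r)\mu)(x)\,d(\mu'-\mu)(x)dr$;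 the L-derivative is $\partial_\mu\varphi(\mu;x)=\partial_x\frac{\delta\varphi}{\delta\mu}(\mu)(x)$. In particular $\partial_\mu[F(\langle\mu,f\rangle)](y)=F'(\langle\mu,f\rangle)f'(y)$. Hamiltonian. $\Pi_\mu=\{\gamma\in\mathcal P_2(\mathbb R\times U):\gamma(\cdot\times U)=\mu\}$; for $p_1,p_2\in C^1(\mathbb R)$, $$\mathcal H(t,\mu_1,\mu_2,p_1,p_2)=\inf_{\gamma_1\in\Pi_{\mu_1},\gamma_2\in\Pi_{\mu_2}}\Big\{\int\big[p_1(y)b_2(t,(y,v),\gamma_2)+\tfrac12p_1'(y)\sigma_2(t,(y,v),\gamma_2)^2\big]\gamma_1(dy\,dv)+\int\big[p_2(y)b_1(t,(y,v),\gamma_2)+\tfrac12p_2'(y)\sigma_1(t,(y,v),\gamma_2)^2\big]\gamma_2(dy\,dv)\Big\}.$$ Test functions. A cylindrical polynomial is a map $(t,\mu_1,\mu_2)\mapsto F(t,\langle\mu_1,f_1\rangle,\langle\mu_2,f_2\rangle)$ with $f_1,f_2$ polynomials and $F:[0,T]\times\mathbb R\times\mathbb R\to\mathbb R$ continuously differentiable. A viscosity test function on $E=\mathcal O_N$ is $\varphi=\sum_{j\ge1}\varphi_j$ with $\varphi_j$ cylindrical polynomials, the series converging absolutely at every point of $E$, and $\lim_{M\to\infty}\sum_{j\ge M}\sup_{(t,\mu_1,\mu_2)\in\mathcal O_N}\sum_{i=1,2}\big(\langle\mu_i,|\partial_{\mu_i}\varphi_j(t,\mu_1,\mu_2;\cdot)|\rangle+\langle\mu_i,|\partial_y\partial_{\mu_i}\varphi_j(t,\mu_1,\mu_2;\cdot)|\rangle\big)=0$.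 $\Gamma_E$ is the set of these. Jets. For $(t,\mu_1,\mu_2)\in E$, $t<T$, $J_E^+u(t,\mu_1,\mu_2)$ is the set of triples $(\partial_t\varphi,\partial_{\mu_1}\varphi(\cdot),\partial_{\mu_2}\varphi(\cdot))$ evaluated at $(t,\mu_1,\mu_2)$, over $\varphi\in\Gamma_E$ with $(u-\varphi)(t,\mu_1,\mu_2)=\max_E(u-\varphi)$; $J_E^-u=-J_E^+(-u)$. Viscosity sub/supersolution on $\mathcal O_N$. A continuous function $u$ on $\overline{\mathcal O}_N$ with $u(T,\mu_1,\mu_2)=\langle\mu_1,\Phi(\cdot,\mu_2)\rangle$ is a viscosity subsolution (resp. supersolution) on $\mathcal O_N$ if for every $(t,\mu_1,\mu_2)\in\mathcal O_N$, $-\pi_t-\mathcal H(t,\mu_1,\mu_2,\pi_{\mu_1},\pi_{\mu_2})\le0$ for all $(\pi_t,\pi_{\mu_1},\pi_{\mu_2})\in J^+_{\mathcal O_N}u(t,\mu_1,\mu_2)$ (resp. $\ge0$ for all elements of $J^-_{\mathcal O_N}u(t,\mu_1,\mu_2)$). *)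

theory Defs
  imports "HOL-Probability.Probability" "HOL-Computational_Algebra.Polynomial"
begin

definition borel_of :: "'a topology \<Rightarrow> 'a measure" where
  "borel_of X = sigma (topspace X) {G. openin X G}"

text \<open>
  Probability measures on a subset \<open>S\<close> of the ambient space with finite \<open>p\<close>-th moment, realised as
  Borel measures on the ambient space that are concentrated on \<open>S\<close>.
\<close>

definition Pspace :: "nat \<Rightarrow> 'a::euclidean_space set \<Rightarrow> 'a measure set" where
  "Pspace p S = {\<mu>. prob_space \<mu> \<and> sets \<mu> = sets borel \<and> (AE x in \<mu>. x \<in> S)
                    \<and> integrable \<mu> (\<lambda>x. norm x ^ p)}"

definition couplings :: "'a::euclidean_space measure \<Rightarrow> 'a measure \<Rightarrow> ('a \<times> 'a) measure set" where
  "couplings \<mu> \<nu> = {\<pi>. sets \<pi> = sets borel \<and> distr \<pi> borel fst = \<mu> \<and> distr \<pi> borel snd = \<nu>}"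

definition wasserstein :: "nat \<Rightarrow> 'a::euclidean_space measure \<Rightarrow> 'a measure \<Rightarrow> real" where
  "wasserstein p \<mu> \<nu> = root p (INF \<pi>\<in>couplings \<mu> \<nu>. LINT z|\<pi>. dist (fst z) (snd z) ^ p)"

definition wasserstein_topology :: "nat \<Rightarrow> 'a::euclidean_space set \<Rightarrow> 'a measure topology" where
  "wasserstein_topology p S = topology (\<lambda>G. G \<subseteq> Pspace p S \<and>
     (\<forall>\<mu>\<in>G. \<exists>\<epsilon>>0. \<forall>\<nu>\<in>Pspace p S. wasserstein p \<mu> \<nu> < \<epsilon> \<longrightarrow> \<nu> \<in> G))"

lemma openin_wasserstein_topology:
  "openin (wasserstein_topology p S) G \<longleftrightarrow> G \<subseteq> Pspace p S \<and>
     (\<forall>\<mu>\<in>G. \<exists>\<epsilon>>0. \<forall>\<nu>\<in>Pspace p S. wasserstein p \<mu> \<nu> < \<epsilon> \<longrightarrow> \<nu> \<in> G)"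
proof -
  have "istopology (\<lambda>G. G \<subseteq> Pspace p S \<and>
     (\<forall>\<mu>\<in>G. \<exists>\<epsilon>>0. \<forall>\<nu>\<in>Pspace p S. wasserstein p \<mu> \<nu> < \<epsilon> \<longrightarrow> \<nu> \<in> G))"
    (is "istopology ?P")
    unfolding istopology_def
  proof (intro conjI allI impI)
    fix G H assume G: "?P G" and H: "?P H"
    show "G \<inter> H \<subseteq> Pspace p S" using G by blast
    show "\<forall>\<mu>\<in>G \<inter> H. \<exists>\<epsilon>>0. \<forall>\<nu>\<in>Pspace p S. wasserstein p \<mu> \<nu> < \<epsilon> \<longrightarrow> \<nu> \<in> G \<inter> H"
    proof
      fix \<mu> assume "\<mu> \<in> G \<inter> H"
      then obtain d e where "d > 0" "\<forall>\<nu>\<in>Pspace p S. wasserstein p \<mu> \<nu> < d \<longrightarrow> \<nu> \<in> G"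
        and "e > 0" "\<forall>\<nu>\<in>Pspace p S. wasserstein p \<mu> \<nu> < e \<longrightarrow> \<nu> \<in> H"
        using G H by blast
      then show "\<exists>\<epsilon>>0. \<forall>\<nu>\<in>Pspace p S. wasserstein p \<mu> \<nu> < \<epsilon> \<longrightarrow> \<nu> \<in> G \<inter> H"
        by (intro exI[of _ "min d e"]) auto
    qed
  next
    fix \<G> assume G: "\<forall>G\<in>\<G>. ?P G"
    show "\<Union>\<G> \<subseteq> Pspace p S" using G by blast
    show "\<forall>\<mu>\<in>\<Union>\<G>. \<exists>\<epsilon>>0. \<forall>\<nu>\<in>Pspace p S. wasserstein p \<mu> \<nu> < \<epsilon> \<longrightarrow> \<nu> \<in> \<Union>\<G>"
    proof
      fix \<mu> assume "\<mu> \<in> \<Union>\<G>"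
      then obtain G where "G \<in> \<G>" "\<mu> \<in> G" by blast
      with G obtain e where "e > 0" "\<forall>\<nu>\<in>Pspace p S. wasserstein p \<mu> \<nu> < e \<longrightarrow> \<nu> \<in> G" by blast
      with \<open>G \<in> \<G>\<close> show "\<exists>\<epsilon>>0. \<forall>\<nu>\<in>Pspace p S. wasserstein p \<mu> \<nu> < \<epsilon> \<longrightarrow> \<nu> \<in> \<Union>\<G>"
        by blast
    qed
  qed
  then show ?thesis
    by (simp add: wasserstein_topology_def)
qed

lemma topspace_wasserstein_topology: "topspace (wasserstein_topology p S) = Pspace p S"
proof (rule antisym)
  show "topspace (wasserstein_topology p S) \<subseteq> Pspace p S"
    using openin_wasserstein_topology openin_topspace by blast
  have "openin (wasserstein_topology p S) (Pspace p S)"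
    unfolding openin_wasserstein_topology by (auto intro: exI[of _ 1])
  then show "Pspace p S \<subseteq> topspace (wasserstein_topology p S)"
    by (rule openin_subset)
qed

definition weak_topology :: "real measure topology" where
  "weak_topology = topology_generated_by
     {{\<mu>. prob_space \<mu> \<and> sets \<mu> = sets borel \<and> (LINT x|\<mu>. f x) \<in> V} | f V.
        continuous_on UNIV f \<and> bounded (range f) \<and> open (V :: real set)}"

definition path_metric :: "real \<Rightarrow> (real \<Rightarrow> real) metric" where
  "path_metric T = submetric (cfunspace (top_of_set {0..T}) euclidean_metric) {\<omega>. \<omega> 0 = 0}"

definition wiener_measure :: "real \<Rightarrow> (real \<Rightarrow> real) measure \<Rightarrow> bool" where
  "wiener_measure T W \<longleftrightarrow>
     prob_space W \<and> sets W = sets (borel_of (mtopology_of (path_metric T))) \<and>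
     (\<forall>s t. 0 \<le> s \<and> s < t \<and> t \<le> T \<longrightarrow>
        distributed W lborel (\<lambda>\<omega>. \<omega> t - \<omega> s) (\<lambda>x. ennreal (normal_density 0 (sqrt (t - s)) x))) \<and>
     (\<forall>n \<tau>. strict_mono_on {..n} \<tau> \<and> \<tau> ` {..n} \<subseteq> {0..T} \<longrightarrow>
        prob_space.indep_vars W (\<lambda>_. borel) (\<lambda>i \<omega>. \<omega> (\<tau> (Suc i)) - \<omega> (\<tau> i)) {..<n})"

definition aug_filtration :: "(real \<Rightarrow> real) measure \<Rightarrow> real \<Rightarrow> (real \<Rightarrow> real) measure" where
  "aug_filtration W t = sigma (space W)
     ({(\<lambda>\<omega>. \<omega> s) -` A \<inter> space W | s A. s \<in> {0..t} \<and> A \<in> sets borel}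
      \<union> null_sets (completion W))"

definition L2F :: "(real \<Rightarrow> real) measure \<Rightarrow> real \<Rightarrow> real set \<Rightarrow> ((real \<Rightarrow> real) \<Rightarrow> real) set" where
  "L2F W t S = {\<zeta> \<in> borel_measurable (aug_filtration W t).
      \<zeta> ` space W \<subseteq> S \<and> integrable (completion W) (\<lambda>\<omega>. (\<zeta> \<omega>)\<^sup>2)}"

definition joint_law ::
  "(real \<Rightarrow> real) measure \<Rightarrow> ((real \<Rightarrow> real) \<Rightarrow> real) \<Rightarrow> ((real \<Rightarrow> real) \<Rightarrow> real) \<Rightarrow> (real \<times> real) measure"
where
  "joint_law W \<zeta> \<eta> = distr (completion W) borel (\<lambda>\<omega>. (\<zeta> \<omega>, \<eta> \<omega>))"

text \<open>
  A coefficient takes a time, a pair (state, control) and a joint law of state and control. Its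
  values outside \<open>[0,T] \<times> (\<real> \<times> U) \<times> P\<^sub>2(\<real> \<times> U)\<close> are irrelevant.
\<close>

type_synonym coefficient = "real \<Rightarrow> real \<times> real \<Rightarrow> (real \<times> real) measure \<Rightarrow> real"

definition coefficient_regular ::
  "real \<Rightarrow> real set \<Rightarrow> (real \<Rightarrow> real) measure \<Rightarrow> real \<Rightarrow> real \<Rightarrow> coefficient \<Rightarrow> bool" where
  "coefficient_regular T U W C\<^sub>0 C \<phi> \<longleftrightarrow>
     continuous_map
       (prod_topology (top_of_set {0..T})
         (prod_topology (top_of_set (UNIV \<times> U)) (wasserstein_topology 2 (UNIV \<times> U))))
       euclideanreal (\<lambda>(t, z, \<gamma>). \<phi> t z \<gamma>) \<and>
     (\<forall>t\<in>{0..T}. \<forall>x x'. \<forall>a\<in>U. \<forall>\<zeta>\<in>L2F W t UNIV. \<forall>\<zeta>'\<in>L2F W t UNIV. \<forall>\<eta>\<in>L2F W t U.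
        \<bar>\<phi> t (x, a) (joint_law W \<zeta> \<eta>)\<bar> \<le> C\<^sub>0 \<and>
        \<bar>\<phi> t (x, a) (joint_law W \<zeta> \<eta>) - \<phi> t (x', a) (joint_law W \<zeta>' \<eta>)\<bar>
          \<le> C * (\<bar>x - x'\<bar> + wasserstein 2 (joint_law W \<zeta> \<eta>) (joint_law W \<zeta>' \<eta>)))"

definition terminal_regular :: "(real \<Rightarrow> real measure \<Rightarrow> real) \<Rightarrow> bool" where
  "terminal_regular \<Phi> \<longleftrightarrow>
     (\<lambda>(x, \<mu>). \<Phi> x \<mu>)
       \<in> borel_measurable (borel_of (prod_topology euclideanreal (wasserstein_topology 2 UNIV))) \<and>
     (\<exists>C>0. \<forall>x x'. \<forall>\<mu>\<in>Pspace 2 UNIV. \<forall>\<mu>'\<in>Pspace 2 UNIV.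
        \<bar>\<Phi> x \<mu> - \<Phi> x' \<mu>'\<bar> \<le> C * (\<bar>x - x'\<bar> + wasserstein 2 \<mu> \<mu>'))"

text \<open>
  The exponents in \<open>I\<close> may exceed 2, and measures with finite second moment need not have the
  corresponding moments; the bound is only imposed where the moments in it exist.
\<close>

definition coefficient_moment_lipschitz ::
  "real \<Rightarrow> real set \<Rightarrow> real \<Rightarrow> nat set \<Rightarrow> coefficient \<Rightarrow> bool" where
  "coefficient_moment_lipschitz T U \<kappa>\<^sub>0 I \<phi> \<longleftrightarrow>
     (\<forall>s\<in>{0..T}. \<forall>s'\<in>{0..T}. \<forall>x. \<forall>a\<in>U.
      \<forall>\<gamma>\<in>Pspace 2 (UNIV \<times> U). \<forall>\<gamma>'\<in>Pspace 2 (UNIV \<times> U).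
        distr \<gamma> borel snd = distr \<gamma>' borel snd \<longrightarrow>
        (\<forall>i\<in>I. integrable (distr \<gamma> borel fst) (\<lambda>y. y ^ i) \<and>
                integrable (distr \<gamma>' borel fst) (\<lambda>y. y ^ i)) \<longrightarrow>
        \<bar>\<phi> s (x, a) \<gamma> - \<phi> s' (x, a) \<gamma>'\<bar>
          \<le> \<kappa>\<^sub>0 * (\<bar>s - s'\<bar> + (\<Sum>i\<in>I. \<bar>(LINT y|distr \<gamma> borel fst. y ^ i)
                                     - (LINT y|distr \<gamma>' borel fst. y ^ i)\<bar>)))"

definition terminal_growth :: "real \<Rightarrow> (real \<Rightarrow> real measure \<Rightarrow> real) \<Rightarrow> bool" where
  "terminal_growth \<delta> \<Phi> \<longleftrightarrow>
     (\<exists>C. \<forall>x. \<forall>\<mu>\<in>Pspace 2 UNIV. \<bar>\<Phi> x \<mu>\<bar> \<le> C * exp (\<delta> * \<bar>x\<bar>))"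

type_synonym state = "real \<times> real measure \<times> real measure"

definition e_weight :: "real \<Rightarrow> real \<Rightarrow> real" where
  "e_weight \<delta> x = exp (\<delta> * (sqrt (x\<^sup>2 + 1) - 1))"

definition K_star :: "real \<Rightarrow> real \<Rightarrow> real" where
  "K_star C\<^sub>0 \<delta> = C\<^sub>0 * \<delta> + 1/2 * C\<^sub>0\<^sup>2 * (\<delta> + \<delta>\<^sup>2)"

definition O_closed :: "real \<Rightarrow> real \<Rightarrow> real \<Rightarrow> nat \<Rightarrow> state set" where
  "O_closed T C\<^sub>0 \<delta> N = {(t, \<mu>\<^sub>1, \<mu>\<^sub>2). t \<in> {0..T} \<and>
     (\<forall>\<mu>\<in>{\<mu>\<^sub>1, \<mu>\<^sub>2}. \<mu> \<in> Pspace 2 UNIV \<and> integrable \<mu> (e_weight \<delta>) \<and>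
        (LINT x|\<mu>. e_weight \<delta> x) \<le> real N * exp (K_star C\<^sub>0 \<delta> * t))}"

definition O_dom :: "real \<Rightarrow> real \<Rightarrow> real \<Rightarrow> nat \<Rightarrow> state set" where
  "O_dom T C\<^sub>0 \<delta> N = {(t, \<mu>\<^sub>1, \<mu>\<^sub>2) \<in> O_closed T C\<^sub>0 \<delta> N. t < T}"

definition O_topology :: "real \<Rightarrow> real \<Rightarrow> real \<Rightarrow> nat \<Rightarrow> state topology" where
  "O_topology T C\<^sub>0 \<delta> N = subtopology
     (prod_topology (top_of_set {0..T}) (prod_topology weak_topology weak_topology))
     (O_closed T C\<^sub>0 \<delta> N)"

definition mixture :: "real \<Rightarrow> real measure \<Rightarrow> real measure \<Rightarrow> real measure" where
  "mixture r \<mu>' \<mu> = measure_of UNIV (sets borel)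
     (\<lambda>A. ennreal r * emeasure \<mu>' A + ennreal (1 - r) * emeasure \<mu> A)"

text \<open>
  For \<open>k = 2\<close> this is the usual linear functional derivative on \<open>P\<^sub>2(\<real>)\<close>, with quadratic growth.
  The functional \<open>\<mu> \<mapsto> F(\<integral> f d\<mu>)\<close> with a polynomial \<open>f\<close> of degree \<open>k > 2\<close> is only defined on
  \<open>P\<^sub>k(\<real>)\<close>, and its derivative \<open>F'(\<integral> f d\<mu>) f(x)\<close> grows like \<open>|x|^k\<close>, so that the space, its
  metric and the growth order have to be adapted to the degree.
\<close>

definition linear_functional_derivative ::
  "nat \<Rightarrow> (real measure \<Rightarrow> real) \<Rightarrow> (real measure \<Rightarrow> real \<Rightarrow> real) \<Rightarrow> bool" where
  "linear_functional_derivative k \<psi> D \<longleftrightarrow>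
     continuous_map (prod_topology (wasserstein_topology k UNIV) euclideanreal) euclideanreal
       (\<lambda>(\<mu>, x). D \<mu> x) \<and>
     (\<forall>R. \<exists>C. \<forall>\<mu>\<in>Pspace k UNIV. (LINT x|\<mu>. \<bar>x\<bar> ^ k) \<le> R \<longrightarrow>
        (\<forall>x. \<bar>D \<mu> x\<bar> \<le> C * (1 + \<bar>x\<bar> ^ k))) \<and>
     (\<forall>\<mu>\<in>Pspace k UNIV. \<forall>\<mu>'\<in>Pspace k UNIV.
        \<psi> \<mu>' - \<psi> \<mu> = (LINT r:{0..1}|lborel.
           (LINT x|\<mu>'. D (mixture r \<mu>' \<mu>) x) - (LINT x|\<mu>. D (mixture r \<mu>' \<mu>) x)))"

definition L_derivative ::
  "nat \<Rightarrow> (real measure \<Rightarrow> real) \<Rightarrow> (real measure \<Rightarrow> real \<Rightarrow> real) \<Rightarrow> bool" where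
  "L_derivative k \<psi> p \<longleftrightarrow> (\<exists>D. linear_functional_derivative k \<psi> D \<and>
     (\<forall>\<mu>\<in>Pspace k UNIV. \<forall>x. (D \<mu> has_real_derivative p \<mu> x) (at x)))"

definition C1_on :: "'a::real_normed_vector set \<Rightarrow> ('a \<Rightarrow> real) \<Rightarrow> bool" where
  "C1_on S F \<longleftrightarrow> (\<exists>F' :: 'a \<Rightarrow> 'a \<Rightarrow>\<^sub>L real. continuous_on S F' \<and>
     (\<forall>x\<in>S. (F has_derivative blinfun_apply (F' x)) (at x within S)))"

definition cylindrical_polynomial :: "real \<Rightarrow> nat \<Rightarrow> (state \<Rightarrow> real) \<Rightarrow> bool" where
  "cylindrical_polynomial T k \<phi> \<longleftrightarrow> (\<exists>F f\<^sub>1 f\<^sub>2.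
     C1_on ({0..T} \<times> UNIV \<times> UNIV) F \<and> degree f\<^sub>1 \<le> k \<and> degree f\<^sub>2 \<le> k \<and>
     (\<forall>t\<in>{0..T}. \<forall>\<mu>\<^sub>1\<in>Pspace k UNIV. \<forall>\<mu>\<^sub>2\<in>Pspace k UNIV.
        \<phi> (t, \<mu>\<^sub>1, \<mu>\<^sub>2) = F (t, LINT x|\<mu>\<^sub>1. poly f\<^sub>1 x, LINT x|\<mu>\<^sub>2. poly f\<^sub>2 x)))"

text \<open>
  A series of cylindrical polynomials \<open>\<phi> j\<close> together with their L-derivatives
  \<open>p\<^sub>1 j\<close>, \<open>p\<^sub>2 j\<close> in the two measure arguments; \<open>k j\<close> bounds the degree of \<open>\<phi> j\<close>.
\<close>

definition test_series ::
  "real \<Rightarrow> state set \<Rightarrow> (nat \<Rightarrow> nat) \<Rightarrow> (nat \<Rightarrow> state \<Rightarrow> real) \<Rightarrow>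
   (nat \<Rightarrow> state \<Rightarrow> real \<Rightarrow> real) \<Rightarrow> (nat \<Rightarrow> state \<Rightarrow> real \<Rightarrow> real) \<Rightarrow> bool" where
  "test_series T E k \<phi> p\<^sub>1 p\<^sub>2 \<longleftrightarrow>
     (\<forall>j. k j \<ge> 2 \<and> cylindrical_polynomial T (k j) (\<phi> j) \<and>
        (\<forall>t\<in>{0..T}. \<forall>\<nu>\<in>Pspace (k j) UNIV.
           L_derivative (k j) (\<lambda>\<mu>. \<phi> j (t, \<mu>, \<nu>)) (\<lambda>\<mu>. p\<^sub>1 j (t, \<mu>, \<nu>)) \<and>
           L_derivative (k j) (\<lambda>\<mu>. \<phi> j (t, \<nu>, \<mu>)) (\<lambda>\<mu>. p\<^sub>2 j (t, \<nu>, \<mu>)))) \<and>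
     (\<forall>z\<in>E. summable (\<lambda>j. \<bar>\<phi> j z\<bar>)) \<and>
     (\<lambda>M. \<Sum>j. SUP (t, \<mu>\<^sub>1, \<mu>\<^sub>2)\<in>E.
          (\<integral>\<^sup>+ y. ennreal \<bar>p\<^sub>1 (j + M) (t, \<mu>\<^sub>1, \<mu>\<^sub>2) y\<bar> \<partial>\<mu>\<^sub>1)
        + (\<integral>\<^sup>+ y. ennreal \<bar>deriv (p\<^sub>1 (j + M) (t, \<mu>\<^sub>1, \<mu>\<^sub>2)) y\<bar> \<partial>\<mu>\<^sub>1)
        + (\<integral>\<^sup>+ y. ennreal \<bar>p\<^sub>2 (j + M) (t, \<mu>\<^sub>1, \<mu>\<^sub>2) y\<bar> \<partial>\<mu>\<^sub>2)
        + (\<integral>\<^sup>+ y. ennreal \<bar>deriv (p\<^sub>2 (j + M) (t, \<mu>\<^sub>1, \<mu>\<^sub>2)) y\<bar> \<partial>\<mu>\<^sub>2)) \<longlonglongrightarrow> 0"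

text \<open>
  The L-derivatives \<open>\<pi>\<^sub>1\<close>, \<open>\<pi>\<^sub>2\<close> of a test function, and their derivatives in \<open>y\<close>, are obtained by
  termwise differentiation of the series. The time derivative is one-sided where the set of
  admissible times ends, in particular at time 0.
\<close>

definition series_C1_sum :: "(nat \<Rightarrow> real \<Rightarrow> real) \<Rightarrow> (real \<Rightarrow> real) \<Rightarrow> bool" where
  "series_C1_sum p \<pi> \<longleftrightarrow>
     (\<forall>y. \<pi> differentiable at y) \<and> continuous_on UNIV (deriv \<pi>) \<and>
     (\<forall>y. (\<lambda>j. p j y) sums \<pi> y) \<and> (\<forall>y. (\<lambda>j. deriv (p j) y) sums deriv \<pi> y)"

definition J_plus ::
  "real \<Rightarrow> state set \<Rightarrow> (state \<Rightarrow> real) \<Rightarrow> state \<Rightarrow> (real \<times> (real \<Rightarrow> real) \<times> (real \<Rightarrow> real)) set" where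
  "J_plus T E u = (\<lambda>(t, \<mu>\<^sub>1, \<mu>\<^sub>2). {(\<pi>\<^sub>t, \<pi>\<^sub>1, \<pi>\<^sub>2). \<exists>k \<phi> p\<^sub>1 p\<^sub>2.
     test_series T E k \<phi> p\<^sub>1 p\<^sub>2 \<and>
     (t, \<mu>\<^sub>1, \<mu>\<^sub>2) \<in> E \<and>
     (\<forall>z\<in>E. u z - (\<Sum>j. \<phi> j z) \<le> u (t, \<mu>\<^sub>1, \<mu>\<^sub>2) - (\<Sum>j. \<phi> j (t, \<mu>\<^sub>1, \<mu>\<^sub>2))) \<and>
     ((\<lambda>s. \<Sum>j. \<phi> j (s, \<mu>\<^sub>1, \<mu>\<^sub>2)) has_real_derivative \<pi>\<^sub>t)
        (at t within {s. (s, \<mu>\<^sub>1, \<mu>\<^sub>2) \<in> E}) \<and>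
     series_C1_sum (\<lambda>j. p\<^sub>1 j (t, \<mu>\<^sub>1, \<mu>\<^sub>2)) \<pi>\<^sub>1 \<and>
     series_C1_sum (\<lambda>j. p\<^sub>2 j (t, \<mu>\<^sub>1, \<mu>\<^sub>2)) \<pi>\<^sub>2})"

definition J_minus ::
  "real \<Rightarrow> state set \<Rightarrow> (state \<Rightarrow> real) \<Rightarrow> state \<Rightarrow> (real \<times> (real \<Rightarrow> real) \<times> (real \<Rightarrow> real)) set" where
  "J_minus T E u z =
     (\<lambda>(\<pi>\<^sub>t, \<pi>\<^sub>1, \<pi>\<^sub>2). (- \<pi>\<^sub>t, \<lambda>y. - \<pi>\<^sub>1 y, \<lambda>y. - \<pi>\<^sub>2 y)) ` J_plus T E (\<lambda>z. - u z) z"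

definition Pi_set :: "real set \<Rightarrow> real measure \<Rightarrow> (real \<times> real) measure set" where
  "Pi_set U \<mu> = {\<gamma> \<in> Pspace 2 (UNIV \<times> U). distr \<gamma> borel fst = \<mu>}"

text \<open>
  The integrals are restricted to \<open>\<real> \<times> U\<close>, which carries the full mass of \<open>\<gamma>\<close>, because nothing is
  known about the coefficients (not even measurability) off that set.
\<close>

definition generator_integral ::
  "real set \<Rightarrow> coefficient \<Rightarrow> coefficient \<Rightarrow> real \<Rightarrow> (real \<Rightarrow> real) \<Rightarrow>
   (real \<times> real) measure \<Rightarrow> (real \<times> real) measure \<Rightarrow> real" where
  "generator_integral U b \<sigma> t p \<gamma>' \<gamma> =
     (LINT z:(UNIV \<times> U)|\<gamma>. p (fst z) * b t z \<gamma>' + 1/2 * deriv p (fst z) * (\<sigma> t z \<gamma>')\<^sup>2)"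

definition hamiltonian ::
  "real set \<Rightarrow> coefficient \<Rightarrow> coefficient \<Rightarrow> coefficient \<Rightarrow> coefficient \<Rightarrow>
   real \<Rightarrow> real measure \<Rightarrow> real measure \<Rightarrow> (real \<Rightarrow> real) \<Rightarrow> (real \<Rightarrow> real) \<Rightarrow> real" where
  "hamiltonian U b\<^sub>1 b\<^sub>2 \<sigma>\<^sub>1 \<sigma>\<^sub>2 t \<mu>\<^sub>1 \<mu>\<^sub>2 p\<^sub>1 p\<^sub>2 =
     (INF (\<gamma>\<^sub>1, \<gamma>\<^sub>2) \<in> Pi_set U \<mu>\<^sub>1 \<times> Pi_set U \<mu>\<^sub>2.
        generator_integral U b\<^sub>2 \<sigma>\<^sub>2 t p\<^sub>1 \<gamma>\<^sub>2 \<gamma>\<^sub>1 + generator_integral U b\<^sub>1 \<sigma>\<^sub>1 t p\<^sub>2 \<gamma>\<^sub>2 \<gamma>\<^sub>2)"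

definition terminal_condition ::
  "real \<Rightarrow> real \<Rightarrow> real \<Rightarrow> nat \<Rightarrow> (real \<Rightarrow> real measure \<Rightarrow> real) \<Rightarrow> (state \<Rightarrow> real) \<Rightarrow> bool" where
  "terminal_condition T C\<^sub>0 \<delta> N \<Phi> u \<longleftrightarrow>
     (\<forall>\<mu>\<^sub>1 \<mu>\<^sub>2. (T, \<mu>\<^sub>1, \<mu>\<^sub>2) \<in> O_closed T C\<^sub>0 \<delta> N \<longrightarrow> u (T, \<mu>\<^sub>1, \<mu>\<^sub>2) = (LINT x|\<mu>\<^sub>1. \<Phi> x \<mu>\<^sub>2))"

definition viscosity_subsolution ::
  "real \<Rightarrow> real set \<Rightarrow> coefficient \<Rightarrow> coefficient \<Rightarrow> coefficient \<Rightarrow> coefficient \<Rightarrow>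
   (real \<Rightarrow> real measure \<Rightarrow> real) \<Rightarrow> real \<Rightarrow> real \<Rightarrow> nat \<Rightarrow> (state \<Rightarrow> real) \<Rightarrow> bool" where
  "viscosity_subsolution T U b\<^sub>1 b\<^sub>2 \<sigma>\<^sub>1 \<sigma>\<^sub>2 \<Phi> C\<^sub>0 \<delta> N u \<longleftrightarrow>
     continuous_map (O_topology T C\<^sub>0 \<delta> N) euclideanreal u \<and>
     terminal_condition T C\<^sub>0 \<delta> N \<Phi> u \<and>
     (\<forall>(t, \<mu>\<^sub>1, \<mu>\<^sub>2) \<in> O_dom T C\<^sub>0 \<delta> N.
        \<forall>(\<pi>\<^sub>t, \<pi>\<^sub>1, \<pi>\<^sub>2) \<in> J_plus T (O_dom T C\<^sub>0 \<delta> N) u (t, \<mu>\<^sub>1, \<mu>\<^sub>2).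
          - \<pi>\<^sub>t - hamiltonian U b\<^sub>1 b\<^sub>2 \<sigma>\<^sub>1 \<sigma>\<^sub>2 t \<mu>\<^sub>1 \<mu>\<^sub>2 \<pi>\<^sub>1 \<pi>\<^sub>2 \<le> 0)"

definition viscosity_supersolution ::
  "real \<Rightarrow> real set \<Rightarrow> coefficient \<Rightarrow> coefficient \<Rightarrow> coefficient \<Rightarrow> coefficient \<Rightarrow>
   (real \<Rightarrow> real measure \<Rightarrow> real) \<Rightarrow> real \<Rightarrow> real \<Rightarrow> nat \<Rightarrow> (state \<Rightarrow> real) \<Rightarrow> bool" where
  "viscosity_supersolution T U b\<^sub>1 b\<^sub>2 \<sigma>\<^sub>1 \<sigma>\<^sub>2 \<Phi> C\<^sub>0 \<delta> N u \<longleftrightarrow>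
     continuous_map (O_topology T C\<^sub>0 \<delta> N) euclideanreal u \<and>
     terminal_condition T C\<^sub>0 \<delta> N \<Phi> u \<and>
     (\<forall>(t, \<mu>\<^sub>1, \<mu>\<^sub>2) \<in> O_dom T C\<^sub>0 \<delta> N.
        \<forall>(\<pi>\<^sub>t, \<pi>\<^sub>1, \<pi>\<^sub>2) \<in> J_minus T (O_dom T C\<^sub>0 \<delta> N) u (t, \<mu>\<^sub>1, \<mu>\<^sub>2).
          - \<pi>\<^sub>t - hamiltonian U b\<^sub>1 b\<^sub>2 \<sigma>\<^sub>1 \<sigma>\<^sub>2 t \<mu>\<^sub>1 \<mu>\<^sub>2 \<pi>\<^sub>1 \<pi>\<^sub>2 \<ge> 0)"

end

theory Submission
  imports Defs
begin

text \<open>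
  The comparison is proved by doubling the variables. The constraint \<open>\<langle>\<mu>, e\<^sub>\<delta>\<rangle> \<le> N e^{K t}\<close> (with
  \<open>K\<close> the constant \<^const>\<open>K_star\<close>) bounds all moments of the measures that occur, uniformly and of
  the order \<open>j! / \<delta>^j\<close>, so measures can be compared through their moments \<open>m\<^sub>j\<close> alone:
  \<open>moment_gap \<mu> \<nu> = \<Sum>\<^sub>j c\<^sub>j (m\<^sub>j(\<mu>) - m\<^sub>j(\<nu>))\<^sup>2\<close> with \<open>c\<^sub>j = 1 / (j!)^4\<close>. Four properties make this the
  right penalty.

  First, it is the sum of a series of cylindrical polynomials satisfying the summability required
  of test functions, so a maximum of \<open>u - v - \<kappa>/2 gap\<close> produces elements of the jets
  (\<open>quadratic_jet\<close>). Second, it separates points, because exponential moments make the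
  moment problem determinate (\<open>exp_class_moment_determinacy\<close>). Third, it is continuous along weakly
  convergent sequences, for which the closed domain is sequentially compact
  (\<open>O_closed_seq_compact\<close>, \<open>state_gap_tendsto\<close>). Fourth, the weights dominate differentiation of
  monomials: the operator \<open>(l\<^sub>j) \<mapsto> (j l\<^sub>j\<^sub>-\<^sub>1)\<close>, which sends the moments of \<open>\<mu>\<close> to the integrals
  of the derivatives of the monomials, is a contraction in the weighted \<open>\<ell>\<^sup>2\<close> norm
  (\<open>summable_gap_weight_lower\<close>).

  Suppose \<open>u > v\<close> somewhere. A slope \<open>\<rho> t\<close> is added to \<open>u\<close>, with \<open>\<rho> > 0\<close> so small that the maximum
  of \<open>u - v + \<rho> t\<close> is still not attained at time \<open>T\<close>. Maximising
  \<open>u(z) - v(w) + \<rho> t - \<kappa>/2 gap(z, w)\<close> over pairs and letting \<open>\<kappa> \<rightarrow> \<infinity>\<close>, compactness gives maximisers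
  before time \<open>T\<close> with \<open>\<kappa> gap(z, w) \<rightarrow> 0\<close> (\<open>doubling\<close>). The viscosity inequalities hold at every
  point of the domain, including those where the exponential constraint is active or \<open>t = 0\<close>, so the
  maximisers may lie there. Subtracting the two inequalities leaves
  \<open>\<rho> \<le> H(z, p) - H(w, p)\<close>, with the same \<open>p\<close> on both sides.

  Since the coefficients depend on the state only through the joint law, the Hamiltonian is the
  infimum over \<open>\<gamma> \<in> \<Pi>\<^bsub>\<mu>\<^sub>2\<^esub>\<close> of an expression linear in the integrals of \<open>p\<close> and \<open>p'\<close>. A control for
  \<open>\<nu>\<^sub>2\<close> is transplanted to \<open>\<mu>\<^sub>2\<close> by keeping its control marginal, and the coefficients then change by
  at most a constant times \<open>|t - s| + \<Sum>\<^sub>i |m\<^sub>i(\<mu>\<^sub>2) - m\<^sub>i(\<nu>\<^sub>2)|\<close>, while the integrals of \<open>p\<close> and \<open>p'\<close>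
  change by at most \<open>\<kappa> gap\<close>. The outcome (\<open>hamiltonian_diff\<close>) is
  \<open>H(z, p) - H(w, p) \<le> const \<kappa> gap(z, w) \<rightarrow> 0\<close>, which contradicts \<open>\<rho> > 0\<close>.
\<close>

section \<open>Measures with exponential moments\<close>

definition moment :: "real measure \<Rightarrow> nat \<Rightarrow> real" where
  "moment \<mu> j = (LINT x|\<mu>. x ^ j)"

text \<open>
  With \<open>R = N e^{K T}\<close>, where \<open>K\<close> is \<^const>\<open>K_star\<close>, this class contains both measure components of
  every state of the closed domain.
\<close>

definition exp_class :: "real \<Rightarrow> real \<Rightarrow> real measure set" where
  "exp_class \<delta> R = {\<mu>. prob_space \<mu> \<and> sets \<mu> = sets borel \<and>
     integrable \<mu> (e_weight \<delta>) \<and> (LINT x|\<mu>. e_weight \<delta> x) \<le> R}"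

text \<open>
  The bound on the \<open>j\<close>-th absolute moment over \<open>exp_class \<delta> R\<close> that results from
  \<open>|x|^j \<le> j! \<delta>^{-j} e^{\<delta>|x|}\<close>.
\<close>

definition moment_bound :: "real \<Rightarrow> real \<Rightarrow> nat \<Rightarrow> real" where
  "moment_bound \<delta> R j = R * exp \<delta> * fact j / \<delta> ^ j"

lemma e_weight_measurable [measurable]: "e_weight \<delta> \<in> borel_measurable borel"
  unfolding e_weight_def by measurable

lemma continuous_e_weight: "continuous_on UNIV (e_weight \<delta>)"
  unfolding e_weight_def by (intro continuous_intros)

lemma e_weight_pos: "e_weight \<delta> x > 0"
  unfolding e_weight_def by simp

lemma e_weight_ge_1: "\<delta> > 0 \<Longrightarrow> e_weight \<delta> x \<ge> 1"
  unfolding e_weight_def by simp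

lemma exp_abs_le_e_weight:
  assumes "\<delta> > 0" shows "exp (\<delta> * \<bar>x\<bar>) \<le> exp \<delta> * e_weight \<delta> x"
proof -
  have "\<bar>x\<bar> \<le> sqrt (x\<^sup>2 + 1)"
    using real_sqrt_le_mono[of "x\<^sup>2" "x\<^sup>2 + 1"] by simp
  hence "\<delta> * \<bar>x\<bar> \<le> \<delta> + \<delta> * (sqrt (x\<^sup>2 + 1) - 1)"
    using assms by (simp add: algebra_simps)
  thus ?thesis unfolding e_weight_def by (simp add: exp_add[symmetric])
qed

lemma power_le_fact_exp:
  assumes "(y::real) \<ge> 0" shows "y ^ j \<le> fact j * exp y"
proof -
  have "y ^ j / fact j \<le> exp y"
    using sum_le_suminf[OF summable_exp, of "{j}" y] assms by (simp add: exp_def field_simps)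
  thus ?thesis by (simp add: field_simps)
qed

lemma abs_power_le_e_weight:
  assumes "\<delta> > 0" shows "\<bar>x\<bar> ^ j \<le> exp \<delta> * fact j / \<delta> ^ j * e_weight \<delta> x"
proof -
  have "(\<delta> * \<bar>x\<bar>) ^ j \<le> fact j * exp (\<delta> * \<bar>x\<bar>)"
    using assms by (intro power_le_fact_exp) auto
  also have "\<dots> \<le> fact j * (exp \<delta> * e_weight \<delta> x)"
    using exp_abs_le_e_weight[OF assms] by (intro mult_left_mono) auto
  finally show ?thesis using assms by (simp add: field_simps power_mult_distrib)
qed

lemma exp_classD:
  assumes "\<mu> \<in> exp_class \<delta> R"
  shows "prob_space \<mu>" "sets \<mu> = sets borel" "space \<mu> = UNIV"
    "integrable \<mu> (e_weight \<delta>)" "(LINT x|\<mu>. e_weight \<delta> x) \<le> R"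
    "finite_measure \<mu>" "real_distribution \<mu>"
proof -
  show "prob_space \<mu>" "sets \<mu> = sets borel" "integrable \<mu> (e_weight \<delta>)"
    "(LINT x|\<mu>. e_weight \<delta> x) \<le> R"
    using assms by (auto simp: exp_class_def)
  from sets_eq_imp_space_eq[OF this(2)] show sp: "space \<mu> = UNIV" by simp
  show "finite_measure \<mu>" using \<open>prob_space \<mu>\<close> by (rule prob_space.finite_measure)
  show "real_distribution \<mu>"
    using \<open>prob_space \<mu>\<close> \<open>sets \<mu> = sets borel\<close> sp
    by (simp add: real_distribution_def real_distribution_axioms_def)
qed

lemma exp_class_ge_1: assumes "\<mu> \<in> exp_class \<delta> R" "\<delta> > 0" shows "R \<ge> 1"
proof -
  interpret prob_space \<mu> using exp_classD[OF assms(1)] by simp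
  have "(LINT x|\<mu>. 1) \<le> (LINT x|\<mu>. e_weight \<delta> x)"
    using exp_classD[OF assms(1)] e_weight_ge_1[OF assms(2)] by (intro integral_mono) auto
  thus ?thesis using exp_classD[OF assms(1)] prob_space by simp
qed

lemma exp_class_abs_power:
  assumes "\<mu> \<in> exp_class \<delta> R" "\<delta> > 0"
  shows "integrable \<mu> (\<lambda>x. \<bar>x\<bar> ^ j)" "integrable \<mu> (\<lambda>x. x ^ j)"
    "(LINT x|\<mu>. \<bar>x\<bar> ^ j) \<le> moment_bound \<delta> R j"
proof -
  note D = exp_classD[OF assms(1)]
  note [measurable_cong] = D(2)
  let ?K = "exp \<delta> * fact j / \<delta> ^ j"
  have b: "\<bar>x\<bar> ^ j \<le> ?K * e_weight \<delta> x" for x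
    by (rule abs_power_le_e_weight[OF assms(2)])
  have K: "?K \<ge> 0" using assms by simp
  have b': "norm (\<bar>x\<bar> ^ j) \<le> norm (?K * e_weight \<delta> x)" "norm (x ^ j) \<le> norm (?K * e_weight \<delta> x)" for x
    using b[of x] K e_weight_pos[of \<delta> x] assms(2) by (auto simp: power_abs abs_mult)
  have i: "integrable \<mu> (\<lambda>x. ?K * e_weight \<delta> x)" using D(4) by simp
  show 1: "integrable \<mu> (\<lambda>x. \<bar>x\<bar> ^ j)"
    by (rule Bochner_Integration.integrable_bound[OF i]) (use b' in auto)
  show "integrable \<mu> (\<lambda>x. x ^ j)"
    by (rule Bochner_Integration.integrable_bound[OF i]) (use b' in auto)
  have "(LINT x|\<mu>. \<bar>x\<bar> ^ j) \<le> (LINT x|\<mu>. ?K * e_weight \<delta> x)"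
    by (rule integral_mono[OF 1 i]) (rule b)
  also have "\<dots> = ?K * (LINT x|\<mu>. e_weight \<delta> x)" by simp
  also have "\<dots> \<le> ?K * R" using K D(5) by (intro mult_left_mono)
  finally show "(LINT x|\<mu>. \<bar>x\<bar> ^ j) \<le> moment_bound \<delta> R j" by (simp add: moment_bound_def mult_ac)
qed

lemma abs_moment_le:
  assumes "\<mu> \<in> exp_class \<delta> R" "\<delta> > 0"
  shows "\<bar>moment \<mu> j\<bar> \<le> moment_bound \<delta> R j"
proof -
  have "\<bar>moment \<mu> j\<bar> \<le> (LINT x|\<mu>. \<bar>x ^ j\<bar>)"
    unfolding moment_def using integral_norm_bound[of \<mu> "\<lambda>x. x ^ j"] by simp
  also have "\<dots> \<le> moment_bound \<delta> R j" using exp_class_abs_power(3)[OF assms, of j] by (simp add: power_abs)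
  finally show ?thesis .
qed

lemma moment_0 [simp]: "\<mu> \<in> exp_class \<delta> R \<Longrightarrow> moment \<mu> 0 = 1"
  using prob_space.prob_space[OF exp_classD(1)] by (simp add: moment_def)

lemma moment_bound_nonneg: "\<delta> > 0 \<Longrightarrow> R \<ge> 0 \<Longrightarrow> moment_bound \<delta> R j \<ge> 0"
  by (simp add: moment_bound_def)

text \<open>
  Markov's inequality for the first moment.
\<close>

lemma tight_exp_class:
  assumes "\<And>n. \<mu> n \<in> exp_class \<delta> R" "\<delta> > 0"
  shows "tight \<mu>"
  unfolding tight_def
proof (intro conjI allI impI)
  fix n show "real_distribution (\<mu> n)" using exp_classD[OF assms(1)] by simp
next
  fix \<epsilon> :: real assume "\<epsilon> > 0"
  let ?M = "moment_bound \<delta> R 1"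
  have M: "?M \<ge> 0" using exp_class_ge_1[OF assms(1) assms(2)] assms(2) by (intro moment_bound_nonneg) auto
  define a where "a = (?M + 1) / \<epsilon>"
  have a: "a > 0" "?M / a < \<epsilon>" using M \<open>\<epsilon> > 0\<close>
    by (auto simp: a_def field_simps add_pos_nonneg)
  have "measure (\<mu> n) {-a<..a} > 1 - \<epsilon>" for n
  proof -
    note D = exp_classD[OF assms(1)[of n]]
    note [measurable_cong] = D(2)
    interpret prob_space "\<mu> n" by (rule D)
    have "measure (\<mu> n) {x\<in>space (\<mu> n). \<bar>x\<bar> \<ge> a} \<le> (LINT x|\<mu> n. \<bar>x\<bar>) / a"
      using exp_class_abs_power[OF assms(1)[of n] assms(2), of 1] a
      by (intro integral_Markov_inequality_measure[where A="{}"]) (auto)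
    also have "\<dots> \<le> ?M / a" using exp_class_abs_power(3)[OF assms(1)[of n] assms(2), of 1] a
      by (intro divide_right_mono) auto
    finally have "measure (\<mu> n) {x. \<bar>x\<bar> \<ge> a} < \<epsilon>" using a D by simp
    moreover have "measure (\<mu> n) (space (\<mu> n) - {-a<..a}) \<le> measure (\<mu> n) {x. \<bar>x\<bar> \<ge> a}"
      by (intro finite_measure_mono) (auto simp: D(2))
    moreover have "measure (\<mu> n) (space (\<mu> n) - {-a<..a}) = 1 - measure (\<mu> n) {-a<..a}"
      by (intro prob_compl) (auto simp: D)
    ultimately show ?thesis by simp
  qed
  thus "\<exists>a b. a < b \<and> (\<forall>n. measure (\<mu> n) {a<..b} > 1 - \<epsilon>)" using a(1)
    by (intro exI[of _ "-a"] exI[of _ a]) auto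
qed

lemma weak_conv_m_bdd_continuous:
  fixes f :: "real \<Rightarrow> real"
  assumes "\<And>n. real_distribution (\<mu> n)" "real_distribution M" "weak_conv_m \<mu> M"
    and "continuous_on UNIV f" "\<And>x. \<bar>f x\<bar> \<le> B"
  shows "(\<lambda>n. LINT x|\<mu> n. f x) \<longlonglongrightarrow> (LINT x|M. f x)"
  by (rule weak_conv_imp_integral_bdd_continuous_conv[OF assms(1-3)])
     (use assms(4,5) in \<open>auto simp: continuous_on_eq_continuous_at\<close>)

text \<open>
  Truncating the weight at level \<open>k\<close> gives a bounded continuous function, so the bound on the
  truncated integral survives the weak limit; Fatou's lemma then removes the truncation. The radius
  varies along the sequence because the constraint of the domain depends on time.
\<close>

lemma exp_class_limit:
  assumes \<mu>: "\<And>n. \<mu> n \<in> exp_class \<delta> R0" and \<delta>: "\<delta> > 0"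
    and M: "real_distribution M" "weak_conv_m \<mu> M"
    and R: "\<And>n. (LINT x|\<mu> n. e_weight \<delta> x) \<le> R n" "R \<longlonglongrightarrow> R'"
  shows "M \<in> exp_class \<delta> R'"
proof -
  interpret M: real_distribution M by (rule M)
  note [measurable_cong] = M.events_eq_borel
  let ?f = "\<lambda>k x. min (e_weight \<delta> x) (real k)"
  have le: "(LINT x|M. ?f k x) \<le> R'" for k
  proof (rule LIMSEQ_le[OF _ R(2)])
    show "(\<lambda>n. LINT x|\<mu> n. ?f k x) \<longlonglongrightarrow> (LINT x|M. ?f k x)"
      using e_weight_pos[of \<delta>]
      by (intro weak_conv_m_bdd_continuous[where B="real k"] exp_classD(7)[OF \<mu>] M continuous_intros
          continuous_e_weight) (auto simp: abs_if min_def less_le_not_le)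
    have "(LINT x|\<mu> n. ?f k x) \<le> R n" for n
    proof -
      note D = exp_classD[OF \<mu>[of n]]
      note [measurable_cong] = D(2)
      have "(LINT x|\<mu> n. ?f k x) \<le> (LINT x|\<mu> n. e_weight \<delta> x)"
        using e_weight_pos[of \<delta>] D(4)
        by (intro integral_mono Bochner_Integration.integrable_bound[OF D(4)])
           (auto simp: abs_if min_def less_le_not_le)
      thus ?thesis using R(1)[of n] by simp
    qed
    thus "\<exists>N. \<forall>n\<ge>N. (LINT x|\<mu> n. ?f k x) \<le> R n" by auto
  qed
  have R'0: "R' \<ge> 0" using le[of 0] e_weight_pos[of \<delta>] by (simp add: min_absorb2 less_imp_le)
  have nn: "(\<integral>\<^sup>+x. ennreal (e_weight \<delta> x) \<partial>M) \<le> ennreal R'"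
  proof -
    have "(\<integral>\<^sup>+x. ennreal (e_weight \<delta> x) \<partial>M) \<le> (\<integral>\<^sup>+x. liminf (\<lambda>k. ennreal (?f k x)) \<partial>M)"
    proof (intro nn_integral_mono)
      fix x
      have "(\<lambda>k. ?f k x) \<longlonglongrightarrow> e_weight \<delta> x"
      proof (rule tendsto_eventually)
        show "\<forall>\<^sub>F k in sequentially. ?f k x = e_weight \<delta> x"
          using eventually_ge_at_top[of "nat \<lceil>e_weight \<delta> x\<rceil>"]
          by eventually_elim (simp add: min_def nat_le_iff ceiling_le_iff)
      qed
      hence "(\<lambda>k. ennreal (?f k x)) \<longlonglongrightarrow> ennreal (e_weight \<delta> x)" by simp
      thus "ennreal (e_weight \<delta> x) \<le> liminf (\<lambda>k. ennreal (?f k x))"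
        by (simp add: lim_imp_Liminf)
    qed
    also have "\<dots> \<le> liminf (\<lambda>k. \<integral>\<^sup>+x. ennreal (?f k x) \<partial>M)"
      by (rule nn_integral_liminf) measurable
    also have "\<dots> \<le> ennreal R'"
    proof -
      have "(\<integral>\<^sup>+x. ennreal (?f k x) \<partial>M) \<le> ennreal R'" for k
      proof -
        have "integrable M (?f k)"
          by (rule M.integrable_const_bound[where B="real k"])
             (use e_weight_pos[of \<delta>] in \<open>auto simp: abs_if min_def less_le_not_le\<close>)
        hence "(\<integral>\<^sup>+x. ennreal (?f k x) \<partial>M) = ennreal (LINT x|M. ?f k x)"
          using e_weight_pos[of \<delta>] by (intro nn_integral_eq_integral) (auto simp: less_imp_le)
        thus ?thesis using le[of k] by (simp add: ennreal_leI)
      qed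
      hence "liminf (\<lambda>k. \<integral>\<^sup>+x. ennreal (?f k x) \<partial>M) \<le> liminf (\<lambda>k::nat. ennreal R')"
        by (intro Liminf_mono always_eventually) auto
      thus ?thesis by (simp add: Liminf_const)
    qed
    finally show ?thesis .
  qed
  have int: "integrable M (e_weight \<delta>)"
    by (rule integrableI_nonneg) (use e_weight_pos[of \<delta>] nn in
        \<open>auto simp: less_imp_le intro: order.strict_trans1[OF _ ennreal_less_top]\<close>)
  have "ennreal (LINT x|M. e_weight \<delta> x) \<le> ennreal R'"
    using nn nn_integral_eq_integral[OF int] e_weight_pos[of \<delta>] by (simp add: less_imp_le)
  hence "(LINT x|M. e_weight \<delta> x) \<le> R'" using R'0 by (simp add: ennreal_le_iff)
  thus ?thesis using int M.prob_space_axioms M.events_eq_borel by (simp add: exp_class_def)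
qed

text \<open>
  Clipping \<open>x\<close> to \<open>[-k, k]\<close> makes the monomial bounded and costs at most the moment of order
  \<open>j + 1\<close> divided by \<open>k\<close>, uniformly over the class.
\<close>

lemma exp_class_moment_limit:
  assumes \<mu>: "\<And>n. \<mu> n \<in> exp_class \<delta> R" and \<delta>: "\<delta> > 0"
    and M: "M \<in> exp_class \<delta> R" "weak_conv_m \<mu> M"
  shows "(\<lambda>n. moment (\<mu> n) j) \<longlonglongrightarrow> moment M j"
proof -
  let ?g = "\<lambda>k x::real. (max (-k) (min k x)) ^ j"
  let ?A = "moment_bound \<delta> R (Suc j)"
  have A: "?A \<ge> 0" using exp_class_ge_1[OF M(1) \<delta>] \<delta> by (intro moment_bound_nonneg) auto
  have gb: "\<bar>?g k x\<bar> \<le> k ^ j" if "k > 0" for k x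
    using that by (auto simp: power_abs intro!: power_mono)
  have diff: "\<bar>moment \<nu> j - (LINT x|\<nu>. ?g k x)\<bar> \<le> ?A / k" if "\<nu> \<in> exp_class \<delta> R" "k > 0" for \<nu> k
  proof -
    note D = exp_classD[OF that(1)]
    note [measurable_cong] = D(2)
    interpret prob_space \<nu> by (rule D)
    note P = exp_class_abs_power[OF that(1) \<delta>]
    have ig: "integrable \<nu> (?g k)"
      by (rule integrable_const_bound[where B="k ^ j"]) (use gb[OF that(2)] in auto)
    have pt: "\<bar>x ^ j - ?g k x\<bar> \<le> \<bar>x\<bar> ^ Suc j / k" for x
    proof (cases "\<bar>x\<bar> \<le> k")
      case True thus ?thesis using that(2) by (auto simp: max_def min_def)
    next
      case False
      have "\<bar>x ^ j - ?g k x\<bar> \<le> \<bar>x\<bar> ^ j"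
      proof (cases "x > 0")
        case True
        hence "?g k x = k ^ j" "x > k" using False that(2) by (auto simp: max_def min_def)
        moreover have "k ^ j \<le> x ^ j" using \<open>x > k\<close> that(2) by (intro power_mono) auto
        ultimately show ?thesis using that(2) True by (simp add: abs_if power_abs[symmetric])
      next
        case F: False
        hence "?g k x = (- k) ^ j" "- x > k" using False that(2) by (auto simp: max_def min_def)
        moreover have "k ^ j \<le> (- x) ^ j" using \<open>- x > k\<close> that(2) by (intro power_mono) auto
        moreover have "x ^ j - (- k) ^ j = (- 1) ^ j * ((- x) ^ j - k ^ j)"
          by (simp add: algebra_simps power_mult_distrib[symmetric])
        ultimately show ?thesis using that(2) F by (simp add: abs_mult power_abs[symmetric])
      qed
      also have "\<dots> \<le> \<bar>x\<bar> ^ Suc j / k"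
        using False that(2) by (auto simp: field_simps intro!: mult_right_mono)
      finally show ?thesis .
    qed
    have "\<bar>moment \<nu> j - (LINT x|\<nu>. ?g k x)\<bar> = \<bar>LINT x|\<nu>. x ^ j - ?g k x\<bar>"
      unfolding moment_def by (subst Bochner_Integration.integral_diff[OF P(2) ig]) simp
    also have "\<dots> \<le> (LINT x|\<nu>. \<bar>x ^ j - ?g k x\<bar>)"
      using integral_norm_bound[of \<nu> "\<lambda>x. x ^ j - ?g k x"] by simp
    also have "\<dots> \<le> (LINT x|\<nu>. \<bar>x\<bar> ^ Suc j / k)"
      using ig P(2)[of j] P(1)[of "Suc j"] pt
      by (intro integral_mono integrable_abs Bochner_Integration.integrable_diff integrable_divide) auto
    also have "\<dots> \<le> ?A / k"
      using P(3)[of "Suc j"] that(2) by (simp add: divide_right_mono)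
    finally show ?thesis .
  qed
  show ?thesis
  proof (rule LIMSEQ_I)
    fix r :: real assume r: "r > 0"
    define k where "k = 4 * (?A + 1) / r"
    have k: "k > 0" "?A / k < r / 4" using A r by (auto simp: k_def field_simps add_pos_nonneg)
    have "(\<lambda>n. LINT x|\<mu> n. ?g k x) \<longlonglongrightarrow> (LINT x|M. ?g k x)"
      by (rule weak_conv_m_bdd_continuous[where B="k ^ j"])
         (use gb[OF k(1)] M exp_classD[OF \<mu>] exp_classD[OF M(1)] in \<open>auto intro!: continuous_intros\<close>)
    from LIMSEQ_D[OF this, of "r/4"] r obtain n0
      where n0: "\<And>n. n \<ge> n0 \<Longrightarrow> \<bar>(LINT x|\<mu> n. ?g k x) - (LINT x|M. ?g k x)\<bar> < r / 4" by auto
    show "\<exists>no. \<forall>n\<ge>no. norm (moment (\<mu> n) j - moment M j) < r"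
    proof (intro exI[of _ n0] allI impI)
      fix n assume "n \<ge> n0"
      show "norm (moment (\<mu> n) j - moment M j) < r"
        using n0[OF \<open>n \<ge> n0\<close>] diff[OF \<mu>[of n] k(1)] diff[OF M(1) k(1)] k(2) r
        unfolding real_norm_def by linarith
    qed
  qed
qed

text \<open>
  Up to the factor \<open>i^k\<close> this is the \<open>k\<close>-th derivative of the characteristic function.
\<close>

section \<open>Determinacy of the moment problem\<close>

definition char_deriv :: "real measure \<Rightarrow> nat \<Rightarrow> real \<Rightarrow> complex" where
  "char_deriv \<mu> k t = (CLINT x|\<mu>. complex_of_real (x ^ k) * iexp (t * x))"

text \<open>
  The Taylor expansion at \<open>t\<close>. Half of the exponential weight dominates \<open>e^{|h||x|}\<close> and the other
  half the factor \<open>|x|^k\<close>, whence the restriction \<open>|h| \<le> \<delta>/2\<close>; what matters is that this radius does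
  not depend on \<open>t\<close>.
\<close>

lemma char_deriv_shift:
  assumes \<mu>: "\<mu> \<in> exp_class \<delta> R" and \<delta>: "\<delta> > 0" and h: "\<bar>h\<bar> \<le> \<delta> / 2"
  shows "(\<lambda>m. (\<i> * h) ^ m / fact m * char_deriv \<mu> (k + m) t) sums char_deriv \<mu> k (t + h)"
proof -
  note D = exp_classD[OF \<mu>]
  note [measurable_cong] = D(2)
  interpret prob_space \<mu> by (rule D)
  define f where "f m x = (\<i> * h) ^ m / fact m * (complex_of_real (x ^ (k + m)) * iexp (t * x))"
    for m :: nat and x :: real
  have nf: "norm (f m x) = \<bar>h\<bar> ^ m / fact m * \<bar>x\<bar> ^ (k + m)" for m x
    by (simp add: f_def norm_mult norm_power norm_divide power_abs)
  define K where "K = fact k / (\<delta>/2) ^ k * exp \<delta>"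
  have K: "K \<ge> 0" using \<delta> by (simp add: K_def)
  have sums_nf: "(\<lambda>m. norm (f m x)) sums (\<bar>x\<bar> ^ k * exp (\<bar>h\<bar> * \<bar>x\<bar>))" for x
    using sums_mult[OF exp_converges[of "\<bar>h\<bar> * \<bar>x\<bar>"], of "\<bar>x\<bar> ^ k"]
    by (simp add: nf power_add power_mult_distrib field_simps)
  have dom: "\<bar>x\<bar> ^ k * exp (\<bar>h\<bar> * \<bar>x\<bar>) \<le> K * e_weight \<delta> x" for x
  proof -
    have "(\<delta>/2 * \<bar>x\<bar>) ^ k \<le> fact k * exp (\<delta>/2 * \<bar>x\<bar>)"
      using \<delta> by (intro power_le_fact_exp) auto
    hence a: "\<bar>x\<bar> ^ k \<le> fact k / (\<delta>/2) ^ k * exp (\<delta>/2 * \<bar>x\<bar>)"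
      using \<delta> by (simp add: field_simps power_mult_distrib)
    have b: "exp (\<bar>h\<bar> * \<bar>x\<bar>) \<le> exp (\<delta>/2 * \<bar>x\<bar>)"
      using mult_right_mono[OF h, of "\<bar>x\<bar>"] by simp
    have "\<bar>x\<bar> ^ k * exp (\<bar>h\<bar> * \<bar>x\<bar>) \<le> (fact k / (\<delta>/2) ^ k * exp (\<delta>/2 * \<bar>x\<bar>)) * exp (\<delta>/2 * \<bar>x\<bar>)"
      by (intro mult_mono a b) (use \<delta> in auto)
    also have "\<dots> = fact k / (\<delta>/2) ^ k * exp (\<delta> * \<bar>x\<bar>)"
      by (simp add: exp_add[symmetric] mult.assoc)
    also have "\<dots> \<le> fact k / (\<delta>/2) ^ k * (exp \<delta> * e_weight \<delta> x)"
      using exp_abs_le_e_weight[OF \<delta>, of x] \<delta> by (intro mult_left_mono) auto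
    finally show ?thesis by (simp add: K_def)
  qed
  have [measurable]: "f m \<in> borel_measurable \<mu>" for m unfolding f_def by measurable
  have intn: "integrable \<mu> (\<lambda>x. norm (f m x))" for m
    unfolding nf using exp_class_abs_power(1)[OF \<mu> \<delta>] by simp
  have int: "integrable \<mu> (f m)" for m
    using intn[of m] by (subst (asm) integrable_norm_iff) auto
  have intdom: "integrable \<mu> (\<lambda>x. K * e_weight \<delta> x)" using D(4) by simp
  have summ: "summable (\<lambda>m. LINT x|\<mu>. norm (f m x))"
  proof (rule summableI_nonneg_bounded)
    fix n
    have "(\<Sum>m<n. (LINT x|\<mu>. norm (f m x))) = (LINT x|\<mu>. (\<Sum>m<n. norm (f m x)))"
      by (rule Bochner_Integration.integral_sum[symmetric]) (rule intn)
    also have "\<dots> \<le> (LINT x|\<mu>. K * e_weight \<delta> x)"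
    proof (intro integral_mono intdom Bochner_Integration.integrable_sum intn)
      fix x
      have "(\<Sum>m<n. norm (f m x)) \<le> \<bar>x\<bar> ^ k * exp (\<bar>h\<bar> * \<bar>x\<bar>)"
        using sums_nf[of x] by (metis finite_lessThan norm_ge_zero sum_le_suminf sums_iff)
      thus "(\<Sum>m<n. norm (f m x)) \<le> K * e_weight \<delta> x" using dom[of x] by linarith
    qed
    finally show "(\<Sum>m<n. (LINT x|\<mu>. norm (f m x))) \<le> (LINT x|\<mu>. K * e_weight \<delta> x)" .
  qed (auto intro: integral_nonneg_AE)
  have "(\<lambda>m. integral\<^sup>L \<mu> (f m)) sums (\<integral>x. (\<Sum>m. f m x) \<partial>\<mu>)"
    by (rule sums_integral[OF int _ summ]) (use sums_nf in \<open>auto simp: sums_iff\<close>)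
  moreover have "integral\<^sup>L \<mu> (f m) = (\<i> * h) ^ m / fact m * char_deriv \<mu> (k + m) t" for m
    unfolding f_def char_deriv_def by (rule integral_mult_right_zero)
  moreover have "(\<Sum>m. f m x) = complex_of_real (x ^ k) * iexp ((t + h) * x)" for x
  proof -
    have "(\<lambda>m. (\<i> * h * x) ^ m /\<^sub>R fact m) sums exp (\<i> * h * x)"
      by (rule exp_converges)
    hence "(\<lambda>m. (complex_of_real (x ^ k) * iexp (t * x)) * ((\<i> * h * x) ^ m /\<^sub>R fact m)) sums
        ((complex_of_real (x ^ k) * iexp (t * x)) * exp (\<i> * h * x))"
      by (rule sums_mult)
    moreover have "(complex_of_real (x ^ k) * iexp (t * x)) * ((\<i> * h * x) ^ m /\<^sub>R fact m) = f m x" for m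
      by (simp add: f_def power_add power_mult_distrib scaleR_conv_of_real field_simps)
    moreover have "(complex_of_real (x ^ k) * iexp (t * x)) * exp (\<i> * h * x) =
        complex_of_real (x ^ k) * iexp ((t + h) * x)"
      by (simp add: exp_add[symmetric] algebra_simps)
    ultimately show ?thesis by (simp add: sums_iff)
  qed
  ultimately show ?thesis by (simp add: char_deriv_def)
qed

text \<open>
  Equal moments mean that the characteristic functions have the same derivatives at 0. By the Taylor
  expansion all derivatives agree on an interval of radius \<open>\<delta>/2\<close> around any point where they
  agree, so finitely many steps reach every point of the line.
\<close>

theorem exp_class_moment_determinacy:
  assumes \<mu>: "\<mu> \<in> exp_class \<delta> R" and \<nu>: "\<nu> \<in> exp_class \<delta> R" and \<delta>: "\<delta> > 0"
    and eq: "\<And>j. moment \<mu> j = moment \<nu> j"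
  shows "\<mu> = \<nu>"
proof -
  have step: "\<forall>k t. \<bar>t\<bar> \<le> real n * (\<delta> / 2) \<longrightarrow> char_deriv \<mu> k t = char_deriv \<nu> k t" for n
  proof (induction n)
    case 0
    have "char_deriv M k 0 = complex_of_real (moment M k)" for M k
    proof -
      have "char_deriv M k 0 = (CLINT x|M. complex_of_real (x ^ k))" by (simp add: char_deriv_def)
      also have "\<dots> = complex_of_real (moment M k)"
        unfolding moment_def by (rule integral_complex_of_real)
      finally show ?thesis .
    qed
    thus ?case using eq by simp
  next
    case (Suc n)
    show ?case
    proof (intro allI impI)
      fix k and t :: real assume t: "\<bar>t\<bar> \<le> real (Suc n) * (\<delta> / 2)"
      \<comment> \<open>the point of the inner interval closest to \<open>t\<close>\<close>
      define s where "s = max (- (real n * (\<delta> / 2))) (min (real n * (\<delta> / 2)) t)"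
      have nn: "real n * (\<delta> / 2) \<ge> 0" using \<delta> by simp
      have t': "\<bar>t\<bar> \<le> real n * (\<delta> / 2) + \<delta> / 2" using t by (simp add: algebra_simps)
      have s: "\<bar>s\<bar> \<le> real n * (\<delta> / 2)" "\<bar>t - s\<bar> \<le> \<delta> / 2"
        using nn t' \<delta> unfolding s_def by linarith+
      have "(\<lambda>m. (\<i> * (t - s)) ^ m / fact m * char_deriv \<mu> (k + m) s) sums char_deriv \<mu> k (s + (t - s))"
        using char_deriv_shift[OF \<mu> \<delta> s(2), of k s] by simp
      moreover have "(\<lambda>m. (\<i> * (t - s)) ^ m / fact m * char_deriv \<nu> (k + m) s) sums char_deriv \<nu> k (s + (t - s))"
        using char_deriv_shift[OF \<nu> \<delta> s(2), of k s] by simp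
      ultimately show "char_deriv \<mu> k t = char_deriv \<nu> k t"
        using Suc s(1) sums_unique2 by auto
    qed
  qed
  have "char \<mu> t = char \<nu> t" for t
  proof -
    obtain n :: nat where "\<bar>t\<bar> / (\<delta> / 2) \<le> real n" using real_arch_simple by blast
    hence "\<bar>t\<bar> \<le> real n * (\<delta> / 2)" using \<delta> by (simp add: field_simps)
    with step have "char_deriv \<mu> 0 t = char_deriv \<nu> 0 t" by blast
    thus ?thesis by (simp add: char_deriv_def char_def)
  qed
  hence "char \<mu> = char \<nu>" by auto
  thus ?thesis using Levy_uniqueness exp_classD(7)[OF \<mu>] exp_classD(7)[OF \<nu>] by blast
qed

text \<open>
  The exponent 4 balances two demands. Against the moment bounds, whose squares grow like \<open>(j!)\<^sup>2\<close> times a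
  geometric factor, the weights must be summable; and passing from index \<open>j + 1\<close> to \<open>j\<close> must gain the factor
  \<open>(j + 1)\<^sup>2\<close> produced by differentiating a monomial.
\<close>

section \<open>Weighted sequences and power series\<close>

definition gap_weight :: "nat \<Rightarrow> real" where "gap_weight j = 1 / fact j ^ 4"

text \<open>
  Differentiation of monomials on the level of moments: \<open>lower (moment \<mu>) j\<close> is the integral of the
  derivative of \<open>x^j\<close>, and \<open>lower (\<lambda>i. y ^ i) j\<close> is that derivative at \<open>y\<close>.
\<close>

definition lower :: "(nat \<Rightarrow> real) \<Rightarrow> nat \<Rightarrow> real" where
  "lower l j = real j * l (j - 1)"

lemma gap_weight_pos: "gap_weight j > 0" by (simp add: gap_weight_def)

lemma lower_0 [simp]: "lower l 0 = 0" by (simp add: lower_def)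
lemma lower_Suc: "lower l (Suc j) = real (Suc j) * l j" by (simp add: lower_def)

lemma lower_diff: "lower (\<lambda>j. l j - m j) = (\<lambda>j. lower l j - lower m j)"
  by (auto simp: lower_def algebra_simps)

lemma gap_weight_lower: "gap_weight (Suc j) * (lower l (Suc j))\<^sup>2 \<le> gap_weight j * (l j)\<^sup>2"
proof -
  have "gap_weight (Suc j) * (real (Suc j))\<^sup>2 = gap_weight j / (real (Suc j))\<^sup>2"
    by (simp add: gap_weight_def power_mult_distrib power2_eq_square power4_eq_xxxx)
  also have "\<dots> \<le> gap_weight j" using gap_weight_pos[of j] by (simp add: divide_le_eq mult_le_cancel_left1)
  finally have "(gap_weight (Suc j) * (real (Suc j))\<^sup>2) * (l j)\<^sup>2 \<le> gap_weight j * (l j)\<^sup>2"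
    by (rule mult_right_mono) simp
  thus ?thesis by (simp add: lower_Suc power_mult_distrib mult_ac)
qed

text \<open>
  Differentiation does not increase the weighted \<open>\<ell>\<^sup>2\<close> norm. This is what keeps the integrals of the
  gradient of the penalty comparable to the penalty itself.
\<close>

lemma summable_gap_weight_lower:
  assumes "summable (\<lambda>j. gap_weight j * (l j)\<^sup>2)"
  shows "summable (\<lambda>j. gap_weight j * (lower l j)\<^sup>2)"
    and "(\<Sum>j. gap_weight j * (lower l j)\<^sup>2) \<le> (\<Sum>j. gap_weight j * (l j)\<^sup>2)"
proof -
  have s: "summable (\<lambda>j. gap_weight (Suc j) * (lower l (Suc j))\<^sup>2)"
    by (rule summable_comparison_test'[OF assms, of 0])
       (use gap_weight_lower[of _ l] gap_weight_pos in \<open>simp add: less_imp_le abs_mult\<close>)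
  thus *: "summable (\<lambda>j. gap_weight j * (lower l j)\<^sup>2)" by (subst (asm) summable_Suc_iff)
  show "(\<Sum>j. gap_weight j * (lower l j)\<^sup>2) \<le> (\<Sum>j. gap_weight j * (l j)\<^sup>2)"
    using suminf_split_head[OF *] suminf_le[OF gap_weight_lower s assms] by simp
qed

text \<open>
  Young's inequality in each term.
\<close>

lemma gap_weight_pairing:
  assumes "summable (\<lambda>j. gap_weight j * (d j)\<^sup>2)" "summable (\<lambda>j. gap_weight j * (x j)\<^sup>2)"
  shows "summable (\<lambda>j. \<bar>gap_weight j * d j * x j\<bar>)"
    and "\<bar>\<Sum>j. gap_weight j * d j * x j\<bar> \<le> 1/2 * ((\<Sum>j. gap_weight j * (d j)\<^sup>2) + (\<Sum>j. gap_weight j * (x j)\<^sup>2))"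
proof -
  have t: "\<bar>gap_weight j * d j * x j\<bar> \<le> 1/2 * (gap_weight j * (d j)\<^sup>2 + gap_weight j * (x j)\<^sup>2)" for j
  proof -
    have "2 * (\<bar>d j\<bar> * \<bar>x j\<bar>) \<le> (d j)\<^sup>2 + (x j)\<^sup>2"
      using sum_squares_bound[of "\<bar>d j\<bar>" "\<bar>x j\<bar>"] by (simp add: power2_eq_square mult_ac)
    hence "gap_weight j * (2 * (\<bar>d j\<bar> * \<bar>x j\<bar>)) \<le> gap_weight j * ((d j)\<^sup>2 + (x j)\<^sup>2)"
      using gap_weight_pos[of j] by (intro mult_left_mono) auto
    thus ?thesis using gap_weight_pos[of j] by (simp add: abs_mult algebra_simps)
  qed
  have s: "summable (\<lambda>j. 1/2 * (gap_weight j * (d j)\<^sup>2 + gap_weight j * (x j)\<^sup>2))"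
    by (intro summable_mult summable_add assms)
  show *: "summable (\<lambda>j. \<bar>gap_weight j * d j * x j\<bar>)"
    by (rule summable_comparison_test'[OF s, of 0]) (use t in simp)
  have "\<bar>\<Sum>j. gap_weight j * d j * x j\<bar> \<le> (\<Sum>j. \<bar>gap_weight j * d j * x j\<bar>)"
    by (rule summable_rabs[OF *])
  also have "\<dots> \<le> (\<Sum>j. 1/2 * (gap_weight j * (d j)\<^sup>2 + gap_weight j * (x j)\<^sup>2))"
    by (rule suminf_le[OF t * s])
  also have "\<dots> = 1/2 * ((\<Sum>j. gap_weight j * (d j)\<^sup>2) + (\<Sum>j. gap_weight j * (x j)\<^sup>2))"
    using assms by (subst suminf_mult) (auto intro!: summable_add simp: suminf_add)
  finally show "\<bar>\<Sum>j. gap_weight j * d j * x j\<bar> \<le> 1/2 * ((\<Sum>j. gap_weight j * (d j)\<^sup>2) + (\<Sum>j. gap_weight j * (x j)\<^sup>2))" .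
qed

lemma summable_gap_weight_moment_bound:
  assumes "\<delta> > 0" "R \<ge> 0"
  shows "summable (\<lambda>j. gap_weight j * (moment_bound \<delta> R j)\<^sup>2)"
proof -
  have s: "summable (\<lambda>j. (R * exp \<delta>)\<^sup>2 * ((1 / \<delta>\<^sup>2) ^ j /\<^sub>R fact j))"
    by (intro summable_mult summable_exp_generic)
  show ?thesis
  proof (rule summable_comparison_test'[OF s, of 0])
    fix j :: nat
    have "gap_weight j * (moment_bound \<delta> R j)\<^sup>2 = (R * exp \<delta>)\<^sup>2 * (1 / \<delta>\<^sup>2) ^ j / fact j / fact j"
      using assms by (simp add: gap_weight_def moment_bound_def power_mult_distrib power_divide
          power2_eq_square power4_eq_xxxx field_simps)
    also have "\<dots> \<le> (R * exp \<delta>)\<^sup>2 * (1 / \<delta>\<^sup>2) ^ j / fact j / 1"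
      using assms by (intro divide_left_mono) auto
    finally show "norm (gap_weight j * (moment_bound \<delta> R j)\<^sup>2) \<le> (R * exp \<delta>)\<^sup>2 * ((1 / \<delta>\<^sup>2) ^ j /\<^sub>R fact j)"
      using gap_weight_pos[of j] by (simp add: abs_mult scaleR_conv_of_real divide_inverse mult_ac)
  qed
qed

lemma lower_moment_bound:
  assumes "\<delta> > 0" "R \<ge> 0" shows "lower (moment_bound \<delta> R) j \<le> \<delta> * moment_bound \<delta> R j"
  using assms by (cases j) (auto simp: lower_def moment_bound_def field_simps)

lemma abs_lower_le:
  assumes "\<delta> > 0" "R \<ge> 0" "\<And>j. \<bar>l j\<bar> \<le> K * moment_bound \<delta> R j" "K \<ge> 0"
  shows "\<bar>lower l j\<bar> \<le> (K * \<delta>) * moment_bound \<delta> R j"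
proof -
  have "\<bar>lower l j\<bar> \<le> K * lower (moment_bound \<delta> R) j"
    using mult_left_mono[OF assms(3)[of "j - 1"], of "real j"] by (simp add: lower_def abs_mult mult_ac)
  also have "\<dots> \<le> K * (\<delta> * moment_bound \<delta> R j)"
    using lower_moment_bound[OF assms(1,2)] assms(4) by (intro mult_left_mono)
  finally show ?thesis by (simp add: mult_ac)
qed

lemma summable_gap_weight_bounded:
  assumes "\<delta> > 0" "R \<ge> 0" "\<And>j. \<bar>l j\<bar> \<le> K * moment_bound \<delta> R j"
  shows "summable (\<lambda>j. gap_weight j * (l j)\<^sup>2)"
    and "(\<Sum>j. gap_weight j * (l j)\<^sup>2) \<le> K\<^sup>2 * (\<Sum>j. gap_weight j * (moment_bound \<delta> R j)\<^sup>2)"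
proof -
  note S = summable_gap_weight_moment_bound[OF assms(1,2)]
  have s: "summable (\<lambda>j. K\<^sup>2 * (gap_weight j * (moment_bound \<delta> R j)\<^sup>2))"
    by (intro summable_mult S)
  have t: "gap_weight j * (l j)\<^sup>2 \<le> K\<^sup>2 * (gap_weight j * (moment_bound \<delta> R j)\<^sup>2)" for j
  proof -
    have "\<bar>l j\<bar>\<^sup>2 \<le> (K * moment_bound \<delta> R j)\<^sup>2" by (rule power_mono[OF assms(3)]) simp
    hence "gap_weight j * (l j)\<^sup>2 \<le> gap_weight j * (K * moment_bound \<delta> R j)\<^sup>2"
      using gap_weight_pos[of j] by (intro mult_left_mono) auto
    thus ?thesis by (simp add: power_mult_distrib mult_ac)
  qed
  show 1: "summable (\<lambda>j. gap_weight j * (l j)\<^sup>2)"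
    by (rule summable_comparison_test'[OF s, of 0]) (use t gap_weight_pos in \<open>simp add: abs_mult less_imp_le\<close>)
  show "(\<Sum>j. gap_weight j * (l j)\<^sup>2) \<le> K\<^sup>2 * (\<Sum>j. gap_weight j * (moment_bound \<delta> R j)\<^sup>2)"
    using suminf_le[OF t 1 s] suminf_mult[OF S] by simp
qed

lemma DERIV_lower_power:
  "((\<lambda>y. lower (\<lambda>i. y ^ i) j) has_real_derivative lower (lower (\<lambda>i. y ^ i)) j) (at y)"
  unfolding lower_def by (cases j) (auto intro!: derivative_eq_intros)

text \<open>
  Termwise differentiation of an everywhere convergent power series, written with the derivatives
  of the monomials so that it matches the L-derivatives of a series of cylindrical polynomials.
\<close>

lemma entire_series_derivatives:
  fixes g :: "nat \<Rightarrow> real"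
  assumes g: "\<And>y. summable (\<lambda>j. g j * y ^ j)"
  defines "\<pi> \<equiv> \<lambda>y. \<Sum>j. g j * lower (\<lambda>i. y ^ i) j"
  shows "(\<lambda>j. g j * lower (\<lambda>i. y ^ i) j) sums \<pi> y"
    and "(\<lambda>j. g j * lower (lower (\<lambda>i. y ^ i)) j) sums deriv \<pi> y"
    and "\<pi> differentiable at y" and "continuous_on UNIV (deriv \<pi>)"
    and "continuous_on UNIV \<pi>"
proof -
  have d1: "summable (\<lambda>n. diffs g n * y ^ n)" for y
    by (rule termdiff_converges_all[OF g])
  have d2: "summable (\<lambda>n. diffs (diffs g) n * y ^ n)" for y
    by (rule termdiff_converges_all[OF d1])
  have s1: "(\<lambda>j. g j * lower (\<lambda>i. y ^ i) j) sums (\<Sum>n. diffs g n * y ^ n)" for y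
    using diffs_equiv[OF d1[of y]] by (simp add: lower_def mult_ac)
  have p1: "\<pi> = (\<lambda>y. \<Sum>n. diffs g n * y ^ n)"
    using s1 by (auto simp: \<pi>_def sums_iff)
  show "(\<lambda>j. g j * lower (\<lambda>i. y ^ i) j) sums \<pi> y" using s1 by (simp add: p1)
  have D: "(\<pi> has_real_derivative (\<Sum>n. diffs (diffs g) n * y ^ n)) (at y)" for y
    unfolding p1 by (rule termdiffs_strong_converges_everywhere[OF d1])
  hence dp: "deriv \<pi> = (\<lambda>y. \<Sum>n. diffs (diffs g) n * y ^ n)"
    by (auto intro: DERIV_imp_deriv)
  have "(\<lambda>n. g (Suc n) * lower (lower (\<lambda>i. y ^ i)) (Suc n)) sums deriv \<pi> y"
    using diffs_equiv[OF d2[of y]] by (simp add: dp lower_def diffs_def mult_ac)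
  thus "(\<lambda>j. g j * lower (lower (\<lambda>i. y ^ i)) j) sums deriv \<pi> y"
    by (subst (asm) sums_Suc_iff) simp
  show "\<pi> differentiable at y" using D by (auto simp: real_differentiable_def)
  have "(deriv \<pi> has_real_derivative (\<Sum>n. diffs (diffs (diffs g)) n * y ^ n)) (at y)" for y
    unfolding dp by (rule termdiffs_strong_converges_everywhere[OF d2])
  thus "continuous_on UNIV (deriv \<pi>)"
    by (meson DERIV_isCont continuous_at_imp_continuous_on)
  show "continuous_on UNIV \<pi>"
    using D by (meson DERIV_isCont continuous_at_imp_continuous_on)
qed

lemma lower_integrals:
  assumes "\<And>j. integrable \<mu> (\<lambda>x. f x j)"
  shows "integrable \<mu> (\<lambda>x. lower (f x) j)"
    and "(LINT x|\<mu>. lower (f x) j) = lower (\<lambda>j. LINT x|\<mu>. f x j) j"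
  using assms by (auto simp: lower_def)

lemma abs_lower: "\<bar>lower l j\<bar> = lower (\<lambda>i. \<bar>l i\<bar>) j"
  by (simp add: lower_def abs_mult)

lemma series_integral:
  assumes \<mu>: "\<mu> \<in> exp_class \<delta> R" and \<delta>: "\<delta> > 0"
    and g: "summable (\<lambda>j. \<bar>g j\<bar> * moment_bound \<delta> R j)"
    and f: "\<And>j. integrable \<mu> (f j)" "\<And>j. (LINT x|\<mu>. \<bar>f j x\<bar>) \<le> K * moment_bound \<delta> R j"
    and sums: "\<And>x. (\<lambda>j. g j * f j x) sums p x" "\<And>x. summable (\<lambda>j. \<bar>g j * f j x\<bar>)"
  shows "integrable \<mu> p" "(\<lambda>j. g j * (LINT x|\<mu>. f j x)) sums (LINT x|\<mu>. p x)"
proof -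
  have p: "p = (\<lambda>x. \<Sum>j. g j * f j x)" using sums(1) by (auto simp: sums_iff)
  have i: "integrable \<mu> (\<lambda>x. g j * f j x)" for j using f(1) by simp
  have s: "summable (\<lambda>j. LINT x|\<mu>. norm (g j * f j x))"
  proof (rule summable_comparison_test'[OF summable_mult[OF g, of K], of 0])
    fix j :: nat
    have "\<bar>g j\<bar> * (LINT x|\<mu>. \<bar>f j x\<bar>) \<le> \<bar>g j\<bar> * (K * moment_bound \<delta> R j)"
      by (rule mult_left_mono[OF f(2)]) simp
    moreover have "(LINT x|\<mu>. \<bar>f j x\<bar>) \<ge> 0" by simp
    ultimately show "norm (LINT x|\<mu>. norm (g j * f j x)) \<le> K * (\<bar>g j\<bar> * moment_bound \<delta> R j)"
      by (simp add: abs_mult mult_ac)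
  qed
  show "integrable \<mu> p" unfolding p
    by (rule integrable_suminf[OF i _ s]) (use sums(2) in simp)
  show "(\<lambda>j. g j * (LINT x|\<mu>. f j x)) sums (LINT x|\<mu>. p x)"
    using sums_integral[OF i _ s] sums(2) unfolding p by simp
qed

lemma integral_abs_lower:
  assumes \<mu>: "\<mu> \<in> exp_class \<delta> R" and \<delta>: "\<delta> > 0"
  shows "integrable \<mu> (\<lambda>y. lower (\<lambda>i. \<bar>y\<bar> ^ i) j)"
    "(LINT y|\<mu>. lower (\<lambda>i. \<bar>y\<bar> ^ i) j) \<le> \<delta> * moment_bound \<delta> R j"
    "integrable \<mu> (\<lambda>y. lower (lower (\<lambda>i. \<bar>y\<bar> ^ i)) j)"
    "(LINT y|\<mu>. lower (lower (\<lambda>i. \<bar>y\<bar> ^ i)) j) \<le> \<delta> * \<delta> * moment_bound \<delta> R j"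
proof -
  have R: "R \<ge> 0" using exp_class_ge_1[OF \<mu> \<delta>] by simp
  note P = exp_class_abs_power[OF \<mu> \<delta>]
  have m0: "\<bar>LINT y|\<mu>. \<bar>y\<bar> ^ j\<bar> \<le> 1 * moment_bound \<delta> R j" for j
    using P(3)[of j] by (simp add: abs_of_nonneg)
  note m1 = abs_lower_le[OF \<delta> R m0 zero_le_one]
  have \<delta>0: "1 * \<delta> \<ge> 0" using \<delta> by simp
  note n1 = lower_integrals[OF P(1)]
  note n2 = lower_integrals[OF n1(1)]
  show "integrable \<mu> (\<lambda>y. lower (\<lambda>i. \<bar>y\<bar> ^ i) j)" by (rule n1)
  show "integrable \<mu> (\<lambda>y. lower (lower (\<lambda>i. \<bar>y\<bar> ^ i)) j)" by (rule n2)
  show "(LINT y|\<mu>. lower (\<lambda>i. \<bar>y\<bar> ^ i) j) \<le> \<delta> * moment_bound \<delta> R j"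
    using m1[of j] by (simp add: n1(2))
  show "(LINT y|\<mu>. lower (lower (\<lambda>i. \<bar>y\<bar> ^ i)) j) \<le> \<delta> * \<delta> * moment_bound \<delta> R j"
    using abs_lower_le[OF \<delta> R m1 \<delta>0, of j] by (simp add: n1(2) n2(2))
qed

text \<open>
  Integrating a series of derivatives of monomials term by term replaces monomials by moments;
  summability of the coefficients against the moment bounds justifies the interchange.
\<close>

lemma grad_integrals:
  fixes g :: "nat \<Rightarrow> real"
  assumes \<mu>: "\<mu> \<in> exp_class \<delta> R" and \<delta>: "\<delta> > 0"
    and gm: "summable (\<lambda>j. \<bar>g j\<bar> * moment_bound \<delta> R j)"
    and g: "\<And>y. summable (\<lambda>j. g j * y ^ j)"
  defines "\<pi> \<equiv> \<lambda>y. \<Sum>j. g j * lower (\<lambda>i. y ^ i) j"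
  shows "integrable \<mu> \<pi>" "(\<lambda>j. g j * lower (moment \<mu>) j) sums (LINT y|\<mu>. \<pi> y)"
    "integrable \<mu> (deriv \<pi>)" "(\<lambda>j. g j * lower (lower (moment \<mu>)) j) sums (LINT y|\<mu>. deriv \<pi> y)"
proof -
  note P = exp_class_abs_power[OF \<mu> \<delta>]
  note E = entire_series_derivatives[OF g, folded \<pi>_def]
  have ga: "summable (\<lambda>j. \<bar>g j\<bar> * y ^ j)" for y :: real
  proof -
    have "summable (\<lambda>j. norm (g j * y ^ j))"
      by (rule powser_insidea[OF g[of "\<bar>y\<bar> + 1"]]) simp
    hence "summable (\<lambda>j. norm (\<bar>g j\<bar> * y ^ j))" by (simp add: abs_mult)
    thus ?thesis by (rule summable_norm_cancel)
  qed
  note E' = entire_series_derivatives[OF ga]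
  have a1: "\<bar>g j * lower (\<lambda>i. y ^ i) j\<bar> = \<bar>g j\<bar> * lower (\<lambda>i. \<bar>y\<bar> ^ i) j"
    "\<bar>g j * lower (lower (\<lambda>i. y ^ i)) j\<bar> = \<bar>g j\<bar> * lower (lower (\<lambda>i. \<bar>y\<bar> ^ i)) j" for y j
    by (auto simp: abs_mult abs_lower power_abs)
  have i1: "integrable \<mu> (\<lambda>y. lower (\<lambda>i. y ^ i) j)"
    "(LINT y|\<mu>. lower (\<lambda>i. y ^ i) j) = lower (moment \<mu>) j" for j
    using lower_integrals[OF P(2), where j=j] by (auto simp: moment_def[abs_def])
  have i2: "integrable \<mu> (\<lambda>y. lower (lower (\<lambda>i. y ^ i)) j)"
    "(LINT y|\<mu>. lower (lower (\<lambda>i. y ^ i)) j) = lower (lower (moment \<mu>)) j" for j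
    using lower_integrals[OF i1(1), where j=j] i1(2) by auto
  have b1: "(LINT y|\<mu>. \<bar>lower (\<lambda>i. y ^ i) j\<bar>) \<le> \<delta> * moment_bound \<delta> R j" for j
    using integral_abs_lower(2)[OF \<mu> \<delta>, of j] by (simp add: abs_lower power_abs)
  have b2: "(LINT y|\<mu>. \<bar>lower (lower (\<lambda>i. y ^ i)) j\<bar>) \<le> (\<delta> * \<delta>) * moment_bound \<delta> R j" for j
    using integral_abs_lower(4)[OF \<mu> \<delta>, of j] by (simp add: abs_lower power_abs)
  show "integrable \<mu> \<pi>" "(\<lambda>j. g j * lower (moment \<mu>) j) sums (LINT y|\<mu>. \<pi> y)"
    using series_integral[OF \<mu> \<delta> gm i1(1) b1 E(1)] sums_summable[OF E'(1)]
    by (simp_all add: a1 i1(2) \<pi>_def)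
  show "integrable \<mu> (deriv \<pi>)" "(\<lambda>j. g j * lower (lower (moment \<mu>)) j) sums (LINT y|\<mu>. deriv \<pi> y)"
    using series_integral[OF \<mu> \<delta> gm i2(1) b2 E(2)] sums_summable[OF E'(2)]
    by (simp_all add: a1 i2(2))
qed

section \<open>Moments as functions on the Wasserstein space\<close>

lemma PspaceD:
  assumes "\<mu> \<in> Pspace k (UNIV :: real set)"
  shows "prob_space \<mu>" "sets \<mu> = sets borel" "space \<mu> = UNIV" "integrable \<mu> (\<lambda>x. \<bar>x\<bar> ^ k)"
  using assms sets_eq_imp_space_eq[of \<mu> borel] by (auto simp: Pspace_def)

lemma abs_power_le_add:
  assumes "j \<le> k" shows "\<bar>x::real\<bar> ^ j \<le> 1 + \<bar>x\<bar> ^ k"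
proof (cases "\<bar>x\<bar> \<le> 1")
  case True
  hence "\<bar>x\<bar> ^ j \<le> 1" by (intro power_le_one) auto
  moreover have "\<bar>x\<bar> ^ k \<ge> 0" by simp
  ultimately show ?thesis by linarith
next
  case False
  hence "\<bar>x\<bar> ^ j \<le> \<bar>x\<bar> ^ k" by (intro power_increasing assms) auto
  thus ?thesis by simp
qed

lemma Pspace_moment:
  assumes "\<mu> \<in> Pspace k UNIV" "j \<le> k"
  shows "integrable \<mu> (\<lambda>x. x ^ j)" "\<bar>moment \<mu> j\<bar> \<le> 1 + (LINT x|\<mu>. \<bar>x\<bar> ^ k)"
proof -
  note D = PspaceD[OF assms(1)]
  note [measurable_cong] = D(2)
  interpret prob_space \<mu> by (rule D)
  have i: "integrable \<mu> (\<lambda>x. 1 + \<bar>x\<bar> ^ k)" using D(4) by simp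
  have b: "\<bar>x ^ j\<bar> \<le> 1 + \<bar>x\<bar> ^ k" for x :: real
    using abs_power_le_add[OF assms(2), of x] by (simp add: power_abs)
  show *: "integrable \<mu> (\<lambda>x. x ^ j)"
    by (rule Bochner_Integration.integrable_bound[OF i]) (use b in \<open>auto intro: order_trans\<close>)
  have "\<bar>moment \<mu> j\<bar> \<le> (LINT x|\<mu>. \<bar>x ^ j\<bar>)"
    unfolding moment_def using integral_norm_bound[of \<mu> "\<lambda>x. x ^ j"] by simp
  also have "\<dots> \<le> (LINT x|\<mu>. 1 + \<bar>x\<bar> ^ k)"
    using * i b by (intro integral_mono) auto
  also have "\<dots> = 1 + (LINT x|\<mu>. \<bar>x\<bar> ^ k)" using D(4) prob_space by simp
  finally show "\<bar>moment \<mu> j\<bar> \<le> 1 + (LINT x|\<mu>. \<bar>x\<bar> ^ k)" .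
qed

lemma abs_add_power_diff:
  fixes x h :: real
  shows "\<bar>(x + h) ^ j - x ^ j\<bar> \<le> (\<bar>x\<bar> + \<bar>h\<bar>) ^ j - \<bar>x\<bar> ^ j"
proof (induction j)
  case (Suc j)
  have "(x + h) ^ Suc j - x ^ Suc j = x * ((x + h) ^ j - x ^ j) + h * (x + h) ^ j"
    by (simp add: algebra_simps)
  hence "\<bar>(x + h) ^ Suc j - x ^ Suc j\<bar> \<le> \<bar>x\<bar> * \<bar>(x + h) ^ j - x ^ j\<bar> + \<bar>h\<bar> * \<bar>x + h\<bar> ^ j"
    by (metis abs_mult abs_triangle_ineq power_abs)
  also have "\<dots> \<le> \<bar>x\<bar> * ((\<bar>x\<bar> + \<bar>h\<bar>) ^ j - \<bar>x\<bar> ^ j) + \<bar>h\<bar> * (\<bar>x\<bar> + \<bar>h\<bar>) ^ j"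
    by (intro add_mono mult_left_mono Suc power_mono abs_triangle_ineq) auto
  also have "\<dots> = (\<bar>x\<bar> + \<bar>h\<bar>) ^ Suc j - \<bar>x\<bar> ^ Suc j" by (simp add: algebra_simps)
  finally show ?case .
qed simp

lemma power_diff_mono_base:
  fixes a b h :: real
  assumes "0 \<le> a" "a \<le> b" "0 \<le> h"
  shows "(a + h) ^ j - a ^ j \<le> (b + h) ^ j - b ^ j"
proof (induction j)
  case (Suc j)
  have "(a + h) ^ Suc j - a ^ Suc j = a * ((a + h) ^ j - a ^ j) + h * (a + h) ^ j"
    by (simp add: algebra_simps)
  also have "\<dots> \<le> b * ((b + h) ^ j - b ^ j) + h * (b + h) ^ j"
    using assms Suc by (intro add_mono mult_mono power_mono) (auto intro!: power_mono)
  also have "\<dots> = (b + h) ^ Suc j - b ^ Suc j" by (simp add: algebra_simps)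
  finally show ?case .
qed simp

text \<open>
  If \<open>|y - x| \<le> \<theta> (1 + |x|)\<close> for a small \<open>\<theta>\<close>, the difference of the powers is a small multiple of
  \<open>(1 + |x|)^k\<close>; otherwise \<open>|y - x|\<close> dominates both \<open>|x|\<close> and 1, and the difference is controlled by
  \<open>|y - x|^k\<close>. In this form the estimate can be integrated along a coupling.
\<close>

lemma power_perturbation:
  fixes \<eta> :: real
  assumes "\<eta> > 0" "j \<le> k"
  obtains K where "K > 0" "\<And>x y::real. \<bar>y ^ j - x ^ j\<bar> \<le> \<eta> * (1 + \<bar>x\<bar>) ^ k + K * \<bar>y - x\<bar> ^ k"
proof -
  have "((\<lambda>\<theta>::real. (1 + \<theta>) ^ j - 1) \<longlongrightarrow> (1 + 0) ^ j - 1) (at_right 0)"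
    by (intro tendsto_intros)
  hence "eventually (\<lambda>\<theta>::real. (1 + \<theta>) ^ j - 1 < \<eta>) (at_right 0)"
    using assms(1) by (intro order_tendstoD) auto
  then obtain \<theta> :: real where \<theta>: "\<theta> > 0" "(1 + \<theta>) ^ j - 1 < \<eta>"
    by (metis eventually_at_right_field field_lbound_gt_zero zero_less_one dense)
  define K where "K = 2 * (1 / \<theta> + 1) ^ k"
  have K: "K > 0" using \<theta> by (simp add: K_def add_pos_pos)
  show ?thesis
  proof (rule that[OF K])
    fix x y :: real
    define h where "h = y - x"
    show "\<bar>y ^ j - x ^ j\<bar> \<le> \<eta> * (1 + \<bar>x\<bar>) ^ k + K * \<bar>y - x\<bar> ^ k"
    proof (cases "\<bar>h\<bar> \<le> \<theta> * (1 + \<bar>x\<bar>)")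
      case True
      have "\<bar>y ^ j - x ^ j\<bar> \<le> (\<bar>x\<bar> + \<bar>h\<bar>) ^ j - \<bar>x\<bar> ^ j"
        using abs_add_power_diff[of x h j] by (simp add: h_def)
      also have "\<dots> \<le> ((1 + \<bar>x\<bar>) + \<bar>h\<bar>) ^ j - (1 + \<bar>x\<bar>) ^ j"
        by (intro power_diff_mono_base) auto
      also have "\<dots> \<le> ((1 + \<bar>x\<bar>) + \<theta> * (1 + \<bar>x\<bar>)) ^ j - (1 + \<bar>x\<bar>) ^ j"
        using True by (intro diff_mono power_mono) auto
      also have "\<dots> = ((1 + \<theta>) ^ j - 1) * (1 + \<bar>x\<bar>) ^ j"
        by (simp add: algebra_simps power_mult_distrib[symmetric])
      also have "\<dots> \<le> \<eta> * (1 + \<bar>x\<bar>) ^ k"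
        using \<theta> assms by (intro mult_mono power_increasing) auto
      finally show ?thesis using K by (simp add: add_increasing2 less_imp_le)
    next
      case False
      hence h: "1 + \<bar>x\<bar> \<le> \<bar>h\<bar> / \<theta>" using \<theta> by (simp add: field_simps)
      let ?m = "(1 / \<theta> + 1) * \<bar>h\<bar>"
      have m: "\<bar>x\<bar> + \<bar>h\<bar> \<le> ?m" "\<bar>x\<bar> \<le> ?m" "1 \<le> ?m"
        using h by (auto simp: algebra_simps add_increasing)
      have "\<bar>y ^ j - x ^ j\<bar> \<le> (\<bar>x\<bar> + \<bar>h\<bar>) ^ j - \<bar>x\<bar> ^ j"
        using abs_add_power_diff[of x h j] by (simp add: h_def)
      also have "\<dots> \<le> (\<bar>x\<bar> + \<bar>h\<bar>) ^ j" by simp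
      also have "\<dots> \<le> ?m ^ j" using m by (intro power_mono) auto
      also have "\<dots> \<le> ?m ^ k" using m assms by (intro power_increasing) auto
      also have "\<dots> \<le> K * \<bar>h\<bar> ^ k" using \<theta> by (simp add: K_def power_mult_distrib)
      finally show ?thesis using assms(1) by (simp add: h_def add_increasing)
    qed
  qed
qed

lemma integrable_one_plus_abs_power:
  assumes "\<mu> \<in> Pspace k (UNIV :: real set)"
  shows "integrable \<mu> (\<lambda>x. (1 + \<bar>x\<bar>) ^ k)"
proof -
  note D = PspaceD[OF assms]
  note [measurable_cong] = D(2)
  interpret prob_space \<mu> by (rule D)
  have i: "integrable \<mu> (\<lambda>x. 2 ^ k * (1 + \<bar>x\<bar> ^ k))" using D(4) by simp
  have "(1 + \<bar>x\<bar>) ^ k \<le> 2 ^ k * (1 + \<bar>x\<bar> ^ k)" for x :: real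
  proof -
    have "(1 + \<bar>x\<bar>) ^ k \<le> (2 * max 1 \<bar>x\<bar>) ^ k" by (intro power_mono) auto
    also have "\<dots> = 2 ^ k * (max 1 \<bar>x\<bar>) ^ k" by (simp add: power_mult_distrib)
    also have "(max 1 \<bar>x\<bar>) ^ k \<le> 1 + \<bar>x\<bar> ^ k" by (auto simp: max_def)
    finally show ?thesis by simp
  qed
  thus ?thesis
    by (intro Bochner_Integration.integrable_bound[OF i]) auto
qed

lemma product_marginals:
  fixes \<mu> \<nu> :: "real measure"
  assumes "prob_space \<mu>" "sets \<mu> = sets borel" "prob_space \<nu>" "sets \<nu> = sets borel"
  shows "prob_space (\<mu> \<Otimes>\<^sub>M \<nu>)" "sets (\<mu> \<Otimes>\<^sub>M \<nu>) = sets borel"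
    "distr (\<mu> \<Otimes>\<^sub>M \<nu>) borel fst = \<mu>" "distr (\<mu> \<Otimes>\<^sub>M \<nu>) borel snd = \<nu>"
proof -
  interpret M: prob_space \<mu> by fact
  interpret N: prob_space \<nu> by fact
  interpret P: pair_prob_space \<mu> \<nu> ..
  show "prob_space (\<mu> \<Otimes>\<^sub>M \<nu>)" by (rule P.prob_space_axioms)
  show "sets (\<mu> \<Otimes>\<^sub>M \<nu>) = sets borel"
    using sets_pair_measure_cong[OF assms(2,4)] by (metis borel_prod)
  have "distr (\<mu> \<Otimes>\<^sub>M \<nu>) borel fst = distr (\<mu> \<Otimes>\<^sub>M \<nu>) \<mu> fst"
    by (rule distr_cong) (auto simp: assms)
  also have "\<dots> = \<mu>" by (rule N.distr_pair_fst)
  finally show "distr (\<mu> \<Otimes>\<^sub>M \<nu>) borel fst = \<mu>" .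
  have "distr (\<mu> \<Otimes>\<^sub>M \<nu>) borel snd = distr (\<mu> \<Otimes>\<^sub>M \<nu>) \<nu> snd"
    by (rule distr_cong) (auto simp: assms)
  also have "\<dots> = \<nu>"
  proof (rule measure_eqI)
    fix A assume A: "A \<in> sets (distr (\<mu> \<Otimes>\<^sub>M \<nu>) \<nu> snd)"
    hence "emeasure (distr (\<mu> \<Otimes>\<^sub>M \<nu>) \<nu> snd) A = emeasure (\<mu> \<Otimes>\<^sub>M \<nu>) (space \<mu> \<times> A)"
      by (auto simp: emeasure_distr space_pair_measure dest: sets.sets_into_space
          intro!: arg_cong[where f="emeasure (\<mu> \<Otimes>\<^sub>M \<nu>)"])
    thus "emeasure (distr (\<mu> \<Otimes>\<^sub>M \<nu>) \<nu> snd) A = emeasure \<nu> A"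
      using A by (simp add: N.emeasure_pair_measure_Times M.emeasure_space_1)
  qed simp
  finally show "distr (\<mu> \<Otimes>\<^sub>M \<nu>) borel snd = \<nu>" .
qed

lemma couplings_nonempty:
  assumes "\<mu> \<in> Pspace k (UNIV :: real set)" "\<nu> \<in> Pspace k (UNIV :: real set)"
  shows "couplings \<mu> \<nu> \<noteq> {}"
proof -
  note p = product_marginals[OF PspaceD(1,2)[OF assms(1)] PspaceD(1,2)[OF assms(2)]]
  have "\<mu> \<Otimes>\<^sub>M \<nu> \<in> couplings \<mu> \<nu>" by (simp add: couplings_def p)
  thus ?thesis by blast
qed

lemma coupling_moment_diff:
  assumes \<mu>: "\<mu> \<in> Pspace k UNIV" and \<nu>: "\<nu> \<in> Pspace k UNIV" and \<pi>: "\<pi> \<in> couplings \<mu> \<nu>"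
    and jk: "j \<le> k"
    and K: "\<And>x y::real. \<bar>y ^ j - x ^ j\<bar> \<le> \<eta> * (1 + \<bar>x\<bar>) ^ k + K * \<bar>y - x\<bar> ^ k"
  shows "\<bar>moment \<nu> j - moment \<mu> j\<bar> \<le>
    \<eta> * (LINT x|\<mu>. (1 + \<bar>x\<bar>) ^ k) + K * (LINT z|\<pi>. dist (fst z) (snd z) ^ k)"
proof -
  have s: "sets \<pi> = sets borel" and m: "distr \<pi> borel fst = \<mu>" "distr \<pi> borel snd = \<nu>"
    using \<pi> by (auto simp: couplings_def)
  have fs [measurable]: "fst \<in> borel_measurable \<pi>" "snd \<in> borel_measurable \<pi>"
    by (auto simp: measurable_cong_sets[OF s refl] intro!: borel_measurable_continuous_onI continuous_intros)
  have f: "integrable \<pi> (\<lambda>z. f (fst z))" "(LINT z|\<pi>. f (fst z)) = (LINT x|\<mu>. f x)"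
    if "integrable \<mu> f" "f \<in> borel_measurable borel" for f :: "real \<Rightarrow> real"
    using that unfolding m(1)[symmetric] by (simp_all add: integrable_distr_eq integral_distr fs)
  have g: "integrable \<pi> (\<lambda>z. f (snd z))" "(LINT z|\<pi>. f (snd z)) = (LINT x|\<nu>. f x)"
    if "integrable \<nu> f" "f \<in> borel_measurable borel" for f :: "real \<Rightarrow> real"
    using that unfolding m(2)[symmetric] by (simp_all add: integrable_distr_eq integral_distr fs)
  note I = integrable_one_plus_abs_power[OF \<mu>] and J = integrable_one_plus_abs_power[OF \<nu>]
  have i: "integrable \<pi> (\<lambda>z. (1 + \<bar>fst z\<bar>) ^ k)" by (rule f[OF I]) measurable
  have i': "integrable \<pi> (\<lambda>z. (1 + \<bar>snd z\<bar>) ^ k)" by (rule g[OF J]) measurable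
  have d: "integrable \<pi> (\<lambda>z. dist (fst z) (snd z) ^ k)"
  proof (rule Bochner_Integration.integrable_bound)
    show "integrable \<pi> (\<lambda>z. 2 ^ k * ((1 + \<bar>fst z\<bar>) ^ k + (1 + \<bar>snd z\<bar>) ^ k))"
      using i i' by simp
    have "dist x y ^ k \<le> 2 ^ k * ((1 + \<bar>x\<bar>) ^ k + (1 + \<bar>y\<bar>) ^ k)" for x y :: real
    proof -
      have "dist x y ^ k \<le> (2 * max (1 + \<bar>x\<bar>) (1 + \<bar>y\<bar>)) ^ k"
        by (intro power_mono) (auto simp: dist_real_def max_def)
      also have "\<dots> = 2 ^ k * (max (1 + \<bar>x\<bar>) (1 + \<bar>y\<bar>)) ^ k" by (simp add: power_mult_distrib)
      also have "(max (1 + \<bar>x\<bar>) (1 + \<bar>y\<bar>)) ^ k \<le> (1 + \<bar>x\<bar>) ^ k + (1 + \<bar>y\<bar>) ^ k"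
        by (auto simp: max_def)
      finally show ?thesis by simp
    qed
    thus "AE z in \<pi>. norm (dist (fst z) (snd z) ^ k) \<le> norm (2 ^ k * ((1 + \<bar>fst z\<bar>) ^ k + (1 + \<bar>snd z\<bar>) ^ k))"
      by (auto simp: abs_mult)
  qed measurable
  have xj: "integrable \<pi> (\<lambda>z. fst z ^ j)" "(LINT z|\<pi>. fst z ^ j) = moment \<mu> j"
    using f[of "\<lambda>x. x ^ j"] Pspace_moment(1)[OF \<mu> jk] by (auto simp: moment_def)
  have yj: "integrable \<pi> (\<lambda>z. snd z ^ j)" "(LINT z|\<pi>. snd z ^ j) = moment \<nu> j"
    using g[of "\<lambda>x. x ^ j"] Pspace_moment(1)[OF \<nu> jk] by (auto simp: moment_def)
  have "moment \<nu> j - moment \<mu> j = (LINT z|\<pi>. snd z ^ j - fst z ^ j)"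
    using xj yj by simp
  hence "\<bar>moment \<nu> j - moment \<mu> j\<bar> \<le> (LINT z|\<pi>. \<bar>snd z ^ j - fst z ^ j\<bar>)"
    using integral_norm_bound[of \<pi> "\<lambda>z. snd z ^ j - fst z ^ j"] by simp
  also have "\<dots> \<le> (LINT z|\<pi>. \<eta> * (1 + \<bar>fst z\<bar>) ^ k + K * dist (fst z) (snd z) ^ k)"
  proof (intro integral_mono)
    fix z :: "real \<times> real"
    show "\<bar>snd z ^ j - fst z ^ j\<bar> \<le> \<eta> * (1 + \<bar>fst z\<bar>) ^ k + K * dist (fst z) (snd z) ^ k"
      using K[of "snd z" "fst z"] by (simp add: dist_real_def abs_minus_commute)
  qed (use xj(1) yj(1) i d in auto)
  also have "\<dots> = \<eta> * (LINT x|\<mu>. (1 + \<bar>x\<bar>) ^ k) + K * (LINT z|\<pi>. dist (fst z) (snd z) ^ k)"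
    using i d f(2)[OF I] by simp
  finally show ?thesis .
qed

lemma wasserstein_less_imp_coupling:
  assumes "\<mu> \<in> Pspace k (UNIV :: real set)" "\<nu> \<in> Pspace k (UNIV :: real set)"
    and "wasserstein k \<mu> \<nu> < \<epsilon>" "k > 0"
  obtains \<pi> where "\<pi> \<in> couplings \<mu> \<nu>" "(LINT z|\<pi>. dist (fst z) (snd z) ^ k) < \<epsilon> ^ k"
proof -
  let ?c = "\<lambda>\<pi>. LINT z|\<pi>. dist (fst z) (snd z) ^ k"
  let ?I = "INF \<pi>\<in>couplings \<mu> \<nu>. ?c \<pi>"
  have ne: "couplings \<mu> \<nu> \<noteq> {}" by (rule couplings_nonempty[OF assms(1,2)])
  have bdd: "bdd_below (?c ` couplings \<mu> \<nu>)" by (rule bdd_belowI[of _ 0]) auto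
  have I0: "?I \<ge> 0" by (rule cINF_greatest[OF ne]) auto
  have r: "root k ?I < \<epsilon>" using assms(3) by (simp add: wasserstein_def)
  hence "root k ?I ^ k < \<epsilon> ^ k" using I0 assms(4) by (intro power_strict_mono) auto
  hence "?I < \<epsilon> ^ k" using I0 assms(4) by (simp add: real_root_pow_pos2)
  thus ?thesis using that cINF_less_iff[OF ne bdd] by blast
qed

text \<open>
  Choose a coupling whose cost nearly attains the Wasserstein distance and integrate the pointwise
  estimate \<open>power_perturbation\<close> along it.
\<close>

lemma moment_wasserstein_continuous:
  assumes jk: "j \<le> k" and k: "k > 0" and \<mu>: "\<mu> \<in> Pspace k UNIV" and r: "r > 0"
  shows "\<exists>\<epsilon>>0. \<forall>\<nu>\<in>Pspace k UNIV. wasserstein k \<mu> \<nu> < \<epsilon> \<longrightarrow> \<bar>moment \<nu> j - moment \<mu> j\<bar> < r"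
proof -
  let ?I = "LINT x|\<mu>. (1 + \<bar>x\<bar>) ^ k"
  have I: "?I \<ge> 0" by simp
  define \<eta> where "\<eta> = r / (2 * (?I + 1))"
  have \<eta>: "\<eta> > 0" unfolding \<eta>_def by (rule divide_pos_pos[OF r], rule mult_pos_pos) (use I in linarith)+
  have "\<eta> * ?I < \<eta> * (?I + 1)" using \<eta> by simp
  also have "\<dots> = r / 2"
  proof -
    have *: "r / (2 * J) * J = r / 2" if "J > 0" for J using that by simp
    show ?thesis unfolding \<eta>_def by (rule *) (use I in linarith)
  qed
  finally have \<eta>I: "\<eta> * ?I < r / 2" .
  obtain K where K: "K > 0" "\<And>x y::real. \<bar>y ^ j - x ^ j\<bar> \<le> \<eta> * (1 + \<bar>x\<bar>) ^ k + K * \<bar>y - x\<bar> ^ k"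
    using power_perturbation[OF \<eta> jk] by blast
  define \<epsilon> where "\<epsilon> = root k (r / (2 * K))"
  have \<epsilon>: "\<epsilon> > 0" "\<epsilon> ^ k = r / (2 * K)" using K r k by (auto simp: \<epsilon>_def real_root_pow_pos)
  show ?thesis
  proof (intro exI[of _ \<epsilon>] conjI ballI impI)
    fix \<nu> assume \<nu>: "\<nu> \<in> Pspace k UNIV" "wasserstein k \<mu> \<nu> < \<epsilon>"
    obtain \<pi> where \<pi>: "\<pi> \<in> couplings \<mu> \<nu>" "(LINT z|\<pi>. dist (fst z) (snd z) ^ k) < \<epsilon> ^ k"
      using wasserstein_less_imp_coupling[OF \<mu> \<nu> k] by blast
    have "K * (LINT z|\<pi>. dist (fst z) (snd z) ^ k) < K * \<epsilon> ^ k"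
      using \<pi>(2) K(1) by simp
    also have "\<dots> = r / 2" using K(1) \<epsilon>(2) by simp
    finally show "\<bar>moment \<nu> j - moment \<mu> j\<bar> < r"
      using coupling_moment_diff[OF \<mu> \<nu>(1) \<pi>(1) jk K(2)] \<eta>I by linarith
  qed (rule \<epsilon>)
qed

lemma continuous_map_moment:
  assumes "j \<le> k" "k > 0"
  shows "continuous_map (wasserstein_topology k UNIV) euclideanreal (\<lambda>\<mu>. moment \<mu> j)"
  unfolding continuous_map_def
proof (intro conjI allI impI)
  fix V :: "real set" assume "openin euclidean V"
  hence V: "open V" by simp
  show "openin (wasserstein_topology k UNIV) {\<mu> \<in> topspace (wasserstein_topology k UNIV). moment \<mu> j \<in> V}"
    unfolding openin_wasserstein_topology topspace_wasserstein_topology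
  proof (intro conjI ballI)
    fix \<mu> assume *: "\<mu> \<in> {\<mu> \<in> Pspace k UNIV. moment \<mu> j \<in> V}"
    then obtain r where r: "r > 0" "\<And>y. dist y (moment \<mu> j) < r \<Longrightarrow> y \<in> V"
      using V by (auto simp: open_dist)
    have "\<mu> \<in> Pspace k UNIV" using * by simp
    from moment_wasserstein_continuous[OF assms this r(1)] r(2)
    show "\<exists>\<epsilon>>0. \<forall>\<nu>\<in>Pspace k UNIV. wasserstein k \<mu> \<nu> < \<epsilon> \<longrightarrow>
        \<nu> \<in> {\<mu> \<in> Pspace k UNIV. moment \<mu> j \<in> V}"
      by (auto simp: dist_real_def)
  qed auto
qed auto

lemma emeasure_mixture:
  assumes "sets \<mu>' = sets borel" "sets \<mu> = sets borel" "A \<in> sets borel"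
  shows "emeasure (mixture r \<mu>' \<mu>) A = ennreal r * emeasure \<mu>' A + ennreal (1 - r) * emeasure \<mu> A"
  unfolding mixture_def
proof (rule emeasure_measure_of_sigma)
  show "sigma_algebra UNIV (sets borel :: real set set)"
    using sets.sigma_algebra_axioms[of borel] by simp
  show "positive (sets borel) (\<lambda>A. ennreal r * emeasure \<mu>' A + ennreal (1 - r) * emeasure \<mu> A)"
    by (simp add: positive_def)
  show "countably_additive (sets borel) (\<lambda>A. ennreal r * emeasure \<mu>' A + ennreal (1 - r) * emeasure \<mu> A)"
    unfolding countably_additive_def
  proof (intro allI impI)
    fix A :: "nat \<Rightarrow> real set"
    assume A: "range A \<subseteq> sets borel" "disjoint_family A" "(\<Union>i. A i) \<in> sets borel"
    have "(\<Sum>i. emeasure \<mu>' (A i)) = emeasure \<mu>' (\<Union>i. A i)" "(\<Sum>i. emeasure \<mu> (A i)) = emeasure \<mu> (\<Union>i. A i)"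
      using A assms by (auto intro!: suminf_emeasure)
    thus "(\<Sum>i. ennreal r * emeasure \<mu>' (A i) + ennreal (1 - r) * emeasure \<mu> (A i)) =
        ennreal r * emeasure \<mu>' (\<Union>i. A i) + ennreal (1 - r) * emeasure \<mu> (\<Union>i. A i)"
      by (simp add: suminf_add[symmetric] ennreal_suminf_cmult)
  qed
qed (rule assms)

lemma sets_mixture [measurable_cong]: "sets (mixture r \<mu>' \<mu>) = sets borel"
  unfolding mixture_def using sets.sigma_sets_eq[of "borel :: real measure"] by simp

lemma nn_integral_mixture:
  assumes "sets \<mu>' = sets borel" "sets \<mu> = sets borel" "f \<in> borel_measurable borel"
  shows "(\<integral>\<^sup>+x. f x \<partial>mixture r \<mu>' \<mu>) = ennreal r * (\<integral>\<^sup>+x. f x \<partial>\<mu>') + ennreal (1 - r) * (\<integral>\<^sup>+x. f x \<partial>\<mu>)"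
  using assms(3)
proof (induction rule: borel_measurable_induct)
  case (cong f g)
  thus ?case by simp
next
  case (set A)
  thus ?case using emeasure_mixture[OF assms(1,2)] assms(1,2) by (simp add: sets_mixture)
next
  case (mult u c)
  note [measurable] = mult(2) and [measurable_cong] = assms(1,2)
  show ?case using mult(4) by (simp add: nn_integral_cmult distrib_left mult_ac)
next
  case (add u v)
  note [measurable] = add(1,4) and [measurable_cong] = assms(1,2)
  show ?case using add by (simp add: nn_integral_add distrib_left add_ac)
next
  case (seq U)
  note [measurable] = seq(1) and [measurable_cong] = assms(1,2)
  have i: "incseq (\<lambda>i. integral\<^sup>N M (U i))" for M :: "real measure"
    using seq(3) by (auto simp: incseq_def le_fun_def intro!: nn_integral_mono)
  have s: "(\<integral>\<^sup>+x. (SUP i. U i) x \<partial>M) = (SUP i. \<integral>\<^sup>+x. U i x \<partial>M)" if "sets M = sets borel" for M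
  proof -
    have "U i \<in> borel_measurable M" for i
      using seq(1)[of i] by (simp add: measurable_cong_sets[OF that refl])
    thus ?thesis using seq(3)
      by (simp only: Sup_apply image_image) (intro nn_integral_monotone_convergence_SUP, auto)
  qed
  have m: "incseq (\<lambda>i. c * integral\<^sup>N M (U i))" for c and M :: "real measure"
    using i[of M] by (auto simp: incseq_def intro: mult_left_mono)
  have IH: "integral\<^sup>N (mixture r \<mu>' \<mu>) (U i) =
      ennreal r * integral\<^sup>N \<mu>' (U i) + ennreal (1 - r) * integral\<^sup>N \<mu> (U i)" for i
    using seq by auto
  show ?case
    unfolding s[OF assms(1)] s[OF assms(2)] s[OF sets_mixture] IH SUP_mult_left_ennreal
    by (rule ennreal_SUP_add[OF m m])
qed

lemma enn2real_convex_combination: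
  assumes "x < \<infinity>" "y < \<infinity>" "0 \<le> r" "r \<le> 1"
  shows "enn2real (ennreal r * x + ennreal (1 - r) * y) = r * enn2real x + (1 - r) * enn2real y"
  using assms
  by (cases x; cases y) (auto simp: ennreal_mult[symmetric] ennreal_plus[symmetric] simp del: ennreal_plus)

lemma integral_mixture:
  assumes "sets \<mu>' = sets borel" "sets \<mu> = sets borel" "0 \<le> r" "r \<le> 1"
    and f: "integrable \<mu>' f" "integrable \<mu> (f :: real \<Rightarrow> real)"
  shows "integrable (mixture r \<mu>' \<mu>) f"
    and "(LINT x|mixture r \<mu>' \<mu>. f x) = r * (LINT x|\<mu>'. f x) + (1 - r) * (LINT x|\<mu>. f x)"
proof -
  have fm [measurable]: "f \<in> borel_measurable borel"
    using borel_measurable_integrable[OF f(1)] assms(1) by (simp cong: measurable_cong_sets)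
  note n = nn_integral_mixture[OF assms(1,2)]
  have fin: "(\<integral>\<^sup>+x. ennreal (norm (f x)) \<partial>\<mu>') < \<infinity>" "(\<integral>\<^sup>+x. ennreal (norm (f x)) \<partial>\<mu>) < \<infinity>"
    using f by (auto simp: integrable_iff_bounded)
  show i: "integrable (mixture r \<mu>' \<mu>) f"
    using fin by (subst integrable_iff_bounded) (simp add: n ennreal_mult_less_top)
  have *: "(\<integral>\<^sup>+x. ennreal (g x) \<partial>M) < \<infinity>" if "integrable M f" "\<And>x. g x \<le> \<bar>f x\<bar>" for g and M :: "real measure"
  proof -
    have "(\<integral>\<^sup>+x. ennreal (g x) \<partial>M) \<le> (\<integral>\<^sup>+x. ennreal (norm (f x)) \<partial>M)"
      by (intro nn_integral_mono ennreal_leI) (use that(2) in simp)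
    also have "\<dots> < \<infinity>" using that(1) by (simp add: integrable_iff_bounded)
    finally show ?thesis .
  qed
  have a: "enn2real (\<integral>\<^sup>+x. ennreal (g x) \<partial>mixture r \<mu>' \<mu>) =
      r * enn2real (\<integral>\<^sup>+x. ennreal (g x) \<partial>\<mu>') + (1 - r) * enn2real (\<integral>\<^sup>+x. ennreal (g x) \<partial>\<mu>)"
    if [measurable]: "g \<in> borel_measurable borel" and "\<And>x. g x \<le> \<bar>f x\<bar>" for g
    using *[OF f(1) that(2)] *[OF f(2) that(2)] assms(3,4)
    by (subst n) (auto intro!: enn2real_convex_combination)
  show "(LINT x|mixture r \<mu>' \<mu>. f x) = r * (LINT x|\<mu>'. f x) + (1 - r) * (LINT x|\<mu>. f x)"
    using a[of f] a[of "\<lambda>x. - f x"]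
    by (simp add: real_lebesgue_integral_def[OF i] real_lebesgue_integral_def[OF f(1)]
        real_lebesgue_integral_def[OF f(2)] algebra_simps)
qed

text \<open>
  The linear functional derivative is \<open>2 c (m\<^sub>j(\<mu>) - a) x^j\<close>. Along the segment from \<open>\<mu>\<close> to \<open>\<mu>'\<close> the
  moment is affine in \<open>r\<close>, so the integral identity is the fundamental theorem of calculus for
  \<open>c (r m' + (1 - r) m - a)\<^sup>2\<close>.
\<close>

lemma L_derivative_moment_square:
  assumes jk: "j \<le> k" and k: "k > 0"
    and \<psi>: "\<And>\<mu>. \<mu> \<in> Pspace k UNIV \<Longrightarrow> \<psi> \<mu> = K + c * (moment \<mu> j - a)\<^sup>2"
  shows "L_derivative k \<psi> (\<lambda>\<mu> y. 2 * c * (moment \<mu> j - a) * lower (\<lambda>i. y ^ i) j)"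
  unfolding L_derivative_def
proof (intro exI[of _ "\<lambda>\<mu> y. 2 * c * (moment \<mu> j - a) * y ^ j"] conjI ballI allI)
  fix \<mu> :: "real measure" and x :: real
  show "((\<lambda>y. 2 * c * (moment \<mu> j - a) * y ^ j) has_real_derivative
      2 * c * (moment \<mu> j - a) * lower (\<lambda>i. x ^ i) j) (at x)"
    unfolding lower_def by (auto intro!: derivative_eq_intros)
next
  show "linear_functional_derivative k \<psi> (\<lambda>\<mu> y. 2 * c * (moment \<mu> j - a) * y ^ j)"
    unfolding linear_functional_derivative_def
  proof (intro conjI allI ballI)
    let ?X = "prod_topology (wasserstein_topology k UNIV) euclideanreal"
    have 1: "continuous_map ?X euclideanreal (\<lambda>z. moment (fst z) j)"
      using continuous_map_compose[OF continuous_map_fst continuous_map_moment[OF jk k]]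
      by (simp add: o_def)
    have 2: "continuous_map ?X euclideanreal (\<lambda>z. snd z ^ j)"
      by (intro continuous_map_real_pow continuous_map_snd)
    show "continuous_map ?X euclideanreal (\<lambda>(\<mu>, x). 2 * c * (moment \<mu> j - a) * x ^ j)"
      unfolding case_prod_unfold
      by (intro continuous_map_real_mult continuous_map_diff 1 2 continuous_map_const[THEN iffD2]) auto
  next
    fix r :: real
    show "\<exists>C. \<forall>\<mu>\<in>Pspace k UNIV. (LINT x|\<mu>. \<bar>x\<bar> ^ k) \<le> r \<longrightarrow>
        (\<forall>x. \<bar>2 * c * (moment \<mu> j - a) * x ^ j\<bar> \<le> C * (1 + \<bar>x\<bar> ^ k))"
    proof (intro exI[of _ "2 * \<bar>c\<bar> * (1 + r + \<bar>a\<bar>)"] ballI impI allI)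
      fix \<mu> :: "real measure" and x :: real assume \<mu>: "\<mu> \<in> Pspace k UNIV" "(LINT x|\<mu>. \<bar>x\<bar> ^ k) \<le> r"
      have "\<bar>moment \<mu> j - a\<bar> \<le> 1 + r + \<bar>a\<bar>" using Pspace_moment(2)[OF \<mu>(1) jk] \<mu>(2) by linarith
      moreover have "\<bar>x ^ j\<bar> \<le> 1 + \<bar>x\<bar> ^ k" using abs_power_le_add[OF jk, of x] by (simp add: power_abs)
      ultimately have "(2 * \<bar>c\<bar>) * \<bar>moment \<mu> j - a\<bar> * \<bar>x ^ j\<bar> \<le> (2 * \<bar>c\<bar>) * (1 + r + \<bar>a\<bar>) * (1 + \<bar>x\<bar> ^ k)"
        by (intro mult_mono) auto
      thus "\<bar>2 * c * (moment \<mu> j - a) * x ^ j\<bar> \<le> 2 * \<bar>c\<bar> * (1 + r + \<bar>a\<bar>) * (1 + \<bar>x\<bar> ^ k)"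
        by (simp add: abs_mult)
    qed
  next
    fix \<mu> \<mu>' :: "real measure" assume \<mu>: "\<mu> \<in> Pspace k UNIV" and \<mu>': "\<mu>' \<in> Pspace k UNIV"
    let ?m = "moment \<mu> j" and ?m' = "moment \<mu>' j"
    note i = Pspace_moment(1)[OF \<mu> jk] Pspace_moment(1)[OF \<mu>' jk]
    have mix: "moment (mixture r \<mu>' \<mu>) j = r * ?m' + (1 - r) * ?m" if "r \<in> {0..1}" for r
      using integral_mixture(2)[OF PspaceD(2)[OF \<mu>'] PspaceD(2)[OF \<mu>] _ _ i(2) i(1)] that
      by (simp add: moment_def)
    have "(LINT r:{0..1}|lborel.
           (LINT x|\<mu>'. 2 * c * (moment (mixture r \<mu>' \<mu>) j - a) * x ^ j) -
           (LINT x|\<mu>. 2 * c * (moment (mixture r \<mu>' \<mu>) j - a) * x ^ j))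
        = (LINT r:{0..1}|lborel. 2 * c * (r * ?m' + (1 - r) * ?m - a) * (?m' - ?m))"
    proof (rule set_lebesgue_integral_cong)
      have "(LINT x|\<mu>'. A * x ^ j) - (LINT x|\<mu>. A * x ^ j) = A * (?m' - ?m)" for A
        by (simp only: integral_mult_right_zero moment_def right_diff_distrib)
      thus "\<forall>r. r \<in> {0..1} \<longrightarrow>
           (LINT x|\<mu>'. 2 * c * (moment (mixture r \<mu>' \<mu>) j - a) * x ^ j) -
           (LINT x|\<mu>. 2 * c * (moment (mixture r \<mu>' \<mu>) j - a) * x ^ j)
         = 2 * c * (r * ?m' + (1 - r) * ?m - a) * (?m' - ?m)"
        by (simp add: mix)
    qed simp
    also have "\<dots> = c * (1 * ?m' + (1 - 1) * ?m - a)\<^sup>2 - c * (0 * ?m' + (1 - 0) * ?m - a)\<^sup>2"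
      unfolding set_lebesgue_integral_def real_scaleR_def mult.commute[of "indicator _ _"]
      by (rule integral_FTC_Icc_real)
         (auto intro!: derivative_eq_intros continuous_intros simp: algebra_simps)
    finally show "\<psi> \<mu>' - \<psi> \<mu> = (LINT r:{0..1}|lborel.
           (LINT x|\<mu>'. 2 * c * (moment (mixture r \<mu>' \<mu>) j - a) * x ^ j) -
           (LINT x|\<mu>. 2 * c * (moment (mixture r \<mu>' \<mu>) j - a) * x ^ j))"
      using \<psi>[OF \<mu>] \<psi>[OF \<mu>'] by simp
  qed
qed

section \<open>The penalty and its jets\<close>

definition moment_gap :: "real measure \<Rightarrow> real measure \<Rightarrow> real" where
  "moment_gap \<mu> \<nu> = (\<Sum>j. gap_weight j * (moment \<mu> j - moment \<nu> j)\<^sup>2)"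

text \<open>
  The L-derivative of \<open>\<mu> \<mapsto> \<kappa>/2 * moment_gap \<mu> \<nu>\<close>.
\<close>

definition gap_gradient :: "real \<Rightarrow> real measure \<Rightarrow> real measure \<Rightarrow> real \<Rightarrow> real" where
  "gap_gradient \<kappa> \<mu> \<nu> y = (\<Sum>j. (\<kappa> * gap_weight j * (moment \<mu> j - moment \<nu> j)) * lower (\<lambda>i. y ^ i) j)"

lemma abs_moment_diff_le:
  assumes "\<mu> \<in> exp_class \<delta> R" "\<nu> \<in> exp_class \<delta> R" "\<delta> > 0"
  shows "\<bar>moment \<mu> j - moment \<nu> j\<bar> \<le> 2 * moment_bound \<delta> R j"
  using abs_moment_le[OF assms(1,3), of j] abs_moment_le[OF assms(2,3), of j] by linarith

lemma moment_gap_sums: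
  assumes "\<mu> \<in> exp_class \<delta> R" "\<nu> \<in> exp_class \<delta> R" "\<delta> > 0"
  shows "summable (\<lambda>j. gap_weight j * (moment \<mu> j - moment \<nu> j)\<^sup>2)"
    "(\<lambda>j. gap_weight j * (moment \<mu> j - moment \<nu> j)\<^sup>2) sums moment_gap \<mu> \<nu>"
proof -
  have "R \<ge> 0" using exp_class_ge_1[OF assms(1,3)] by simp
  from summable_gap_weight_bounded(1)[OF assms(3) this abs_moment_diff_le[OF assms]]
  show "summable (\<lambda>j. gap_weight j * (moment \<mu> j - moment \<nu> j)\<^sup>2)" .
  thus "(\<lambda>j. gap_weight j * (moment \<mu> j - moment \<nu> j)\<^sup>2) sums moment_gap \<mu> \<nu>"
    by (simp add: moment_gap_def summable_sums)
qed

lemma summable_gap_weight_powser: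
  assumes "\<delta> > 0" "R \<ge> 0" "\<And>j. \<bar>d j\<bar> \<le> K * moment_bound \<delta> R j"
  shows "summable (\<lambda>j. gap_weight j * d j * y ^ j)"
proof -
  have K: "K * moment_bound \<delta> R j \<ge> 0" for j using assms(3)[of j] by linarith
  have s: "summable (\<lambda>j. (K * R * exp \<delta>) * ((\<bar>y\<bar> / \<delta>) ^ j /\<^sub>R fact j))"
    by (intro summable_mult summable_exp_generic)
  show ?thesis
  proof (rule summable_comparison_test'[OF s, of 0])
    fix j :: nat
    have "norm (gap_weight j * d j * y ^ j) = gap_weight j * \<bar>d j\<bar> * \<bar>y\<bar> ^ j"
      using gap_weight_pos[of j] by (simp add: abs_mult power_abs)
    also have "\<dots> \<le> gap_weight j * (K * moment_bound \<delta> R j) * \<bar>y\<bar> ^ j"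
      using gap_weight_pos[of j] assms(3)[of j] by (intro mult_right_mono mult_left_mono) auto
    also have "\<dots> = ((K * moment_bound \<delta> R j) * (1 / fact j) * \<bar>y\<bar> ^ j / fact j) / (fact j * fact j)"
      by (simp add: gap_weight_def power4_eq_xxxx)
    also have "\<dots> \<le> ((K * moment_bound \<delta> R j) * (1 / fact j) * \<bar>y\<bar> ^ j / fact j) / 1"
      using K[of j] by (intro divide_left_mono) (auto simp: mult_ge1_I)
    also have "\<dots> = (K * R * exp \<delta>) * ((\<bar>y\<bar> / \<delta>) ^ j /\<^sub>R fact j)"
      using assms(1) by (simp add: moment_bound_def field_simps power_divide)
    finally show "norm (gap_weight j * d j * y ^ j) \<le> (K * R * exp \<delta>) * ((\<bar>y\<bar> / \<delta>) ^ j /\<^sub>R fact j)" .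
  qed
qed

lemma gap_gradient_coeff:
  assumes "\<mu> \<in> exp_class \<delta> R" "\<nu> \<in> exp_class \<delta> R" "\<delta> > 0"
  shows "summable (\<lambda>j. (\<kappa> * gap_weight j * (moment \<mu> j - moment \<nu> j)) * y ^ j)"
    and "summable (\<lambda>j. \<bar>\<kappa> * gap_weight j * (moment \<mu> j - moment \<nu> j)\<bar> * moment_bound \<delta> R j)"
proof -
  have R: "R \<ge> 0" using exp_class_ge_1[OF assms(1,3)] by simp
  show "summable (\<lambda>j. (\<kappa> * gap_weight j * (moment \<mu> j - moment \<nu> j)) * y ^ j)"
    using summable_mult[OF summable_gap_weight_powser[OF assms(3) R abs_moment_diff_le[OF assms]], of \<kappa>]
    by (simp add: mult_ac)
  have "summable (\<lambda>j. \<bar>\<kappa>\<bar> * \<bar>gap_weight j * (moment \<mu> j - moment \<nu> j) * moment_bound \<delta> R j\<bar>)"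
    by (intro summable_mult gap_weight_pairing(1) moment_gap_sums(1)[OF assms] summable_gap_weight_moment_bound assms R)
  thus "summable (\<lambda>j. \<bar>\<kappa> * gap_weight j * (moment \<mu> j - moment \<nu> j)\<bar> * moment_bound \<delta> R j)"
    using moment_bound_nonneg[OF assms(3) R] by (simp add: abs_mult mult_ac)
qed

lemma C1_on_quadratic:
  fixes h h' :: "real \<Rightarrow> real"
  assumes h: "\<And>t. (h has_real_derivative h' t) (at t)" and h': "continuous_on UNIV h'"
  shows "C1_on S (\<lambda>(t::real, x::real, y::real). h t + c * ((x - a)\<^sup>2 + (y - b)\<^sup>2))"
  unfolding C1_on_def
proof (intro exI conjI ballI)
  let ?F' = "\<lambda>z::real \<times> real \<times> real. h' (fst z) *\<^sub>R fst_blinfun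
      + (2 * c * (fst (snd z) - a)) *\<^sub>R (fst_blinfun o\<^sub>L snd_blinfun)
      + (2 * c * (snd (snd z) - b)) *\<^sub>R (snd_blinfun o\<^sub>L snd_blinfun)"
  show "continuous_on S ?F'"
    by (intro continuous_intros continuous_on_compose2[OF h'] ) auto
  fix z assume "z \<in> S"
  have 1: "(h has_derivative (*) (h' (fst z))) (at (fst z))"
    using h[of "fst z"] by (simp add: has_field_derivative_def)
  have 2: "((\<lambda>z. h (fst z)) has_derivative (\<lambda>x. h' (fst z) * fst x)) (at z within S)"
    using has_derivative_compose[OF has_derivative_fst[OF has_derivative_ident] 1]
    by (simp add: o_def)
  have F': "blinfun_apply (?F' z) = (\<lambda>x. h' (fst z) * fst x
      + 2 * c * (fst (snd z) - a) * fst (snd x) + 2 * c * (snd (snd z) - b) * snd (snd x))"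
    by (auto simp: blinfun.add_left blinfun.scaleR_left fun_eq_iff)
  show "((\<lambda>(t, x, y). h t + c * ((x - a)\<^sup>2 + (y - b)\<^sup>2)) has_derivative blinfun_apply (?F' z)) (at z within S)"
    unfolding case_prod_unfold F'
    by (rule has_derivative_eq_rhs, (rule derivative_intros 2)+) (auto simp: fun_eq_iff algebra_simps)
qed

lemma tail_suminf_ennreal:
  assumes q: "summable q" "\<And>j. q j \<ge> 0" and f: "\<And>j. f j \<le> ennreal (q j)"
  shows "(\<lambda>M. \<Sum>j. f (j + M)) \<longlonglongrightarrow> (0::ennreal)"
proof (rule tendsto_sandwich[OF _ _ tendsto_const])
  have "(\<lambda>M. \<Sum>j. q (j + M)) \<longlonglongrightarrow> 0" by (rule suminf_exist_split2[OF q(1)])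
  hence "(\<lambda>M. ennreal (\<Sum>j. q (j + M))) \<longlonglongrightarrow> ennreal 0" by (rule tendsto_ennrealI)
  thus "(\<lambda>M. ennreal (\<Sum>j. q (j + M))) \<longlonglongrightarrow> 0" by simp
  have "(\<Sum>j. f (j + M)) \<le> ennreal (\<Sum>j. q (j + M))" for M
  proof -
    have "(\<Sum>j. f (j + M)) \<le> (\<Sum>j. ennreal (q (j + M)))" by (intro suminf_le f) auto
    also have "\<dots> = ennreal (\<Sum>j. q (j + M))"
      by (rule suminf_ennreal2) (use q summable_iff_shift[of q M] in auto)
    finally show ?thesis .
  qed
  thus "\<forall>\<^sub>F M in sequentially. (\<Sum>j. f (j + M)) \<le> ennreal (\<Sum>j. q (j + M))" by simp
qed simp

lemma nn_integral_lower:
  assumes \<mu>: "\<mu> \<in> exp_class \<delta> R" and \<delta>: "\<delta> > 0"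
  shows "(\<integral>\<^sup>+ y. ennreal \<bar>c * lower (\<lambda>i. y ^ i) j\<bar> \<partial>\<mu>) \<le> ennreal (\<bar>c\<bar> * (\<delta> * moment_bound \<delta> R j))"
    and "(\<integral>\<^sup>+ y. ennreal \<bar>c * lower (lower (\<lambda>i. y ^ i)) j\<bar> \<partial>\<mu>) \<le> ennreal (\<bar>c\<bar> * (\<delta> * \<delta> * moment_bound \<delta> R j))"
proof -
  note I = integral_abs_lower[OF \<mu> \<delta>, of j]
  have nn: "lower (\<lambda>i. \<bar>y\<bar> ^ i) j \<ge> 0" "lower (lower (\<lambda>i. \<bar>y\<bar> ^ i)) j \<ge> 0" for y :: real
    by (auto simp: lower_def)
  have e: "\<bar>c * lower (\<lambda>i. y ^ i) j\<bar> = \<bar>c\<bar> * lower (\<lambda>i. \<bar>y\<bar> ^ i) j"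
    "\<bar>c * lower (lower (\<lambda>i. y ^ i)) j\<bar> = \<bar>c\<bar> * lower (lower (\<lambda>i. \<bar>y\<bar> ^ i)) j" for y
    by (auto simp: abs_mult abs_lower power_abs)
  show "(\<integral>\<^sup>+ y. ennreal \<bar>c * lower (\<lambda>i. y ^ i) j\<bar> \<partial>\<mu>) \<le> ennreal (\<bar>c\<bar> * (\<delta> * moment_bound \<delta> R j))"
    unfolding e using I(1,2) nn by (subst nn_integral_eq_integral) (auto intro!: ennreal_leI mult_left_mono)
  show "(\<integral>\<^sup>+ y. ennreal \<bar>c * lower (lower (\<lambda>i. y ^ i)) j\<bar> \<partial>\<mu>) \<le>
      ennreal (\<bar>c\<bar> * (\<delta> * \<delta> * moment_bound \<delta> R j))"
    unfolding e using I(3,4) nn by (subst nn_integral_eq_integral) (auto intro!: ennreal_leI mult_left_mono)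
qed

text \<open>
  The function \<open>\<rho> s + \<kappa>/2 ((s - s\<^sub>0)\<^sup>2 + moment_gap \<alpha>\<^sub>1 \<nu>\<^sub>1 + moment_gap \<alpha>\<^sub>2 \<nu>\<^sub>2)\<close> is a test function: its
  \<open>j\<close>-th term depends on the measures through the moments of order \<open>j\<close> only, and the derivatives of
  that term are bounded on the domain by a multiple of \<open>gap_weight j * (moment_bound \<delta> R j)\<^sup>2\<close>, which is
  summable. Hence its derivatives at a point where it touches \<open>u\<close> from above, up to a
  constant, belong to the jet.
\<close>

lemma quadratic_jet:
  fixes u :: "state \<Rightarrow> real"
  assumes \<delta>: "\<delta> > 0" and \<kappa>: "\<kappa> > 0"
    and E: "\<And>s \<alpha>1 \<alpha>2. (s, \<alpha>1, \<alpha>2) \<in> E \<Longrightarrow> \<alpha>1 \<in> exp_class \<delta> R \<and> \<alpha>2 \<in> exp_class \<delta> R"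
    and \<nu>: "\<nu>1 \<in> exp_class \<delta> R" "\<nu>2 \<in> exp_class \<delta> R"
    and z: "(t, \<mu>1, \<mu>2) \<in> E"
    and max: "\<And>s \<alpha>1 \<alpha>2. (s, \<alpha>1, \<alpha>2) \<in> E \<Longrightarrow>
      u (s, \<alpha>1, \<alpha>2) - (\<rho> * s + \<kappa> / 2 * ((s - s0)\<^sup>2 + moment_gap \<alpha>1 \<nu>1 + moment_gap \<alpha>2 \<nu>2)) \<le>
      u (t, \<mu>1, \<mu>2) - (\<rho> * t + \<kappa> / 2 * ((t - s0)\<^sup>2 + moment_gap \<mu>1 \<nu>1 + moment_gap \<mu>2 \<nu>2))"
  shows "(\<rho> + \<kappa> * (t - s0), gap_gradient \<kappa> \<mu>1 \<nu>1, gap_gradient \<kappa> \<mu>2 \<nu>2) \<in> J_plus T E u (t, \<mu>1, \<mu>2)"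
proof -
  have R: "R \<ge> 0" using exp_class_ge_1[OF \<nu>(1) \<delta>] by simp
  note A0 = moment_bound_nonneg[OF \<delta> R]
  \<comment> \<open>the term of order 0 is free to carry the time, because all moments of order 0 are 1\<close>
  define h where "h j s = (if j = (0::nat) then \<rho> * s + \<kappa> / 2 * (s - s0)\<^sup>2 else 0)" for j s
  define c where "c j = \<kappa> / 2 * gap_weight j" for j
  define F where "F j = (\<lambda>(s::real, x::real, y::real).
      h j s + c j * ((x - moment \<nu>1 j)\<^sup>2 + (y - moment \<nu>2 j)\<^sup>2))" for j
  define \<phi> where "\<phi> j = (\<lambda>(s, \<alpha>1, \<alpha>2). F j (s, moment \<alpha>1 j, moment \<alpha>2 j))" for j
  define p1 where "p1 j = (\<lambda>(s::real, \<alpha>1, \<alpha>2::real measure) y.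
      2 * c j * (moment \<alpha>1 j - moment \<nu>1 j) * lower (\<lambda>i. y ^ i) j)" for j
  define p2 where "p2 j = (\<lambda>(s::real, \<alpha>1::real measure, \<alpha>2) y.
      2 * c j * (moment \<alpha>2 j - moment \<nu>2 j) * lower (\<lambda>i. y ^ i) j)" for j
  \<comment> \<open>test functions live on spaces of order at least 2, also for the moments of order 0 and 1\<close>
  define k where "k j = max 2 j" for j :: nat
  have c0: "c j \<ge> 0" for j using \<kappa> gap_weight_pos[of j] by (simp add: c_def)
  have dp: "deriv (\<lambda>y. C * lower (\<lambda>i. y ^ i) j) y = C * lower (lower (\<lambda>i. y ^ i)) j" for C j and y :: real
    by (rule DERIV_imp_deriv) (intro DERIV_cmult DERIV_lower_power)
  have phi_sums: "(\<lambda>j. \<phi> j (s, \<alpha>1, \<alpha>2)) sums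
      (\<rho> * s + \<kappa> / 2 * ((s - s0)\<^sup>2 + moment_gap \<alpha>1 \<nu>1 + moment_gap \<alpha>2 \<nu>2))"
    if "\<alpha>1 \<in> exp_class \<delta> R" "\<alpha>2 \<in> exp_class \<delta> R" for s \<alpha>1 \<alpha>2
  proof -
    have "(\<lambda>j. h j s) sums (\<rho> * s + \<kappa> / 2 * (s - s0)\<^sup>2)"
      unfolding h_def by (rule sums_single)
    from sums_add[OF this sums_add[OF sums_mult[OF moment_gap_sums(2)[OF that(1) \<nu>(1) \<delta>], of "\<kappa>/2"]
        sums_mult[OF moment_gap_sums(2)[OF that(2) \<nu>(2) \<delta>], of "\<kappa>/2"]]]
    show ?thesis by (simp add: \<phi>_def F_def c_def algebra_simps)
  qed
  have absphi: "summable (\<lambda>j. \<bar>\<phi> j w\<bar>)" if "w \<in> E" for w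
  proof -
    obtain s \<alpha>1 \<alpha>2 where w: "w = (s, \<alpha>1, \<alpha>2)" by (cases w)
    have e: "\<alpha>1 \<in> exp_class \<delta> R" "\<alpha>2 \<in> exp_class \<delta> R" using E that w by auto
    have "summable (\<lambda>j. \<phi> j w)" using phi_sums[OF e] by (auto simp: w sums_iff)
    hence "summable (\<lambda>j. \<phi> (Suc j) w)" by (rule summable_Suc_iff[of "\<lambda>j. \<phi> j w", THEN iffD2])
    moreover have "\<phi> (Suc j) w \<ge> 0" for j using c0 by (simp add: \<phi>_def F_def h_def w)
    ultimately have "summable (\<lambda>j. \<bar>\<phi> (Suc j) w\<bar>)" by simp
    thus ?thesis by (rule summable_Suc_iff[of "\<lambda>j. \<bar>\<phi> j w\<bar>", THEN iffD1])
  qed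
  have cyl: "cylindrical_polynomial T (k j) (\<phi> j)" for j
    unfolding cylindrical_polynomial_def
  proof (intro exI[of _ "F j"] exI[of _ "monom 1 j"] conjI ballI)
    show "C1_on ({0..T} \<times> UNIV \<times> UNIV) (F j)"
      unfolding F_def
      by (rule C1_on_quadratic[where h'="\<lambda>s. if j = 0 then \<rho> + \<kappa> * (s - s0) else 0"])
         (cases "j = 0"; auto simp: h_def[abs_def] intro!: derivative_eq_intros continuous_intros)+
    show "degree (monom (1::real) j) \<le> k j" using degree_monom_le[of "1::real" j] by (simp add: k_def)
    thus "degree (monom (1::real) j) \<le> k j" .
  next
    have "poly (monom 1 j) = (\<lambda>x::real. x ^ j)" by (auto simp: poly_monom)
    thus "\<phi> j (s, \<mu>, \<nu>) = F j (s, LINT x|\<mu>. poly (monom 1 j) x, LINT x|\<nu>. poly (monom 1 j) x)"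
      for s \<mu> \<nu> by (simp add: \<phi>_def moment_def)
  qed
  have Lder: "L_derivative (k j) (\<lambda>\<mu>. \<phi> j (s, \<mu>, \<nu>)) (\<lambda>\<mu>. p1 j (s, \<mu>, \<nu>))"
    "L_derivative (k j) (\<lambda>\<mu>. \<phi> j (s, \<nu>, \<mu>)) (\<lambda>\<mu>. p2 j (s, \<nu>, \<mu>))" for j s \<nu>
  proof -
    show "L_derivative (k j) (\<lambda>\<mu>. \<phi> j (s, \<mu>, \<nu>)) (\<lambda>\<mu>. p1 j (s, \<mu>, \<nu>))"
      unfolding p1_def prod.case
      by (rule L_derivative_moment_square[where K="h j s + c j * (moment \<nu> j - moment \<nu>2 j)\<^sup>2"])
         (auto simp: k_def \<phi>_def F_def algebra_simps)
    show "L_derivative (k j) (\<lambda>\<mu>. \<phi> j (s, \<nu>, \<mu>)) (\<lambda>\<mu>. p2 j (s, \<nu>, \<mu>))"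
      unfolding p2_def prod.case
      by (rule L_derivative_moment_square[where K="h j s + c j * (moment \<nu> j - moment \<nu>1 j)\<^sup>2"])
         (auto simp: k_def \<phi>_def F_def algebra_simps)
  qed
  define q where "q j = 4 * \<kappa> * (\<delta> + \<delta> * \<delta>) * (gap_weight j * (moment_bound \<delta> R j)\<^sup>2)" for j
  have q: "summable q" "q j \<ge> 0" for j
    using \<kappa> \<delta> gap_weight_pos[of j] by (auto simp: q_def[abs_def] intro!: summable_mult summable_gap_weight_moment_bound R)
  have supb: "(SUP (s, \<alpha>1, \<alpha>2)\<in>E.
          (\<integral>\<^sup>+ y. ennreal \<bar>p1 j (s, \<alpha>1, \<alpha>2) y\<bar> \<partial>\<alpha>1)
        + (\<integral>\<^sup>+ y. ennreal \<bar>deriv (p1 j (s, \<alpha>1, \<alpha>2)) y\<bar> \<partial>\<alpha>1)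
        + (\<integral>\<^sup>+ y. ennreal \<bar>p2 j (s, \<alpha>1, \<alpha>2) y\<bar> \<partial>\<alpha>2)
        + (\<integral>\<^sup>+ y. ennreal \<bar>deriv (p2 j (s, \<alpha>1, \<alpha>2)) y\<bar> \<partial>\<alpha>2)) \<le> ennreal (q j)" for j
  proof (rule SUP_least, clarify)
    fix s \<alpha>1 \<alpha>2 assume "(s, \<alpha>1, \<alpha>2) \<in> E"
    hence e: "\<alpha>1 \<in> exp_class \<delta> R" "\<alpha>2 \<in> exp_class \<delta> R" using E by auto
    define C1 where "C1 = 2 * c j * (moment \<alpha>1 j - moment \<nu>1 j)"
    define C2 where "C2 = 2 * c j * (moment \<alpha>2 j - moment \<nu>2 j)"
    let ?A = "moment_bound \<delta> R j"
    let ?B = "2 * c j * (2 * ?A)"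
    have C: "\<bar>C1\<bar> \<le> ?B" "\<bar>C2\<bar> \<le> ?B"
      using mult_left_mono[OF abs_moment_diff_le[OF e(1) \<nu>(1) \<delta>], of "2 * c j" j]
        mult_left_mono[OF abs_moment_diff_le[OF e(2) \<nu>(2) \<delta>], of "2 * c j" j] c0[of j]
      by (simp_all add: C1_def C2_def abs_mult)
    have p: "p1 j (s, \<alpha>1, \<alpha>2) = (\<lambda>y. C1 * lower (\<lambda>i. y ^ i) j)"
      "p2 j (s, \<alpha>1, \<alpha>2) = (\<lambda>y. C2 * lower (\<lambda>i. y ^ i) j)"
      by (auto simp: p1_def p2_def C1_def C2_def)
    have n: "ennreal (\<bar>C\<bar> * (\<delta> * ?A)) \<le> ennreal (?B * (\<delta> * ?A))"
      "ennreal (\<bar>C\<bar> * (\<delta> * \<delta> * ?A)) \<le> ennreal (?B * (\<delta> * \<delta> * ?A))" if "\<bar>C\<bar> \<le> ?B" for C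
      by (intro ennreal_leI mult_right_mono that; use \<delta> A0[of j] in simp)+
    have "(\<integral>\<^sup>+ y. ennreal \<bar>p1 j (s, \<alpha>1, \<alpha>2) y\<bar> \<partial>\<alpha>1)
        + (\<integral>\<^sup>+ y. ennreal \<bar>deriv (p1 j (s, \<alpha>1, \<alpha>2)) y\<bar> \<partial>\<alpha>1)
        + (\<integral>\<^sup>+ y. ennreal \<bar>p2 j (s, \<alpha>1, \<alpha>2) y\<bar> \<partial>\<alpha>2)
        + (\<integral>\<^sup>+ y. ennreal \<bar>deriv (p2 j (s, \<alpha>1, \<alpha>2)) y\<bar> \<partial>\<alpha>2)
      \<le> ennreal (?B * (\<delta> * ?A)) + ennreal (?B * (\<delta> * \<delta> * ?A))
        + ennreal (?B * (\<delta> * ?A)) + ennreal (?B * (\<delta> * \<delta> * ?A))"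
      unfolding p dp
      by (intro add_mono order_trans[OF nn_integral_lower(1)[OF e(1) \<delta>]]
          order_trans[OF nn_integral_lower(2)[OF e(1) \<delta>]]
          order_trans[OF nn_integral_lower(1)[OF e(2) \<delta>]]
          order_trans[OF nn_integral_lower(2)[OF e(2) \<delta>]] n C)
    also have "\<dots> = ennreal (2 * (?B * (\<delta> * ?A) + ?B * (\<delta> * \<delta> * ?A)))"
    proof -
      have "ennreal a + ennreal b + ennreal a + ennreal b = ennreal (2 * (a + b))"
        if "a \<ge> 0" "b \<ge> 0" for a b
        using that by (simp add: ennreal_plus[symmetric] del: ennreal_plus)
      thus ?thesis using \<delta> A0[of j] c0[of j] by simp
    qed
    also have "2 * (?B * (\<delta> * ?A) + ?B * (\<delta> * \<delta> * ?A)) = q j"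
      by (simp add: q_def c_def power2_eq_square algebra_simps)
    finally show "(\<integral>\<^sup>+ y. ennreal \<bar>p1 j (s, \<alpha>1, \<alpha>2) y\<bar> \<partial>\<alpha>1)
        + (\<integral>\<^sup>+ y. ennreal \<bar>deriv (p1 j (s, \<alpha>1, \<alpha>2)) y\<bar> \<partial>\<alpha>1)
        + (\<integral>\<^sup>+ y. ennreal \<bar>p2 j (s, \<alpha>1, \<alpha>2) y\<bar> \<partial>\<alpha>2)
        + (\<integral>\<^sup>+ y. ennreal \<bar>deriv (p2 j (s, \<alpha>1, \<alpha>2)) y\<bar> \<partial>\<alpha>2) \<le> ennreal (q j)" .
  qed
  have ts: "test_series T E k \<phi> p1 p2"
    unfolding test_series_def
    by (intro conjI allI ballI cyl Lder absphi tail_suminf_ennreal[OF q supb]) (simp add: k_def)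
  have e: "\<mu>1 \<in> exp_class \<delta> R" "\<mu>2 \<in> exp_class \<delta> R" using E[OF z] by auto
  have phi_eq: "(\<Sum>j. \<phi> j (s, \<alpha>1, \<alpha>2)) = \<rho> * s + \<kappa> / 2 * ((s - s0)\<^sup>2 + moment_gap \<alpha>1 \<nu>1 + moment_gap \<alpha>2 \<nu>2)"
    if "\<alpha>1 \<in> exp_class \<delta> R" "\<alpha>2 \<in> exp_class \<delta> R" for s \<alpha>1 \<alpha>2
    using phi_sums[OF that] by (simp add: sums_iff)
  have mx: "\<forall>w\<in>E. u w - (\<Sum>j. \<phi> j w) \<le> u (t, \<mu>1, \<mu>2) - (\<Sum>j. \<phi> j (t, \<mu>1, \<mu>2))"
  proof
    fix w assume w: "w \<in> E"
    obtain s \<alpha>1 \<alpha>2 where w': "w = (s, \<alpha>1, \<alpha>2)" by (cases w)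
    show "u w - (\<Sum>j. \<phi> j w) \<le> u (t, \<mu>1, \<mu>2) - (\<Sum>j. \<phi> j (t, \<mu>1, \<mu>2))"
      using max[OF w[unfolded w']] E[OF w[unfolded w']] by (simp add: phi_eq e w')
  qed
  have td: "((\<lambda>s. \<Sum>j. \<phi> j (s, \<mu>1, \<mu>2)) has_real_derivative \<rho> + \<kappa> * (t - s0))
        (at t within {s. (s, \<mu>1, \<mu>2) \<in> E})"
    unfolding phi_eq[OF e] by (auto intro!: derivative_eq_intros)
  have sc: "series_C1_sum (\<lambda>j y. (2 * c j * (moment \<alpha> j - moment \<beta> j)) * lower (\<lambda>i. y ^ i) j) (gap_gradient \<kappa> \<alpha> \<beta>)"
    if "\<alpha> \<in> exp_class \<delta> R" "\<beta> \<in> exp_class \<delta> R" for \<alpha> \<beta>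
  proof -
    have c: "2 * c j * (moment \<alpha> j - moment \<beta> j) = \<kappa> * gap_weight j * (moment \<alpha> j - moment \<beta> j)" for j
      by (simp add: c_def)
    have m: "gap_gradient \<kappa> \<alpha> \<beta> = (\<lambda>y. \<Sum>j. (\<kappa> * gap_weight j * (moment \<alpha> j - moment \<beta> j)) * lower (\<lambda>i. y ^ i) j)"
      by (auto simp: gap_gradient_def)
    show ?thesis
      unfolding series_C1_sum_def dp unfolding c m
      using entire_series_derivatives[OF gap_gradient_coeff(1)[OF that \<delta>], of \<kappa>] by blast
  qed
  have s1: "series_C1_sum (\<lambda>j. p1 j (t, \<mu>1, \<mu>2)) (gap_gradient \<kappa> \<mu>1 \<nu>1)"
    using sc[OF e(1) \<nu>(1)] by (simp add: p1_def)
  have s2: "series_C1_sum (\<lambda>j. p2 j (t, \<mu>1, \<mu>2)) (gap_gradient \<kappa> \<mu>2 \<nu>2)"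
    using sc[OF e(2) \<nu>(2)] by (simp add: p2_def)
  show ?thesis
    unfolding J_plus_def using ts z mx td s1 s2 by blast
qed

section \<open>Sequential compactness of the domain\<close>

lemma weak_conv_m_subseq:
  "weak_conv_m \<mu> M \<Longrightarrow> strict_mono r \<Longrightarrow> weak_conv_m (\<mu> \<circ> r) M"
  unfolding weak_conv_m_def weak_conv_def
  by (auto intro: LIMSEQ_subseq_LIMSEQ[unfolded o_def])

text \<open>
  Helly's selection theorem; the limit stays in the class by \<open>exp_class_limit\<close>.
\<close>

lemma exp_class_seq_compact:
  fixes \<mu> :: "nat \<Rightarrow> real measure"
  assumes "\<And>n. \<mu> n \<in> exp_class \<delta> R" "\<delta> > 0"
  obtains r M where "strict_mono r" "M \<in> exp_class \<delta> R" "weak_conv_m (\<mu> \<circ> r) M"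
proof -
  have "strict_mono (\<lambda>n::nat. n)" by (simp add: strict_mono_def)
  from tight_imp_convergent_subsubsequence[of \<mu> "\<lambda>n. n", OF tight_exp_class[of \<mu>, OF assms] this]
  obtain r M where r: "strict_mono r" "real_distribution M" "weak_conv_m (\<mu> \<circ> r) M"
    by (auto simp: o_def)
  have "M \<in> exp_class \<delta> R"
    by (rule exp_class_limit[OF _ assms(2) r(2,3) _ tendsto_const])
       (use assms(1) exp_classD(5)[OF assms(1)] in auto)
  thus ?thesis using that r by blast
qed

text \<open>
  The finite second moment demanded by the domain follows from the exponential one.
\<close>

lemma O_closed_iff:
  assumes "\<delta> > 0"
  shows "(t, \<mu>1, \<mu>2) \<in> O_closed T C0 \<delta> N \<longleftrightarrow> t \<in> {0..T} \<and>
    \<mu>1 \<in> exp_class \<delta> (real N * exp (K_star C0 \<delta> * t)) \<and>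
    \<mu>2 \<in> exp_class \<delta> (real N * exp (K_star C0 \<delta> * t))"
proof -
  have "\<mu> \<in> Pspace 2 UNIV" if "\<mu> \<in> exp_class \<delta> R" for \<mu> R
    using exp_classD[OF that] exp_class_abs_power(1)[OF that assms, of 2] by (simp add: Pspace_def)
  thus ?thesis by (auto simp: O_closed_def exp_class_def Pspace_def)
qed

lemma O_closed_exp_class:
  assumes "\<delta> > 0" "C0 > 0" "z \<in> O_closed T C0 \<delta> N"
  shows "fst z \<in> {0..T}" "fst (snd z) \<in> exp_class \<delta> (real N * exp (K_star C0 \<delta> * T))"
    "snd (snd z) \<in> exp_class \<delta> (real N * exp (K_star C0 \<delta> * T))"
proof -
  obtain t \<mu>1 \<mu>2 where z: "z = (t, \<mu>1, \<mu>2)" by (cases z)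
  have K: "K_star C0 \<delta> \<ge> 0" using assms by (simp add: K_star_def)
  have m: "exp_class \<delta> R \<subseteq> exp_class \<delta> R'" if "R \<le> R'" for R R'
    using that by (auto simp: exp_class_def)
  have "t \<in> {0..T}" using assms(3) by (simp add: z O_closed_iff[OF assms(1)])
  hence "real N * exp (K_star C0 \<delta> * t) \<le> real N * exp (K_star C0 \<delta> * T)"
    using K by (intro mult_left_mono) (auto intro: mult_left_mono)
  from m[OF this]
  show "fst z \<in> {0..T}" "fst (snd z) \<in> exp_class \<delta> (real N * exp (K_star C0 \<delta> * T))"
    "snd (snd z) \<in> exp_class \<delta> (real N * exp (K_star C0 \<delta> * T))"
    using assms(3) by (auto simp: z O_closed_iff[OF assms(1)])
qed

text \<open>
  Weak convergence is expressed through distribution functions, the form in which the selection and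
  representation theorems for real distributions deliver it. Sequences suffice for the compactness
  argument, so the topology of the domain enters only through \<open>O_topology_seq_continuous\<close>.
\<close>

definition state_conv :: "(nat \<Rightarrow> state) \<Rightarrow> state \<Rightarrow> bool" where
  "state_conv z w \<longleftrightarrow> (\<lambda>n. fst (z n)) \<longlonglongrightarrow> fst w \<and>
     weak_conv_m (\<lambda>n. fst (snd (z n))) (fst (snd w)) \<and> weak_conv_m (\<lambda>n. snd (snd (z n))) (snd (snd w))"

lemma state_conv_subseq:
  assumes "state_conv z w" "strict_mono r"
  shows "state_conv (z \<circ> r) w"
proof -
  have "((\<lambda>n. fst (z n)) \<circ> r) \<longlonglongrightarrow> fst w"
    using assms by (intro LIMSEQ_subseq_LIMSEQ) (auto simp: state_conv_def)
  moreover have "weak_conv_m ((\<lambda>n. fst (snd (z n))) \<circ> r) (fst (snd w))"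
    "weak_conv_m ((\<lambda>n. snd (snd (z n))) \<circ> r) (snd (snd w))"
    using assms by (auto intro!: weak_conv_m_subseq simp: state_conv_def)
  ultimately show ?thesis by (simp add: state_conv_def o_def)
qed

text \<open>
  One subsequence for the time and one for each measure. The time-dependent exponential constraint
  passes to the limit because \<open>exp_class_limit\<close> allows a convergent sequence of radii.
\<close>

lemma O_closed_seq_compact:
  fixes z :: "nat \<Rightarrow> state"
  assumes \<delta>: "\<delta> > 0" and C: "C0 > 0" and z: "\<And>n. z n \<in> O_closed T C0 \<delta> N"
  obtains r w where "strict_mono r" "w \<in> O_closed T C0 \<delta> N" "state_conv (z \<circ> r) w"
proof -
  let ?R = "real N * exp (K_star C0 \<delta> * T)"
  note O = O_closed_exp_class[OF \<delta> C z]
  have sc: "seq_compact {0..T}" by (simp add: compact_imp_seq_compact)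
  have tr: "\<forall>n. fst (z n) \<in> {0..T}" using O(1) by blast
  obtain t r1 where 1: "t \<in> {0..T}" "strict_mono r1" "((\<lambda>n. fst (z n)) \<circ> r1) \<longlonglongrightarrow> t"
    by (rule seq_compactE[OF sc tr]) blast
  obtain r2 \<mu>1 where 2: "strict_mono r2" "\<mu>1 \<in> exp_class \<delta> ?R"
      "weak_conv_m ((\<lambda>n. fst (snd (z (r1 n)))) \<circ> r2) \<mu>1"
    using exp_class_seq_compact[of "\<lambda>n. fst (snd (z (r1 n)))", OF O(2) \<delta>] by blast
  obtain r3 \<mu>2 where 3: "strict_mono r3" "\<mu>2 \<in> exp_class \<delta> ?R"
      "weak_conv_m ((\<lambda>n. snd (snd (z (r1 (r2 n))))) \<circ> r3) \<mu>2"
    using exp_class_seq_compact[of "\<lambda>n. snd (snd (z (r1 (r2 n))))", OF O(3) \<delta>] by blast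
  define r where "r = r1 \<circ> (r2 \<circ> r3)"
  have r: "strict_mono r" unfolding r_def by (intro strict_mono_o 1 2 3)
  have t: "(\<lambda>n. fst (z (r n))) \<longlonglongrightarrow> t"
    using LIMSEQ_subseq_LIMSEQ[OF 1(3) strict_mono_o[OF 2(1) 3(1)]] by (simp add: r_def o_def)
  have w1: "weak_conv_m (\<lambda>n. fst (snd (z (r n)))) \<mu>1"
    using weak_conv_m_subseq[OF 2(3) 3(1)] by (simp add: r_def o_def)
  have w2: "weak_conv_m (\<lambda>n. snd (snd (z (r n)))) \<mu>2"
    using 3(3) by (simp add: r_def o_def)
  have lim: "(\<lambda>n. real N * exp (K_star C0 \<delta> * fst (z (r n)))) \<longlonglongrightarrow> real N * exp (K_star C0 \<delta> * t)"
    by (intro tendsto_intros t)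
  have zz: "fst (snd (z n)) \<in> exp_class \<delta> (real N * exp (K_star C0 \<delta> * fst (z n)))"
    "snd (snd (z n)) \<in> exp_class \<delta> (real N * exp (K_star C0 \<delta> * fst (z n)))" for n
    using z[of n] O_closed_iff[OF \<delta>, of "fst (z n)" "fst (snd (z n))" "snd (snd (z n))"] by auto
  have "\<mu>1 \<in> exp_class \<delta> (real N * exp (K_star C0 \<delta> * t))"
    by (rule exp_class_limit[OF O(2) \<delta> exp_classD(7)[OF 2(2)] w1 exp_classD(5)[OF zz(1)] lim])
  moreover have "\<mu>2 \<in> exp_class \<delta> (real N * exp (K_star C0 \<delta> * t))"
    by (rule exp_class_limit[OF O(3) \<delta> exp_classD(7)[OF 3(2)] w2 exp_classD(5)[OF zz(2)] lim])
  ultimately have "(t, \<mu>1, \<mu>2) \<in> O_closed T C0 \<delta> N"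
    using 1(1) by (simp add: O_closed_iff[OF \<delta>])
  moreover have "state_conv (z \<circ> r) (t, \<mu>1, \<mu>2)"
    using t w1 w2 by (simp add: state_conv_def)
  ultimately show ?thesis using that r by blast
qed

lemma limitin_topology_generated_by:
  assumes "l \<in> \<Union>S" "\<And>B. B \<in> S \<Longrightarrow> l \<in> B \<Longrightarrow> eventually (\<lambda>n. f n \<in> B) F"
  shows "limitin (topology_generated_by S) f l F"
proof -
  have "l \<in> G \<longrightarrow> eventually (\<lambda>n. f n \<in> G) F" if "generate_topology_on S G" for G
    using that
  proof induction
    case (Int a b)
    thus ?case by (auto intro: eventually_conj)
  next
    case (UN K)
    show ?case
    proof
      assume "l \<in> \<Union>K"
      then obtain X where X: "X \<in> K" "l \<in> X" by blast
      with UN have "eventually (\<lambda>n. f n \<in> X) F" by blast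
      thus "eventually (\<lambda>n. f n \<in> \<Union>K) F" by (rule eventually_mono) (use X in blast)
    qed
  qed (use assms in auto)
  thus ?thesis using assms(1)
    by (auto simp: limitin_def topology_generated_by_topspace openin_topology_generated_by_iff)
qed

text \<open>
  The topology is generated by integrals of bounded continuous functions, so it is enough to check
  the generating sets.
\<close>

lemma limitin_weak_topology:
  assumes \<mu>: "\<And>n. real_distribution (\<mu> n)" and M: "real_distribution M" and w: "weak_conv_m \<mu> M"
  shows "limitin weak_topology \<mu> M sequentially"
  unfolding weak_topology_def
proof (rule limitin_topology_generated_by)
  interpret M: real_distribution M by (rule M)
  have p: "prob_space (\<mu> n) \<and> sets (\<mu> n) = sets borel" for n
    using \<mu>[of n] by (simp add: real_distribution_def real_distribution_axioms_def)
  let ?B = "\<lambda>f V. {\<mu>. prob_space \<mu> \<and> sets \<mu> = sets borel \<and> (LINT x|\<mu>. f x) \<in> (V :: real set)}"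
  let ?S = "{?B f V | f V. continuous_on UNIV f \<and> bounded (range f) \<and> open V}"
  have "M \<in> ?B (\<lambda>_. 0) UNIV" using M.prob_space_axioms M.events_eq_borel by simp
  moreover have "?B (\<lambda>_. 0) UNIV \<in> ?S"
    by (intro CollectI exI[of _ "\<lambda>_. 0"] exI[of _ UNIV]) (auto simp: image_constant_conv)
  ultimately show "M \<in> \<Union>?S" by (rule UnionI[rotated])
  fix B assume "B \<in> ?S" "M \<in> B"
  then obtain f V where B: "B = ?B f V" "continuous_on UNIV f" "bounded (range f)" "open V"
    and MV: "(LINT x|M. f x) \<in> V" by auto
  obtain b where "\<And>x. \<bar>f x\<bar> \<le> b" using B(3) by (auto simp: bounded_iff)
  from weak_conv_m_bdd_continuous[OF \<mu> M w B(2) this]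
  have "eventually (\<lambda>n. (LINT x|\<mu> n. f x) \<in> V) sequentially"
    using topological_tendstoD[OF _ B(4) MV] by blast
  thus "eventually (\<lambda>n. \<mu> n \<in> B) sequentially" using p by (simp add: B(1))
qed

lemma O_topology_seq_continuous:
  assumes \<delta>: "\<delta> > 0" and C: "C0 > 0" and u: "continuous_map (O_topology T C0 \<delta> N) euclideanreal u"
    and z: "\<And>n. z n \<in> O_closed T C0 \<delta> N" and w: "w \<in> O_closed T C0 \<delta> N" "state_conv z w"
  shows "(\<lambda>n. u (z n)) \<longlonglongrightarrow> u w"
proof -
  note Z = O_closed_exp_class[OF \<delta> C z] and W = O_closed_exp_class[OF \<delta> C w(1)]
  have "limitin (O_topology T C0 \<delta> N) z w sequentially"
    unfolding O_topology_def limitin_subtopology limitin_pairwise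
    using w z Z(1) W(1)
    by (auto simp: state_conv_def o_def intro!: limitin_weak_topology exp_classD(7)[OF Z(2)]
        exp_classD(7)[OF Z(3)] exp_classD(7)[OF W(2)] exp_classD(7)[OF W(3)])
  from continuous_map_limit[OF u this] show ?thesis by (simp add: o_def)
qed

text \<open>
  Every moment converges, and the moment bounds dominate the series (Tannery's theorem).
\<close>

lemma moment_gap_tendsto:
  assumes \<mu>: "\<And>n. \<mu> n \<in> exp_class \<delta> R" "M \<in> exp_class \<delta> R" "weak_conv_m \<mu> M"
    and \<nu>: "\<And>n. \<nu> n \<in> exp_class \<delta> R" "K \<in> exp_class \<delta> R" "weak_conv_m \<nu> K"
    and \<delta>: "\<delta> > 0"
  shows "(\<lambda>n. moment_gap (\<mu> n) (\<nu> n)) \<longlonglongrightarrow> moment_gap M K"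
proof -
  have R: "R \<ge> 0" using exp_class_ge_1[OF \<mu>(2) \<delta>] by simp
  have b: "norm (gap_weight j * (moment (\<mu> n) j - moment (\<nu> n) j)\<^sup>2) \<le> 4 * (gap_weight j * (moment_bound \<delta> R j)\<^sup>2)" for j n
  proof -
    have "\<bar>moment (\<mu> n) j - moment (\<nu> n) j\<bar>\<^sup>2 \<le> (2 * moment_bound \<delta> R j)\<^sup>2"
      by (rule power_mono[OF abs_moment_diff_le[OF \<mu>(1) \<nu>(1) \<delta>]]) simp
    hence "gap_weight j * (moment (\<mu> n) j - moment (\<nu> n) j)\<^sup>2 \<le> gap_weight j * (4 * (moment_bound \<delta> R j)\<^sup>2)"
      using gap_weight_pos[of j] by (intro mult_left_mono) (auto simp: power_mult_distrib)
    thus ?thesis using gap_weight_pos[of j] by (simp add: abs_mult)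
  qed
  have "((\<lambda>n. \<Sum>j. gap_weight j * (moment (\<mu> n) j - moment (\<nu> n) j)\<^sup>2) \<longlongrightarrow>
      (\<Sum>j. gap_weight j * (moment M j - moment K j)\<^sup>2)) sequentially"
  proof (rule tannerys_theorem[where M="\<lambda>j. 4 * (gap_weight j * (moment_bound \<delta> R j)\<^sup>2)", THEN conjunct2, THEN conjunct2])
    show "(\<lambda>n. gap_weight j * (moment (\<mu> n) j - moment (\<nu> n) j)\<^sup>2) \<longlonglongrightarrow> gap_weight j * (moment M j - moment K j)\<^sup>2" for j
      by (intro tendsto_intros exp_class_moment_limit[OF \<mu>(1) \<delta> \<mu>(2,3)]
         exp_class_moment_limit[OF \<nu>(1) \<delta> \<nu>(2,3)])
    show "\<forall>\<^sub>F (j, n) in sequentially \<times>\<^sub>F sequentially.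
        norm (gap_weight j * (moment (\<mu> n) j - moment (\<nu> n) j)\<^sup>2) \<le> 4 * (gap_weight j * (moment_bound \<delta> R j)\<^sup>2)"
      using b by (intro always_eventually) auto
    show "summable (\<lambda>j. 4 * (gap_weight j * (moment_bound \<delta> R j)\<^sup>2))"
      by (intro summable_mult summable_gap_weight_moment_bound \<delta> R)
  qed simp
  thus ?thesis by (simp add: moment_gap_def)
qed

lemma moment_gap_nonneg: 
  assumes "\<mu> \<in> exp_class \<delta> R" "\<nu> \<in> exp_class \<delta> R" "\<delta> > 0"
  shows "moment_gap \<mu> \<nu> \<ge> 0"
  unfolding moment_gap_def using moment_gap_sums(1)[OF assms] gap_weight_pos
  by (intro suminf_nonneg mult_nonneg_nonneg less_imp_le[OF gap_weight_pos]) auto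

lemma moment_gap_same [simp]: "moment_gap \<mu> \<mu> = 0" by (simp add: moment_gap_def)

lemma moment_diff_le_moment_gap:
  assumes "\<mu> \<in> exp_class \<delta> R" "\<nu> \<in> exp_class \<delta> R" "\<delta> > 0"
  shows "gap_weight j * (moment \<mu> j - moment \<nu> j)\<^sup>2 \<le> moment_gap \<mu> \<nu>"
  using sum_le_suminf[OF moment_gap_sums(1)[OF assms], of "{j}"] gap_weight_pos
  by (auto simp: moment_gap_def less_imp_le)

lemma moment_gap_eq_0:
  assumes "\<mu> \<in> exp_class \<delta> R" "\<nu> \<in> exp_class \<delta> R" "\<delta> > 0" "moment_gap \<mu> \<nu> = 0"
  shows "\<mu> = \<nu>"
proof (rule exp_class_moment_determinacy[OF assms(1-3)])
  fix j
  have "(moment \<mu> j - moment \<nu> j)\<^sup>2 \<le> 0"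
    using moment_diff_le_moment_gap[OF assms(1-3), of j] assms(4) gap_weight_pos[of j]
    by (simp add: mult_le_0_iff not_le)
  thus "moment \<mu> j = moment \<nu> j" by simp
qed

text \<open>
  The doubling penalty.
\<close>

definition state_gap :: "state \<Rightarrow> state \<Rightarrow> real" where
  "state_gap z w = (fst z - fst w)\<^sup>2 + moment_gap (fst (snd z)) (fst (snd w)) + moment_gap (snd (snd z)) (snd (snd w))"

lemma state_gap_same [simp]: "state_gap z z = 0" by (simp add: state_gap_def)

lemma state_gap_nonneg:
  assumes "\<delta> > 0" "C0 > 0" "z \<in> O_closed T C0 \<delta> N" "w \<in> O_closed T C0 \<delta> N"
  shows "state_gap z w \<ge> 0"
  using moment_gap_nonneg[OF _ _ assms(1)] O_closed_exp_class[OF assms(1,2,3)] O_closed_exp_class[OF assms(1,2,4)]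
  unfolding state_gap_def by (intro add_nonneg_nonneg) auto

lemma state_gap_eq_0:
  assumes "\<delta> > 0" "C0 > 0" "z \<in> O_closed T C0 \<delta> N" "w \<in> O_closed T C0 \<delta> N" "state_gap z w = 0"
  shows "z = w"
proof -
  note Z = O_closed_exp_class[OF assms(1,2,3)] and W = O_closed_exp_class[OF assms(1,2,4)]
  note m = moment_gap_nonneg[OF Z(2) W(2) assms(1)] moment_gap_nonneg[OF Z(3) W(3) assms(1)]
  have s: "(fst z - fst w)\<^sup>2 \<ge> 0" by simp
  have "(fst z - fst w)\<^sup>2 = 0" "moment_gap (fst (snd z)) (fst (snd w)) = 0" "moment_gap (snd (snd z)) (snd (snd w)) = 0"
    using m s assms(5) unfolding state_gap_def by linarith+
  thus ?thesis
    using moment_gap_eq_0[OF Z(2) W(2) assms(1)] moment_gap_eq_0[OF Z(3) W(3) assms(1)]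
    by (auto intro!: prod_eqI)
qed

lemma state_gap_tendsto:
  assumes \<delta>: "\<delta> > 0" and C: "C0 > 0"
    and z: "\<And>n. z n \<in> O_closed T C0 \<delta> N" "z' \<in> O_closed T C0 \<delta> N" "state_conv z z'"
    and w: "\<And>n. w n \<in> O_closed T C0 \<delta> N" "w' \<in> O_closed T C0 \<delta> N" "state_conv w w'"
  shows "(\<lambda>n. state_gap (z n) (w n)) \<longlonglongrightarrow> state_gap z' w'"
proof -
  note O = O_closed_exp_class[OF \<delta> C, where T=T and N=N]
  show ?thesis
    unfolding state_gap_def using z(3) w(3)
    by (intro tendsto_intros moment_gap_tendsto[OF O(2) O(2) _ O(2) O(2) _ \<delta>]
        moment_gap_tendsto[OF O(3) O(3) _ O(3) O(3) _ \<delta>] z w) (auto simp: state_conv_def)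
qed

text \<open>
  A maximising sequence is taken in the extended reals, so that boundedness from above is a
  consequence and not a prerequisite.
\<close>

lemma attains_max_pairs:
  fixes f :: "state \<Rightarrow> state \<Rightarrow> real"
  assumes \<delta>: "\<delta> > 0" and C: "C0 > 0" and ne: "O_closed T C0 \<delta> N \<noteq> {}"
    and f: "\<And>z z' w w'. (\<And>n. z n \<in> O_closed T C0 \<delta> N) \<Longrightarrow> z' \<in> O_closed T C0 \<delta> N \<Longrightarrow> state_conv z z' \<Longrightarrow>
      (\<And>n. w n \<in> O_closed T C0 \<delta> N) \<Longrightarrow> w' \<in> O_closed T C0 \<delta> N \<Longrightarrow> state_conv w w' \<Longrightarrow>
      (\<lambda>n. f (z n) (w n)) \<longlonglongrightarrow> f z' w'"
  obtains z w where "z \<in> O_closed T C0 \<delta> N" "w \<in> O_closed T C0 \<delta> N"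
    "\<And>z' w'. z' \<in> O_closed T C0 \<delta> N \<Longrightarrow> w' \<in> O_closed T C0 \<delta> N \<Longrightarrow> f z' w' \<le> f z w"
proof -
  let ?O = "O_closed T C0 \<delta> N"
  define A where "A = (\<lambda>(z, w). ereal (f z w)) ` (?O \<times> ?O)"
  have "A \<noteq> {}" using ne by (auto simp: A_def)
  then obtain g :: "nat \<Rightarrow> ereal" where g: "incseq g" "range g \<subseteq> A" "Sup A = (SUP i. g i)"
    using Sup_countable_SUP by blast
  have "\<forall>n. \<exists>p. fst p \<in> ?O \<and> snd p \<in> ?O \<and> g n = ereal (f (fst p) (snd p))"
    using g(2) unfolding A_def by fastforce
  then obtain p where p: "\<And>n. fst (p n) \<in> ?O" "\<And>n. snd (p n) \<in> ?O"
    "\<And>n. g n = ereal (f (fst (p n)) (snd (p n)))" by metis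
  obtain r z where r: "strict_mono r" "z \<in> ?O" "state_conv ((\<lambda>n. fst (p n)) \<circ> r) z"
    using O_closed_seq_compact[where z="\<lambda>n. fst (p n)", OF \<delta> C p(1)] by blast
  obtain r' w where r': "strict_mono r'" "w \<in> ?O" "state_conv ((\<lambda>n. snd (p (r n))) \<circ> r') w"
    using O_closed_seq_compact[where z="\<lambda>n. snd (p (r n))", OF \<delta> C p(2)] by blast
  have "(\<lambda>n. f (fst (p (r (r' n)))) (snd (p (r (r' n))))) \<longlonglongrightarrow> f z w"
    by (rule f[OF p(1) r(2) state_conv_subseq[OF r(3) r'(1), unfolded o_def] p(2) r'(2) r'(3)[unfolded o_def]])
  hence "(\<lambda>n. g (r (r' n))) \<longlonglongrightarrow> ereal (f z w)" by (simp add: p(3))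
  moreover have "(\<lambda>n. g (r (r' n))) \<longlonglongrightarrow> Sup A"
    using LIMSEQ_subseq_LIMSEQ[OF LIMSEQ_SUP[OF g(1)] strict_mono_o[OF r(1) r'(1)]]
    by (simp add: g(3) o_def)
  ultimately have S: "Sup A = ereal (f z w)" using LIMSEQ_unique by blast
  have "f z' w' \<le> f z w" if "z' \<in> ?O" "w' \<in> ?O" for z' w'
  proof -
    have "ereal (f z' w') \<le> Sup A" using that by (intro Sup_upper) (auto simp: A_def)
    thus ?thesis by (simp add: S)
  qed
  thus ?thesis using that r(2) r'(2) by blast
qed

text \<open>
  Let \<open>h(z, w) = u(z) - v(w) + \<rho> t\<close> and let \<open>(Z\<^sub>n, W\<^sub>n)\<close> maximise \<open>h - (n + 1)/2 gap\<close>. Along a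
  convergent subsequence \<open>h(Z\<^sub>n, W\<^sub>n)\<close> stays bounded, so \<open>gap(Z\<^sub>n, W\<^sub>n) \<rightarrow> 0\<close> and both components have
  the same limit \<open>z\<close>. Comparing once more with the pair \<open>(z, z)\<close> shows that even
  \<open>(n + 1) gap(Z\<^sub>n, W\<^sub>n) \<rightarrow> 0\<close>. The slope \<open>\<rho>\<close> is chosen so that \<open>\<rho> T\<close> is half of \<open>u(z\<^sub>0) - v(z\<^sub>0)\<close>:
  with \<open>u \<le> v\<close> at time \<open>T\<close> this excludes a limit at the terminal time.
\<close>

section \<open>Doubling of variables\<close>

lemma doubling:
  assumes \<delta>: "\<delta> > 0" and C: "C0 > 0" and T: "T > 0"
    and u: "continuous_map (O_topology T C0 \<delta> N) euclideanreal u"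
    and v: "continuous_map (O_topology T C0 \<delta> N) euclideanreal v"
    and terminal: "\<And>z. z \<in> O_closed T C0 \<delta> N \<Longrightarrow> fst z = T \<Longrightarrow> u z \<le> v z"
    and z0: "z0 \<in> O_closed T C0 \<delta> N" "u z0 > v z0"
  obtains \<rho> where "\<rho> > 0" "\<And>\<eta>. \<eta> > 0 \<Longrightarrow> \<exists>\<kappa>>0. \<exists>z\<in>O_dom T C0 \<delta> N. \<exists>w\<in>O_dom T C0 \<delta> N.
      \<kappa> * state_gap z w < \<eta> \<and>
      (\<forall>z'\<in>O_closed T C0 \<delta> N. \<forall>w'\<in>O_closed T C0 \<delta> N.
        u z' - v w' + \<rho> * fst z' - \<kappa> / 2 * state_gap z' w' \<le>
        u z - v w + \<rho> * fst z - \<kappa> / 2 * state_gap z w)"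
proof -
  let ?O = "O_closed T C0 \<delta> N"
  note uc = O_topology_seq_continuous[OF \<delta> C u] and vc = O_topology_seq_continuous[OF \<delta> C v]
  define \<rho> where "\<rho> = (u z0 - v z0) / (2 * T)"
  have \<rho>: "\<rho> > 0" using z0 T by (simp add: \<rho>_def)
  define h where "h z w = u z - v w + \<rho> * fst z" for z w
  have hc: "(\<lambda>n. h (z n) (w n)) \<longlonglongrightarrow> h z' w'"
    if "\<And>n. z n \<in> ?O" "z' \<in> ?O" "state_conv z z'" "\<And>n. w n \<in> ?O" "w' \<in> ?O" "state_conv w w'" for z z' w w'
  proof -
    have t: "(\<lambda>n. fst (z n)) \<longlonglongrightarrow> fst z'" using that(3) by (simp add: state_conv_def)
    show ?thesis
      unfolding h_def by (rule tendsto_add[OF tendsto_diff[OF uc[OF that(1-3)] vc[OF that(4-6)]] tendsto_mult_left[OF t]])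
  qed
  define P where "P n z w \<longleftrightarrow> z \<in> ?O \<and> w \<in> ?O \<and>
      (\<forall>z'\<in>?O. \<forall>w'\<in>?O. h z' w' - real (Suc n) / 2 * state_gap z' w' \<le>
        h z w - real (Suc n) / 2 * state_gap z w)" for n z w
  have "\<exists>z w. P n z w" for n
  proof (rule attains_max_pairs[OF \<delta> C, where T=T and N=N and f="\<lambda>z w. h z w - real (Suc n) / 2 * state_gap z w"])
    show "?O \<noteq> {}" using z0(1) by blast
  next
    fix z z' w w'
    assume *: "\<And>n. z n \<in> ?O" "z' \<in> ?O" "state_conv z z'" "\<And>n. w n \<in> ?O" "w' \<in> ?O" "state_conv w w'"
    show "(\<lambda>i. h (z i) (w i) - real (Suc n) / 2 * state_gap (z i) (w i)) \<longlonglongrightarrow>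
        h z' w' - real (Suc n) / 2 * state_gap z' w'"
      by (rule tendsto_diff[OF hc[OF *] tendsto_mult_left[OF state_gap_tendsto[OF \<delta> C *]]])
  next
    fix z w
    assume "z \<in> ?O" "w \<in> ?O" "\<And>z' w'. z' \<in> ?O \<Longrightarrow> w' \<in> ?O \<Longrightarrow>
      h z' w' - real (Suc n) / 2 * state_gap z' w' \<le> h z w - real (Suc n) / 2 * state_gap z w"
    hence "P n z w" unfolding P_def by blast
    thus "\<exists>z w. P n z w" by blast
  qed
  then obtain Z W where P: "\<And>n. P n (Z n) (W n)" by metis
  have ZW: "Z n \<in> ?O" "W n \<in> ?O"
    "z' \<in> ?O \<Longrightarrow> w' \<in> ?O \<Longrightarrow> h z' w' - real (Suc n) / 2 * state_gap z' w' \<le>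
      h (Z n) (W n) - real (Suc n) / 2 * state_gap (Z n) (W n)" for n z' w'
    using P[of n] unfolding P_def by blast+
  obtain r z where r: "strict_mono r" "z \<in> ?O" "state_conv (Z \<circ> r) z"
    using O_closed_seq_compact[where z=Z, OF \<delta> C ZW(1)] by blast
  obtain r' w where r': "strict_mono r'" "w \<in> ?O" "state_conv ((\<lambda>n. W (r n)) \<circ> r') w"
    using O_closed_seq_compact[where z="\<lambda>n. W (r n)", OF \<delta> C ZW(2)] by blast
  define s where "s = r \<circ> r'"
  have s: "strict_mono s" unfolding s_def by (intro strict_mono_o r r')
  have zc: "state_conv (\<lambda>n. Z (s n)) z" using state_conv_subseq[OF r(3) r'(1)] by (simp add: s_def o_def)
  have wc: "state_conv (\<lambda>n. W (s n)) w" using r'(3) by (simp add: s_def o_def)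
  define H where "H n = h (Z (s n)) (W (s n))" for n
  define G where "G n = state_gap (Z (s n)) (W (s n))" for n
  define k where "k n = real (Suc (s n))" for n
  have k: "k n > 0" for n by (simp add: k_def)
  have H: "H \<longlonglongrightarrow> h z w" unfolding H_def by (rule hc[OF ZW(1) r(2) zc ZW(2) r'(2) wc])
  have G: "G \<longlonglongrightarrow> state_gap z w" unfolding G_def
    by (rule state_gap_tendsto[OF \<delta> C ZW(1) r(2) zc ZW(2) r'(2) wc])
  have G0: "G n \<ge> 0" for n unfolding G_def by (rule state_gap_nonneg[OF \<delta> C ZW(1) ZW(2)])
  have mx: "h z' z' \<le> H n - k n / 2 * G n" if "z' \<in> ?O" for z' n
    using ZW(3)[OF that that, of "s n"] by (simp add: H_def G_def k_def)
  have ik: "(\<lambda>n. inverse (k n)) \<longlonglongrightarrow> 0"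
    using LIMSEQ_subseq_LIMSEQ[OF LIMSEQ_inverse_real_of_nat s] by (simp add: k_def o_def)
  have "G n \<le> 2 * (H n - h z0 z0) * inverse (k n)" for n
    using mx[OF z0(1), of n] k[of n] by (simp add: field_simps)
  moreover have "(\<lambda>n. 2 * (H n - h z0 z0) * inverse (k n)) \<longlonglongrightarrow> 2 * (h z w - h z0 z0) * 0"
    by (intro tendsto_intros H ik)
  ultimately have "G \<longlonglongrightarrow> 0"
    by (intro tendsto_sandwich[of "\<lambda>_. 0" G sequentially "\<lambda>n. 2 * (H n - h z0 z0) * inverse (k n)" 0])
       (use G0 in auto)
  with G have "state_gap z w = 0" by (rule LIMSEQ_unique)
  hence zw: "z = w" by (rule state_gap_eq_0[OF \<delta> C r(2) r'(2)])
  have "h z0 z0 \<le> h z w"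
  proof (rule LIMSEQ_le_const[OF H], intro exI allI impI)
    fix n
    show "h z0 z0 \<le> H n"
      using mx[OF z0(1), of n] mult_nonneg_nonneg[of "k n / 2" "G n"] G0[of n] k[of n] by linarith
  qed
  hence hz: "h z0 z0 \<le> h z z" by (simp add: zw)
  \<comment> \<open>at the terminal time \<open>h(z, z) \<le> \<rho> T < u(z\<^sub>0) - v(z\<^sub>0) \<le> h(z\<^sub>0, z\<^sub>0)\<close>\<close>
  have tz: "fst z < T"
  proof (rule ccontr)
    assume "\<not> fst z < T"
    hence t: "fst z = T" using O_closed_exp_class(1)[OF \<delta> C r(2)] by auto
    have "\<rho> * fst z0 \<ge> 0" using \<rho> O_closed_exp_class(1)[OF \<delta> C z0(1)] by simp
    moreover have "\<rho> * T < u z0 - v z0" using T z0(2) by (simp add: \<rho>_def field_simps)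
    ultimately show False using hz terminal[OF r(2) t] t by (simp add: h_def)
  qed
  have "(\<lambda>n. fst (Z (s n))) \<longlonglongrightarrow> fst z" "(\<lambda>n. fst (W (s n))) \<longlonglongrightarrow> fst z"
    using zc wc zw by (auto simp: state_conv_def)
  hence ev1: "\<forall>\<^sub>F n in sequentially. fst (Z (s n)) < T" "\<forall>\<^sub>F n in sequentially. fst (W (s n)) < T"
    using tz by (auto intro: order_tendstoD)
  have kG: "k n * G n \<le> 2 * (H n - h z z)" for n
    using mx[OF r(2), of n] by simp
  have "(\<lambda>n. 2 * (H n - h z z)) \<longlonglongrightarrow> 2 * (h z w - h z z)" by (intro tendsto_intros H)
  hence lim0: "(\<lambda>n. 2 * (H n - h z z)) \<longlonglongrightarrow> 0" by (simp add: zw)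
  show ?thesis
  proof (rule that[OF \<rho>])
    fix \<eta> :: real assume "\<eta> > 0"
    hence "\<forall>\<^sub>F n in sequentially. 2 * (H n - h z z) < \<eta>" using lim0 by (auto intro: order_tendstoD)
    with ev1 have "\<forall>\<^sub>F n in sequentially. fst (Z (s n)) < T \<and> fst (W (s n)) < T \<and> 2 * (H n - h z z) < \<eta>"
      by eventually_elim auto
    then obtain n where n: "fst (Z (s n)) < T" "fst (W (s n)) < T" "2 * (H n - h z z) < \<eta>"
      by (auto simp: eventually_sequentially)
    have dom: "Z (s n) \<in> O_dom T C0 \<delta> N" "W (s n) \<in> O_dom T C0 \<delta> N"
      using n ZW(1,2)[of "s n"] by (auto simp: O_dom_def)
    show "\<exists>\<kappa>>0. \<exists>z\<in>O_dom T C0 \<delta> N. \<exists>w\<in>O_dom T C0 \<delta> N. \<kappa> * state_gap z w < \<eta> \<and>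
      (\<forall>z'\<in>?O. \<forall>w'\<in>?O. u z' - v w' + \<rho> * fst z' - \<kappa> / 2 * state_gap z' w' \<le>
        u z - v w + \<rho> * fst z - \<kappa> / 2 * state_gap z w)"
    proof (rule exI[of _ "k n"], rule conjI[OF k], rule bexI[OF _ dom(1)], rule bexI[OF _ dom(2)], intro conjI ballI)
      show "k n * state_gap (Z (s n)) (W (s n)) < \<eta>" using kG[of n] n(3) by (simp add: G_def)
    next
      fix z' w' assume "z' \<in> ?O" "w' \<in> ?O"
      from ZW(3)[OF this, of "s n"]
      show "u z' - v w' + \<rho> * fst z' - k n / 2 * state_gap z' w' \<le>
        u (Z (s n)) - v (W (s n)) + \<rho> * fst (Z (s n)) - k n / 2 * state_gap (Z (s n)) (W (s n))"
        by (simp add: h_def k_def)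
    qed
  qed
qed

section \<open>Boundedness of the coefficients\<close>

lemma borel_measurable_fst_snd:
  fixes \<gamma> :: "(real \<times> real) measure"
  assumes "sets \<gamma> = sets borel"
  shows "fst \<in> borel_measurable \<gamma>" "snd \<in> borel_measurable \<gamma>"
  by (auto simp: measurable_cong_sets[OF assms refl] intro!: borel_measurable_continuous_onI continuous_intros)

definition control_laws :: "real set \<Rightarrow> real measure set" where
  "control_laws U = {\<rho>. prob_space \<rho> \<and> sets \<rho> = sets borel \<and> (AE a in \<rho>. a \<in> U)}"

text \<open>
  As \<open>U\<close> is bounded, only the state marginal can violate the moment condition.
\<close>

lemma Pspace_product_iff:
  fixes \<gamma> :: "(real \<times> real) measure"
  assumes U: "bounded U" "closed U" and \<gamma>: "prob_space \<gamma>" "sets \<gamma> = sets borel"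
  shows "\<gamma> \<in> Pspace 2 (UNIV \<times> U) \<longleftrightarrow>
    integrable (distr \<gamma> borel fst) (\<lambda>x. x\<^sup>2) \<and> distr \<gamma> borel snd \<in> control_laws U"
proof -
  interpret prob_space \<gamma> by fact
  note [measurable] = borel_measurable_fst_snd[OF \<gamma>(2)]
  have Um [measurable]: "U \<in> sets borel" using U(2) by simp
  have ae: "(AE z in \<gamma>. z \<in> UNIV \<times> U) \<longleftrightarrow> (AE a in distr \<gamma> borel snd. a \<in> U)"
    by (subst AE_distr_iff) (auto simp: mem_Times_iff)
  have ps: "prob_space (distr \<gamma> borel snd)" by (rule prob_space_distr) measurable
  obtain b where b: "\<And>a. a \<in> U \<Longrightarrow> \<bar>a\<bar> \<le> b" using U(1) by (auto simp: bounded_iff)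
  have "integrable \<gamma> (\<lambda>z. norm z ^ 2) \<longleftrightarrow> integrable (distr \<gamma> borel fst) (\<lambda>x. x\<^sup>2)"
    if "AE z in \<gamma>. z \<in> UNIV \<times> U"
  proof -
    have "AE z in \<gamma>. norm ((snd z)\<^sup>2) \<le> b\<^sup>2"
      using that
    proof eventually_elim
      case (elim z)
      hence "\<bar>snd z\<bar> \<le> b" by (intro b) (auto simp: mem_Times_iff)
      from power_mono[OF this, of 2] show ?case by simp
    qed
    hence s: "integrable \<gamma> (\<lambda>z. (snd z)\<^sup>2)" by (rule integrable_const_bound) measurable
    have n: "(\<lambda>z::real \<times> real. norm z ^ 2) = (\<lambda>z. (fst z)\<^sup>2 + (snd z)\<^sup>2)"
      by (auto simp: norm_Pair fun_eq_iff)
    have "integrable \<gamma> (\<lambda>z. (fst z)\<^sup>2 + (snd z)\<^sup>2) \<longleftrightarrow> integrable \<gamma> (\<lambda>z. (fst z)\<^sup>2)"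
    proof
      assume "integrable \<gamma> (\<lambda>z. (fst z)\<^sup>2 + (snd z)\<^sup>2)"
      from Bochner_Integration.integrable_diff[OF this s] show "integrable \<gamma> (\<lambda>z. (fst z)\<^sup>2)" by simp
    qed (use s in simp)
    thus ?thesis unfolding n by (subst integrable_distr_eq) auto
  qed
  thus ?thesis using ae ps \<gamma> by (auto simp: Pspace_def control_laws_def)
qed

lemma product_in_Pi_set:
  assumes U: "bounded U" "closed U" and \<mu>: "\<mu> \<in> exp_class \<delta> R" "\<delta> > 0" and \<rho>: "\<rho> \<in> control_laws U"
  shows "\<mu> \<Otimes>\<^sub>M \<rho> \<in> Pi_set U \<mu>" "distr (\<mu> \<Otimes>\<^sub>M \<rho>) borel snd = \<rho>"
proof -
  have r: "prob_space \<rho>" "sets \<rho> = sets borel" using \<rho> by (auto simp: control_laws_def)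
  note p = product_marginals[OF exp_classD(1,2)[OF \<mu>(1)] r]
  show "distr (\<mu> \<Otimes>\<^sub>M \<rho>) borel snd = \<rho>" by (rule p)
  show "\<mu> \<Otimes>\<^sub>M \<rho> \<in> Pi_set U \<mu>"
    using exp_class_abs_power(2)[OF \<mu>, of 2] \<rho>
    by (simp add: Pi_set_def Pspace_product_iff[OF U p(1,2)] p(3,4))
qed

lemma Pi_set_control_laws:
  assumes "bounded U" "closed U" "\<gamma> \<in> Pi_set U \<mu>"
  shows "distr \<gamma> borel snd \<in> control_laws U" "distr \<gamma> borel fst = \<mu>" "\<gamma> \<in> Pspace 2 (UNIV \<times> U)"
    "prob_space \<gamma>" "sets \<gamma> = sets borel"
proof -
  show 1: "distr \<gamma> borel fst = \<mu>" "\<gamma> \<in> Pspace 2 (UNIV \<times> U)" using assms(3) by (auto simp: Pi_set_def)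
  thus 2: "prob_space \<gamma>" "sets \<gamma> = sets borel" by (auto simp: Pspace_def)
  show "distr \<gamma> borel snd \<in> control_laws U" using Pspace_product_iff[OF assms(1,2) 2] 1(2) by blast
qed

lemma return_control_laws: "closed U \<Longrightarrow> a \<in> U \<Longrightarrow> return borel a \<in> control_laws U"
proof -
  assume "closed U" "a \<in> U"
  hence [measurable]: "U \<in> sets borel" by simp
  have "AE x in return borel a. x \<in> U" by (subst AE_return) (use \<open>a \<in> U\<close> in auto)
  thus ?thesis by (simp add: control_laws_def prob_space_return)
qed

text \<open>
  Embedding the control laws into an exponential class makes the compactness of that class available
  for them.
\<close>

lemma control_laws_exp_class:
  assumes "bounded U" obtains R where "control_laws U \<subseteq> exp_class 1 R"
proof -
  obtain b where b: "\<And>a. a \<in> U \<Longrightarrow> \<bar>a\<bar> \<le> b" using assms by (auto simp: bounded_iff)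
  define R where "R = exp (sqrt (b\<^sup>2 + 1) - 1)"
  have eb: "e_weight 1 a \<le> R" if "a \<in> U" for a
  proof -
    have "a\<^sup>2 \<le> b\<^sup>2" using power_mono[OF b[OF that], of 2] by simp
    hence "sqrt (a\<^sup>2 + 1) \<le> sqrt (b\<^sup>2 + 1)" by simp
    thus ?thesis by (simp add: e_weight_def R_def)
  qed
  have "\<rho> \<in> exp_class 1 R" if "\<rho> \<in> control_laws U" for \<rho>
  proof -
    have r: "prob_space \<rho>" "sets \<rho> = sets borel" "AE a in \<rho>. a \<in> U" using that by (auto simp: control_laws_def)
    note [measurable_cong] = r(2)
    interpret prob_space \<rho> by fact
    have ae: "AE a in \<rho>. e_weight 1 a \<le> R" using r(3) by eventually_elim (rule eb)
    have i: "integrable \<rho> (e_weight 1)"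
    proof (rule integrable_const_bound)
      show "AE a in \<rho>. norm (e_weight 1 a) \<le> R"
        using ae by eventually_elim (simp add: e_weight_pos abs_of_pos)
    qed measurable
    have "(LINT x|\<rho>. e_weight 1 x) \<le> R" by (rule integral_le_const[OF i ae])
    thus ?thesis using r i by (simp add: exp_class_def)
  qed
  thus ?thesis using that by blast
qed

text \<open>
  The joint law with state 0 and control law \<open>\<rho>\<close>: a reference point among all joint laws with the
  control marginal \<open>\<rho>\<close>.
\<close>

definition slice :: "real measure \<Rightarrow> (real \<times> real) measure" where
  "slice \<rho> = distr \<rho> borel (\<lambda>a. (0, a))"

lemma slice_marginals:
  assumes "\<rho> \<in> control_laws U" "bounded U" "closed U"
  shows "slice \<rho> \<in> Pspace 2 (UNIV \<times> U)" "distr (slice \<rho>) borel snd = \<rho>"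
    "integrable (distr (slice \<rho>) borel fst) (\<lambda>y. y ^ i)"
    "(LINT y|distr (slice \<rho>) borel fst. y ^ i) = 0 ^ i"
proof -
  have r: "prob_space \<rho>" "sets \<rho> = sets borel" using assms(1) by (auto simp: control_laws_def)
  interpret prob_space \<rho> by fact
  have m [measurable]: "(\<lambda>a. (0::real, a)) \<in> measurable \<rho> borel"
    by (auto simp: measurable_cong_sets[OF r(2) refl] intro!: borel_measurable_continuous_onI continuous_intros)
  have fs: "fst \<in> borel_measurable (borel :: (real \<times> real) measure)"
    "snd \<in> borel_measurable (borel :: (real \<times> real) measure)"
    by (rule borel_measurable_fst_snd, simp)+
  have f: "distr (slice \<rho>) borel fst = distr \<rho> borel (\<lambda>_. 0)"
    unfolding slice_def by (subst distr_distr[OF fs(1) m]) (simp add: o_def)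
  show s: "distr (slice \<rho>) borel snd = \<rho>"
    unfolding slice_def by (subst distr_distr[OF fs(2) m]) (simp add: o_def distr_id2 r(2))
  have i: "integrable (distr (slice \<rho>) borel fst) (\<lambda>y. y ^ i)" for i
    unfolding f by (subst integrable_distr_eq) auto
  thus "integrable (distr (slice \<rho>) borel fst) (\<lambda>y. y ^ i)" .
  show "(LINT y|distr (slice \<rho>) borel fst. y ^ i) = 0 ^ i"
    unfolding f by (subst integral_distr) (auto simp: prob_space)
  show "slice \<rho> \<in> Pspace 2 (UNIV \<times> U)"
  proof (subst Pspace_product_iff[OF assms(2,3)])
    show "prob_space (slice \<rho>)" unfolding slice_def by (rule prob_space_distr[OF m])
    show "sets (slice \<rho>) = sets borel" by (simp add: slice_def)
  qed (use i[of 2] s assms(1) in auto)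
qed

lemma wasserstein_le_coupling:
  fixes \<mu> \<nu> :: "'a::euclidean_space measure"
  assumes "\<pi> \<in> couplings \<mu> \<nu>"
  shows "wasserstein 2 \<mu> \<nu> \<le> sqrt (LINT z|\<pi>. (dist (fst z) (snd z))\<^sup>2)"
proof -
  have "(INF \<pi>\<in>couplings \<mu> \<nu>. LINT z|\<pi>. dist (fst z) (snd z) ^ 2) \<le> (LINT z|\<pi>. (dist (fst z) (snd z))\<^sup>2)"
    by (rule cINF_lower[OF _ assms]) (auto intro!: bdd_belowI[of _ 0])
  thus ?thesis by (simp add: wasserstein_def sqrt_def)
qed

text \<open>
  Weak convergence is upgraded to convergence in the Wasserstein distance. Skorohod's theorem
  realises the weakly convergent control laws by pointwise convergent random variables, their joint
  law is a coupling, and its cost tends to 0 by dominated convergence since \<open>U\<close> is bounded. As \<open>U\<close>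
  is closed, the limit is again concentrated on \<open>U\<close>.
\<close>

lemma slice_seq_compact:
  fixes \<rho> :: "nat \<Rightarrow> real measure"
  assumes U: "bounded U" "closed U" and \<rho>: "\<And>n. \<rho> n \<in> control_laws U"
  obtains r M where "strict_mono r" "M \<in> control_laws U"
    "limitin (wasserstein_topology 2 (UNIV \<times> U)) (\<lambda>n. slice (\<rho> (r n))) (slice M) sequentially"
proof -
  obtain R where R: "control_laws U \<subseteq> exp_class 1 R" using control_laws_exp_class[OF U(1)] .
  have r1: "\<rho> n \<in> exp_class 1 R" for n using R \<rho> by blast
  obtain r M where r: "strict_mono r" "M \<in> exp_class 1 R" "weak_conv_m (\<rho> \<circ> r) M"
    using exp_class_seq_compact[of \<rho>, OF r1] by auto
  have rd: "real_distribution ((\<rho> \<circ> r) n)" for n using exp_classD(7)[OF r1] by simp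
  obtain \<Omega> :: "real measure" and Yn Y where Y0: "prob_space \<Omega>" "\<forall>n. Yn n \<in> borel_measurable \<Omega>"
    "\<forall>n. distr \<Omega> borel (Yn n) = (\<rho> \<circ> r) n" "Y \<in> measurable \<Omega> lborel" "distr \<Omega> borel Y = M"
    "\<forall>x\<in>space \<Omega>. (\<lambda>n. Yn n x) \<longlonglongrightarrow> Y x"
    using Skorohod[OF rd exp_classD(7)[OF r(2)] r(3)] by blast
  hence Y: "prob_space \<Omega>" "\<And>n. Yn n \<in> borel_measurable \<Omega>"
    "\<And>n. distr \<Omega> borel (Yn n) = \<rho> (r n)" "Y \<in> borel_measurable \<Omega>" "distr \<Omega> borel Y = M"
    "\<And>x. x \<in> space \<Omega> \<Longrightarrow> (\<lambda>n. Yn n x) \<longlonglongrightarrow> Y x" by auto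
  note [measurable] = Y(2,4)
  interpret prob_space \<Omega> by (rule Y)
  have Um [measurable]: "U \<in> sets borel" using U(2) by simp
  obtain b where b: "\<And>a. a \<in> U \<Longrightarrow> \<bar>a\<bar> \<le> b" using U(1) by (auto simp: bounded_iff)
  have "AE x in \<Omega>. Yn n x \<in> U" for n
  proof -
    have "AE a in distr \<Omega> borel (Yn n). a \<in> U" unfolding Y(3) using \<rho>[of "r n"] by (simp add: control_laws_def)
    thus ?thesis by (subst (asm) AE_distr_iff) auto
  qed
  hence aen: "AE x in \<Omega>. \<forall>n. Yn n x \<in> U" by (simp add: AE_all_countable)
  have ae: "AE x in \<Omega>. Y x \<in> U" using aen AE_space
  proof eventually_elim
    case (elim x)
    show ?case by (rule closed_sequentially[OF U(2) _ Y(6)[OF elim(2)]]) (use elim in auto)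
  qed
  hence M: "M \<in> control_laws U"
    unfolding Y(5)[symmetric] by (auto simp: control_laws_def AE_distr_iff intro!: prob_space_distr)
  have w: "wasserstein 2 (slice M) (slice (\<rho> (r n))) \<le> sqrt (LINT x|\<Omega>. (Y x - Yn n x)\<^sup>2)" for n
  proof -
    let ?p = "\<lambda>x. ((0::real, Y x), (0::real, Yn n x))"
    have pm [measurable]: "?p \<in> measurable \<Omega> borel"
      by (subst borel_prod[symmetric], subst borel_prod[symmetric]) measurable
    have fs: "fst \<in> measurable borel (borel :: (real \<times> real) measure)"
      "snd \<in> measurable borel (borel :: (real \<times> real) measure)"
      by (auto intro!: borel_measurable_continuous_onI continuous_intros)
    have z: "(\<lambda>a. (0::real, a)) \<in> measurable borel borel"
      by (auto intro!: borel_measurable_continuous_onI continuous_intros)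
    have "distr \<Omega> borel ?p \<in> couplings (slice M) (slice (\<rho> (r n)))"
      unfolding couplings_def slice_def Y(3)[symmetric] Y(5)[symmetric]
      using distr_distr[OF fs(1) pm] distr_distr[OF fs(2) pm] distr_distr[OF z Y(4)] distr_distr[OF z Y(2)[of n]]
      by (simp add: o_def)
    from wasserstein_le_coupling[OF this]
    show ?thesis
      by (subst (asm) integral_distr)
         (auto simp: dist_Pair_Pair dist_real_def power2_commute[of "Yn n _"] intro!: borel_measurable_continuous_onI continuous_intros)
  qed
  have "(\<lambda>n. LINT x|\<Omega>. (Y x - Yn n x)\<^sup>2) \<longlonglongrightarrow> (LINT x|\<Omega>. 0)"
  proof (rule integral_dominated_convergence[where w="\<lambda>_. (2 * b)\<^sup>2"])
    show "AE x in \<Omega>. (\<lambda>n. (Y x - Yn n x)\<^sup>2) \<longlonglongrightarrow> 0"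
    proof (rule AE_I2)
      fix x assume x: "x \<in> space \<Omega>"
      have "(\<lambda>n. (Y x - Yn n x)\<^sup>2) \<longlonglongrightarrow> (Y x - Y x)\<^sup>2" by (intro tendsto_intros Y(6)[OF x])
      thus "(\<lambda>n. (Y x - Yn n x)\<^sup>2) \<longlonglongrightarrow> 0" by simp
    qed
    show "AE x in \<Omega>. norm ((Y x - Yn n x)\<^sup>2) \<le> (2 * b)\<^sup>2" for n
      using ae aen
    proof eventually_elim
      case (elim x)
      have "\<bar>Y x - Yn n x\<bar> \<le> 2 * b" using b[of "Y x"] b[of "Yn n x"] elim by fastforce
      from power_mono[OF this, of 2] show ?case by simp
    qed
  qed auto
  hence "(\<lambda>n. sqrt (LINT x|\<Omega>. (Y x - Yn n x)\<^sup>2)) \<longlonglongrightarrow> sqrt 0" by (intro tendsto_real_sqrt) simp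
  hence lim: "(\<lambda>n. sqrt (LINT x|\<Omega>. (Y x - Yn n x)\<^sup>2)) \<longlonglongrightarrow> 0" by simp
  have "limitin (wasserstein_topology 2 (UNIV \<times> U)) (\<lambda>n. slice (\<rho> (r n))) (slice M) sequentially"
    unfolding limitin_def topspace_wasserstein_topology
  proof (intro conjI allI impI)
    show "slice M \<in> Pspace 2 (UNIV \<times> U)" by (rule slice_marginals[OF M U])
    fix G assume G: "openin (wasserstein_topology 2 (UNIV \<times> U)) G \<and> slice M \<in> G"
    then obtain \<epsilon> where \<epsilon>: "\<epsilon> > 0"
      "\<And>\<nu>. \<nu> \<in> Pspace 2 (UNIV \<times> U) \<Longrightarrow> wasserstein 2 (slice M) \<nu> < \<epsilon> \<Longrightarrow> \<nu> \<in> G"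
      unfolding openin_wasserstein_topology by blast
    have "\<forall>\<^sub>F n in sequentially. sqrt (LINT x|\<Omega>. (Y x - Yn n x)\<^sup>2) < \<epsilon>"
      using order_tendstoD(2)[OF lim \<epsilon>(1)] .
    thus "\<forall>\<^sub>F n in sequentially. slice (\<rho> (r n)) \<in> G"
    proof eventually_elim
      case (elim n)
      show ?case by (rule \<epsilon>(2)[OF slice_marginals(1)[OF \<rho> U] order.strict_trans1[OF w elim]])
    qed
  qed
  thus ?thesis using that r(1) M by blast
qed

text \<open>
  A continuous function on the set of slices, which is compact by \<open>slice_seq_compact\<close>.
\<close>

lemma coefficient_bounded_slices:
  fixes \<phi> :: coefficient
  assumes U: "bounded U" "closed U" "a \<in> U" and T: "T > 0"
    and \<phi>: "continuous_map (prod_topology (top_of_set {0..T})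
         (prod_topology (top_of_set (UNIV \<times> U)) (wasserstein_topology 2 (UNIV \<times> U))))
       euclideanreal (\<lambda>(t, z, \<gamma>). \<phi> t z \<gamma>)"
  shows "\<exists>B. \<forall>\<rho>\<in>control_laws U. \<bar>\<phi> 0 (0, a) (slice \<rho>)\<bar> \<le> B"
proof (rule ccontr)
  assume "\<nexists>B. \<forall>\<rho>\<in>control_laws U. \<bar>\<phi> 0 (0, a) (slice \<rho>)\<bar> \<le> B"
  hence "\<forall>n::nat. \<exists>\<rho>. \<rho> \<in> control_laws U \<and> \<bar>\<phi> 0 (0, a) (slice \<rho>)\<bar> > real n" by (meson not_le)
  then obtain \<rho> where \<rho>: "\<And>n::nat. \<rho> n \<in> control_laws U" "\<And>n. \<bar>\<phi> 0 (0, a) (slice (\<rho> n))\<bar> > real n" by metis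
  obtain r M where r: "strict_mono r" "M \<in> control_laws U"
    "limitin (wasserstein_topology 2 (UNIV \<times> U)) (\<lambda>n. slice (\<rho> (r n))) (slice M) sequentially"
    using slice_seq_compact[OF U(1,2) \<rho>(1)] .
  have "limitin (prod_topology (top_of_set {0..T})
         (prod_topology (top_of_set (UNIV \<times> U)) (wasserstein_topology 2 (UNIV \<times> U))))
     (\<lambda>n. (0, (0, a), slice (\<rho> (r n)))) (0, (0, a), slice M) sequentially"
    using r(3) T U(3) by (simp add: limitin_pairwise o_def limitin_const_iff)
  from continuous_map_limit[OF \<phi> this]
  have "(\<lambda>n. \<phi> 0 (0, a) (slice (\<rho> (r n)))) \<longlonglongrightarrow> \<phi> 0 (0, a) (slice M)" by (simp add: o_def)
  hence "Bseq (\<lambda>n. \<phi> 0 (0, a) (slice (\<rho> (r n))))" by (intro convergent_imp_Bseq convergentI)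
  then obtain B where B: "\<And>n. \<bar>\<phi> 0 (0, a) (slice (\<rho> (r n)))\<bar> \<le> B" by (auto simp: Bseq_def)
  obtain n :: nat where "B < real n" using reals_Archimedean2 by blast
  also have "real n \<le> real (r n)" using seq_suble[OF r(1)] by simp
  also have "\<dots> < \<bar>\<phi> 0 (0, a) (slice (\<rho> (r n)))\<bar>" by (rule \<rho>(2))
  finally show False using B[of n] by simp
qed

lemma coefficient_moment_lipschitzD:
  assumes "coefficient_moment_lipschitz T U \<kappa>0 I \<phi>" "s \<in> {0..T}" "s' \<in> {0..T}" "a \<in> U"
    and "\<gamma> \<in> Pspace 2 (UNIV \<times> U)" "\<gamma>' \<in> Pspace 2 (UNIV \<times> U)"
    and "distr \<gamma> borel snd = distr \<gamma>' borel snd"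
    and "\<And>i. integrable (distr \<gamma> borel fst) (\<lambda>y. y ^ i)" "\<And>i. integrable (distr \<gamma>' borel fst) (\<lambda>y. y ^ i)"
  shows "\<bar>\<phi> s (x, a) \<gamma> - \<phi> s' (x, a) \<gamma>'\<bar> \<le>
    \<kappa>0 * (\<bar>s - s'\<bar> + (\<Sum>i\<in>I. \<bar>moment (distr \<gamma> borel fst) i - moment (distr \<gamma>' borel fst) i\<bar>))"
proof -
  have *: "\<forall>i\<in>I. integrable (distr \<gamma> borel fst) (\<lambda>y. y ^ i) \<and> integrable (distr \<gamma>' borel fst) (\<lambda>y. y ^ i)"
    using assms(8,9) by simp
  show ?thesis
    unfolding moment_def
    by (rule assms(1)[unfolded coefficient_moment_lipschitz_def, THEN bspec, OF assms(2), THEN bspec, OF assms(3),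
        THEN spec, THEN bspec, OF assms(4), THEN bspec, OF assms(5), THEN bspec, OF assms(6),
        THEN mp, OF assms(7), THEN mp, OF *])
qed

text \<open>
  The Lipschitz condition in the moments compares \<open>\<gamma>\<close> at time \<open>t\<close> with the slice of the same control
  marginal at time 0, and the moments involved are uniformly bounded.
\<close>

lemma coefficient_bounded:
  fixes \<phi> :: coefficient
  assumes U: "bounded U" "closed U" "a \<in> U" and T: "T > 0"
    and reg: "coefficient_regular T U W C0 C \<phi>" and lip: "coefficient_moment_lipschitz T U \<kappa>0 I \<phi>"
    and k: "\<kappa>0 > 0" and \<delta>: "\<delta> > 0"
  shows "\<exists>B. \<forall>t\<in>{0..T}. \<forall>\<mu>\<in>exp_class \<delta> R. \<forall>\<gamma>\<in>Pi_set U \<mu>. \<bar>\<phi> t (0, a) \<gamma>\<bar> \<le> B"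
proof -
  have "continuous_map (prod_topology (top_of_set {0..T})
         (prod_topology (top_of_set (UNIV \<times> U)) (wasserstein_topology 2 (UNIV \<times> U))))
       euclideanreal (\<lambda>(t, z, \<gamma>). \<phi> t z \<gamma>)"
    using reg unfolding coefficient_regular_def by (rule conjunct1)
  from coefficient_bounded_slices[OF U T this]
  obtain B where B: "\<And>\<rho>. \<rho> \<in> control_laws U \<Longrightarrow> \<bar>\<phi> 0 (0, a) (slice \<rho>)\<bar> \<le> B"
    by blast
  show ?thesis
  proof (intro exI ballI)
    fix t \<mu> \<gamma> assume t: "t \<in> {0..T}" and \<mu>: "\<mu> \<in> exp_class \<delta> R" and \<gamma>: "\<gamma> \<in> Pi_set U \<mu>"
    note P = Pi_set_control_laws[OF U(1,2) \<gamma>]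
    let ?\<rho> = "distr \<gamma> borel snd"
    note S = slice_marginals[OF P(1) U(1,2)]
    have mom: "\<bar>moment \<mu> i - 0 ^ i\<bar> \<le> moment_bound \<delta> R i + 1" for i
      using abs_moment_le[OF \<mu> \<delta>, of i] by (cases i) auto
    have T0: "0 \<in> {0..T}" using T by simp
    have int: "integrable (distr \<gamma> borel fst) (\<lambda>y. y ^ i)" for i
      unfolding P(2) by (rule exp_class_abs_power(2)[OF \<mu> \<delta>])
    have "\<bar>\<phi> t (0, a) \<gamma> - \<phi> 0 (0, a) (slice ?\<rho>)\<bar> \<le>
      \<kappa>0 * (\<bar>t - 0\<bar> + (\<Sum>i\<in>I. \<bar>moment (distr \<gamma> borel fst) i - moment (distr (slice ?\<rho>) borel fst) i\<bar>))"
      by (rule coefficient_moment_lipschitzD[OF lip t T0 U(3) P(3) S(1) S(2)[symmetric] int S(3)])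
    also have "\<dots> \<le> \<kappa>0 * (T + (\<Sum>i\<in>I. moment_bound \<delta> R i + 1))"
      using k t mom S(4) unfolding P(2) moment_def[of "distr (slice _) borel fst"]
      by (intro mult_left_mono add_mono sum_mono) auto
    finally show "\<bar>\<phi> t (0, a) \<gamma>\<bar> \<le> B + \<kappa>0 * (T + (\<Sum>i\<in>I. moment_bound \<delta> R i + 1))"
      using B[OF P(1)] by linarith
  qed
qed

section \<open>The gradient of the penalty under integrals\<close>

lemma moment_gap_commute: "moment_gap \<mu> \<nu> = moment_gap \<nu> \<mu>"
  by (simp add: moment_gap_def power2_commute)

lemma gap_gradient_properties:
  assumes "\<mu> \<in> exp_class \<delta> R" "\<nu> \<in> exp_class \<delta> R" "\<delta> > 0"
  shows "continuous_on UNIV (gap_gradient \<kappa> \<mu> \<nu>)" "continuous_on UNIV (deriv (gap_gradient \<kappa> \<mu> \<nu>))"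
    "gap_gradient \<kappa> \<nu> \<mu> = (\<lambda>y. - gap_gradient \<kappa> \<mu> \<nu> y)"
proof -
  have e: "gap_gradient \<kappa> \<mu> \<nu> = (\<lambda>y. \<Sum>j. (\<kappa> * gap_weight j * (moment \<mu> j - moment \<nu> j)) * lower (\<lambda>i. y ^ i) j)" for \<mu> \<nu>
    by (auto simp: gap_gradient_def)
  show "continuous_on UNIV (gap_gradient \<kappa> \<mu> \<nu>)" "continuous_on UNIV (deriv (gap_gradient \<kappa> \<mu> \<nu>))"
    unfolding e using entire_series_derivatives[OF gap_gradient_coeff(1)[OF assms], of \<kappa>] by blast+
  show "gap_gradient \<kappa> \<nu> \<mu> = (\<lambda>y. - gap_gradient \<kappa> \<mu> \<nu> y)"
  proof
    fix y
    have s: "(\<lambda>j. (\<kappa> * gap_weight j * (moment \<mu> j - moment \<nu> j)) * lower (\<lambda>i. y ^ i) j) sums gap_gradient \<kappa> \<mu> \<nu> y"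
      unfolding e using entire_series_derivatives(1)[OF gap_gradient_coeff(1)[OF assms], of \<kappa>] by blast
    have "(\<lambda>j. (\<kappa> * gap_weight j * (moment \<nu> j - moment \<mu> j)) * lower (\<lambda>i. y ^ i) j) sums - gap_gradient \<kappa> \<mu> \<nu> y"
      using sums_minus[OF s] by (simp add: algebra_simps)
    thus "gap_gradient \<kappa> \<nu> \<mu> y = - gap_gradient \<kappa> \<mu> \<nu> y" by (simp add: gap_gradient_def sums_iff)
  qed
qed

lemma gap_gradient_integrals:
  assumes "\<mu> \<in> exp_class \<delta> R" "\<nu> \<in> exp_class \<delta> R" "\<alpha> \<in> exp_class \<delta> R" "\<delta> > 0"
  shows "integrable \<alpha> (gap_gradient \<kappa> \<mu> \<nu>)"
    "(\<lambda>j. \<kappa> * (gap_weight j * (moment \<mu> j - moment \<nu> j) * lower (moment \<alpha>) j)) sums (LINT y|\<alpha>. gap_gradient \<kappa> \<mu> \<nu> y)"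
    "integrable \<alpha> (deriv (gap_gradient \<kappa> \<mu> \<nu>))"
    "(\<lambda>j. \<kappa> * (gap_weight j * (moment \<mu> j - moment \<nu> j) * lower (lower (moment \<alpha>)) j)) sums
      (LINT y|\<alpha>. deriv (gap_gradient \<kappa> \<mu> \<nu>) y)"
proof -
  have e: "gap_gradient \<kappa> \<mu> \<nu> = (\<lambda>y. \<Sum>j. (\<kappa> * gap_weight j * (moment \<mu> j - moment \<nu> j)) * lower (\<lambda>i. y ^ i) j)"
    by (auto simp: gap_gradient_def)
  note c = gap_gradient_coeff[OF assms(1,2,4), of \<kappa>]
  from grad_integrals[OF assms(3,4) c(2,1), folded e]
  show "integrable \<alpha> (gap_gradient \<kappa> \<mu> \<nu>)" "integrable \<alpha> (deriv (gap_gradient \<kappa> \<mu> \<nu>))"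
    "(\<lambda>j. \<kappa> * (gap_weight j * (moment \<mu> j - moment \<nu> j) * lower (moment \<alpha>) j)) sums (LINT y|\<alpha>. gap_gradient \<kappa> \<mu> \<nu> y)"
    "(\<lambda>j. \<kappa> * (gap_weight j * (moment \<mu> j - moment \<nu> j) * lower (lower (moment \<alpha>)) j)) sums
      (LINT y|\<alpha>. deriv (gap_gradient \<kappa> \<mu> \<nu>) y)"
    by (simp_all add: mult_ac)
qed

text \<open>
  The square of the weighted \<open>\<ell>\<^sup>2\<close> norm of the moment bounds.
\<close>

definition moment_bound_norm :: "real \<Rightarrow> real \<Rightarrow> real" where
  "moment_bound_norm \<delta> R = (\<Sum>j. gap_weight j * (moment_bound \<delta> R j)\<^sup>2)"

text \<open>
  A difference of coefficients multiplies the full integral of the gradient, not an increment of it.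
  Distributing the small factor \<open>r\<close> over the terms before applying Young's inequality yields a bound
  that is quadratic in the distance.
\<close>

lemma weighted_pairing_bound:
  assumes \<delta>: "\<delta> > 0" and R: "R \<ge> 0" and \<kappa>: "\<kappa> > 0" and r: "r \<ge> 0"
    and D: "(\<lambda>j. gap_weight j * (d j)\<^sup>2) sums D" and l: "\<And>j. \<bar>l j\<bar> \<le> K * moment_bound \<delta> R j"
    and L: "(\<lambda>j. \<kappa> * (gap_weight j * d j * l j)) sums L"
  shows "r * \<bar>L\<bar> \<le> \<kappa> / 2 * (D + K\<^sup>2 * moment_bound_norm \<delta> R * r\<^sup>2)"
proof -
  have rl: "\<bar>r * l j\<bar> \<le> (r * K) * moment_bound \<delta> R j" for j
    using mult_left_mono[OF l[of j] r] r by (simp add: abs_mult mult_ac)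
  note S = summable_gap_weight_bounded[OF \<delta> R rl]
  note P = gap_weight_pairing[OF sums_summable[OF D] S(1)]
  have "(\<lambda>j. (r / \<kappa>) * (\<kappa> * (gap_weight j * d j * l j))) sums ((r / \<kappa>) * L)" by (rule sums_mult[OF L])
  hence "(\<Sum>j. gap_weight j * d j * (r * l j)) = r / \<kappa> * L" using \<kappa> by (simp add: sums_iff mult_ac)
  hence "\<bar>r / \<kappa> * L\<bar> \<le> 1/2 * (D + (r * K)\<^sup>2 * moment_bound_norm \<delta> R)"
    using P(2) S(2) D unfolding moment_bound_norm_def by (simp add: sums_iff)
  hence "r * \<bar>L\<bar> / \<kappa> \<le> 1/2 * (D + (r * K)\<^sup>2 * moment_bound_norm \<delta> R)" using r \<kappa> by (simp add: abs_mult)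
  thus ?thesis using \<kappa> by (simp add: field_simps power_mult_distrib)
qed

text \<open>
  The increment of the integral of the gradient is a pairing of \<open>d\<close> with \<open>lower d\<close> (or with
  \<open>lower (lower d)\<close>), whose norms are at most that of \<open>d\<close>.
\<close>

lemma self_pairing_bound:
  assumes \<kappa>: "\<kappa> > 0" and D: "(\<lambda>j. gap_weight j * (d j)\<^sup>2) sums D"
    and x: "summable (\<lambda>j. gap_weight j * (x j)\<^sup>2)" "(\<Sum>j. gap_weight j * (x j)\<^sup>2) \<le> D"
    and L: "(\<lambda>j. \<kappa> * (gap_weight j * d j * x j)) sums L"
  shows "\<bar>L\<bar> \<le> \<kappa> * D"
proof -
  note P = gap_weight_pairing[OF sums_summable[OF D] x(1)]
  have "(\<lambda>j. (1 / \<kappa>) * (\<kappa> * (gap_weight j * d j * x j))) sums ((1 / \<kappa>) * L)" by (rule sums_mult[OF L])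
  hence e: "(\<Sum>j. gap_weight j * d j * x j) = L / \<kappa>" "(\<Sum>j. gap_weight j * (d j)\<^sup>2) = D"
    using \<kappa> D by (simp_all add: sums_iff)
  have "1/2 * (D + (\<Sum>j. gap_weight j * (x j)\<^sup>2)) \<le> D" using x(2) by simp
  with P(2)[unfolded e] have "\<bar>L / \<kappa>\<bar> \<le> D" by (rule order_trans)
  thus ?thesis using \<kappa> by (simp add: field_simps)
qed

text \<open>
  Let \<open>p\<close> be the gradient of the penalty at \<open>(\<mu>, \<nu>)\<close>. The integrals of \<open>p\<close> and \<open>p'\<close> against \<open>\<mu>\<close> and
  \<open>\<nu>\<close> differ by at most \<open>\<kappa> * moment_gap \<mu> \<nu>\<close>; against \<open>\<nu>\<close> alone they are of the order \<open>\<kappa>\<close> times the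
  distance, so that a further small factor \<open>r\<close> makes them quadratic.
\<close>

lemma gap_gradient_estimates:
  assumes m: "\<mu> \<in> exp_class \<delta> R" "\<nu> \<in> exp_class \<delta> R" and \<delta>: "\<delta> > 0" and \<kappa>: "\<kappa> > 0"
  shows "\<bar>(LINT y|\<mu>. gap_gradient \<kappa> \<mu> \<nu> y) - (LINT y|\<nu>. gap_gradient \<kappa> \<mu> \<nu> y)\<bar> \<le> \<kappa> * moment_gap \<mu> \<nu>"
    "\<bar>(LINT y|\<mu>. deriv (gap_gradient \<kappa> \<mu> \<nu>) y) - (LINT y|\<nu>. deriv (gap_gradient \<kappa> \<mu> \<nu>) y)\<bar> \<le> \<kappa> * moment_gap \<mu> \<nu>"
    "r \<ge> 0 \<Longrightarrow> r * \<bar>LINT y|\<nu>. gap_gradient \<kappa> \<mu> \<nu> y\<bar> \<le> \<kappa> / 2 * (moment_gap \<mu> \<nu> + \<delta>\<^sup>2 * moment_bound_norm \<delta> R * r\<^sup>2)"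
    "r \<ge> 0 \<Longrightarrow> r * \<bar>LINT y|\<nu>. deriv (gap_gradient \<kappa> \<mu> \<nu>) y\<bar> \<le> \<kappa> / 2 * (moment_gap \<mu> \<nu> + (\<delta>\<^sup>2)\<^sup>2 * moment_bound_norm \<delta> R * r\<^sup>2)"
proof -
  have R: "R \<ge> 0" using exp_class_ge_1[OF m(1) \<delta>] by simp
  note IM = gap_gradient_integrals[OF m m(1) \<delta>, of \<kappa>] and IN = gap_gradient_integrals[OF m m(2) \<delta>, of \<kappa>]
  note D = moment_gap_sums(2)[OF m \<delta>]
  let ?d = "\<lambda>j. moment \<mu> j - moment \<nu> j"
  note s1 = summable_gap_weight_lower[OF sums_summable[OF D]]
  note s2 = summable_gap_weight_lower[OF s1(1)]
  have D': "(\<Sum>j. gap_weight j * (?d j)\<^sup>2) = moment_gap \<mu> \<nu>" using D by (simp add: sums_iff)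
  have l1: "(\<lambda>j. \<kappa> * (gap_weight j * ?d j * lower ?d j)) sums
      ((LINT y|\<mu>. gap_gradient \<kappa> \<mu> \<nu> y) - (LINT y|\<nu>. gap_gradient \<kappa> \<mu> \<nu> y))"
    using sums_diff[OF IM(2) IN(2)] by (simp add: lower_diff algebra_simps)
  have l2: "(\<lambda>j. \<kappa> * (gap_weight j * ?d j * lower (lower ?d) j)) sums
      ((LINT y|\<mu>. deriv (gap_gradient \<kappa> \<mu> \<nu>) y) - (LINT y|\<nu>. deriv (gap_gradient \<kappa> \<mu> \<nu>) y))"
    using sums_diff[OF IM(4) IN(4)] by (simp add: lower_diff algebra_simps)
  show "\<bar>(LINT y|\<mu>. gap_gradient \<kappa> \<mu> \<nu> y) - (LINT y|\<nu>. gap_gradient \<kappa> \<mu> \<nu> y)\<bar> \<le> \<kappa> * moment_gap \<mu> \<nu>"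
    by (rule self_pairing_bound[OF \<kappa> D s1(1) _ l1]) (use s1(2) D' in simp)
  show "\<bar>(LINT y|\<mu>. deriv (gap_gradient \<kappa> \<mu> \<nu>) y) - (LINT y|\<nu>. deriv (gap_gradient \<kappa> \<mu> \<nu>) y)\<bar> \<le> \<kappa> * moment_gap \<mu> \<nu>"
    by (rule self_pairing_bound[OF \<kappa> D s2(1) _ l2]) (use s1(2) s2(2) D' in simp)
  have n0: "\<bar>moment \<nu> j\<bar> \<le> 1 * moment_bound \<delta> R j" for j using abs_moment_le[OF m(2) \<delta>, of j] by simp
  note n1 = abs_lower_le[OF \<delta> R n0 zero_le_one]
  have \<delta>0: "1 * \<delta> \<ge> 0" using \<delta> by simp
  note n2 = abs_lower_le[OF \<delta> R n1 \<delta>0]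
  show "r \<ge> 0 \<Longrightarrow> r * \<bar>LINT y|\<nu>. gap_gradient \<kappa> \<mu> \<nu> y\<bar> \<le> \<kappa> / 2 * (moment_gap \<mu> \<nu> + \<delta>\<^sup>2 * moment_bound_norm \<delta> R * r\<^sup>2)"
    using weighted_pairing_bound[OF \<delta> R \<kappa> _ D n1 IN(2), of r] by simp
  show "r \<ge> 0 \<Longrightarrow> r * \<bar>LINT y|\<nu>. deriv (gap_gradient \<kappa> \<mu> \<nu>) y\<bar> \<le> \<kappa> / 2 * (moment_gap \<mu> \<nu> + (\<delta>\<^sup>2)\<^sup>2 * moment_bound_norm \<delta> R * r\<^sup>2)"
    using weighted_pairing_bound[OF \<delta> R \<kappa> _ D n2 IN(4), of r] by (simp add: power2_eq_square)
qed

section \<open>The Hamiltonian\<close>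

lemma generator_integral_eq:
  assumes U: "bounded U" "closed U" and \<gamma>: "\<gamma> \<in> Pi_set U \<mu>"
    and p: "continuous_on UNIV p" "continuous_on UNIV (deriv p)"
      "integrable \<mu> p" "integrable \<mu> (deriv p)"
    and b: "\<And>z. z \<in> UNIV \<times> U \<Longrightarrow> b t z \<gamma>' = \<beta>" "\<And>z. z \<in> UNIV \<times> U \<Longrightarrow> \<sigma> t z \<gamma>' = \<tau>"
  shows "generator_integral U b \<sigma> t p \<gamma>' \<gamma> = \<beta> * (LINT y|\<mu>. p y) + 1/2 * \<tau>\<^sup>2 * (LINT y|\<mu>. deriv p y)"
proof -
  note P = Pi_set_control_laws[OF U \<gamma>]
  note fs [measurable] = borel_measurable_fst_snd[OF P(5)]
  have [measurable]: "p \<in> borel_measurable borel" "deriv p \<in> borel_measurable borel"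
    using p by (auto intro: borel_measurable_continuous_onI)
  have Um [measurable]: "UNIV \<times> U \<in> sets \<gamma>" using U(2) by (auto simp: P(5) intro!: borel_closed closed_Times)
  have i: "integrable \<gamma> (\<lambda>z. p (fst z))" "integrable \<gamma> (\<lambda>z. deriv p (fst z))"
    using p(3,4) unfolding P(2)[symmetric] by (simp_all add: integrable_distr_eq)
  have l: "(LINT z|\<gamma>. p (fst z)) = (LINT y|\<mu>. p y)" "(LINT z|\<gamma>. deriv p (fst z)) = (LINT y|\<mu>. deriv p y)"
    unfolding P(2)[symmetric] by (simp_all add: integral_distr)
  have ae: "AE z in \<gamma>. z \<in> UNIV \<times> U" using P(3) by (simp add: Pspace_def)
  let ?f = "\<lambda>z. \<beta> * p (fst z) + 1/2 * \<tau>\<^sup>2 * deriv p (fst z)"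
  have "generator_integral U b \<sigma> t p \<gamma>' \<gamma> = (LINT z|\<gamma>. indicator (UNIV \<times> U) z *\<^sub>R ?f z)"
    unfolding generator_integral_def set_lebesgue_integral_def
    by (rule Bochner_Integration.integral_cong) (auto simp: indicator_def b mult_ac)
  also have "\<dots> = (LINT z|\<gamma>. ?f z)"
    by (rule integral_cong_AE) (use ae in \<open>auto elim!: eventually_mono\<close>)
  also have "\<dots> = \<beta> * (LINT y|\<mu>. p y) + 1/2 * \<tau>\<^sup>2 * (LINT y|\<mu>. deriv p y)"
    using i by (simp add: l)
  finally show ?thesis .
qed

text \<open>
  The expression under the infimum of the Hamiltonian, evaluated at the control value \<open>a\<close>: for
  coefficients that depend on the joint law only, it depends on the second coupling alone.
\<close>

definition control_value :: "real \<Rightarrow> coefficient \<Rightarrow> coefficient \<Rightarrow> coefficient \<Rightarrow> coefficient \<Rightarrow>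
    real \<Rightarrow> real measure \<Rightarrow> real measure \<Rightarrow> (real \<Rightarrow> real) \<Rightarrow> (real \<Rightarrow> real) \<Rightarrow> (real \<times> real) measure \<Rightarrow> real" where
  "control_value a b1 b2 \<sigma>1 \<sigma>2 t \<mu>1 \<mu>2 p1 p2 \<gamma> =
     b2 t (0, a) \<gamma> * (LINT y|\<mu>1. p1 y) + 1/2 * (\<sigma>2 t (0, a) \<gamma>)\<^sup>2 * (LINT y|\<mu>1. deriv p1 y)
   + (b1 t (0, a) \<gamma> * (LINT y|\<mu>2. p2 y) + 1/2 * (\<sigma>1 t (0, a) \<gamma>)\<^sup>2 * (LINT y|\<mu>2. deriv p2 y))"

text \<open>
  Splitting \<open>b M - b' L = b (M - L) + (b - b') L\<close> separates the two mechanisms of \<open>gap_gradient_estimates\<close>.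
\<close>

lemma product_perturbation:
  fixes b b' M L B e D :: real
  assumes "\<bar>b\<bar> \<le> B" "\<bar>M - L\<bar> \<le> e" "\<bar>b - b'\<bar> * \<bar>L\<bar> \<le> D"
  shows "b * M - b' * L \<le> B * e + D"
proof -
  have "b * M - b' * L = b * (M - L) + (b - b') * L" by (simp add: algebra_simps)
  also have "\<dots> \<le> \<bar>b\<bar> * \<bar>M - L\<bar> + \<bar>b - b'\<bar> * \<bar>L\<bar>"
    by (intro add_mono) (auto simp: abs_mult[symmetric])
  also have "\<dots> \<le> B * e + D" using assms by (intro add_mono mult_mono) auto
  finally show ?thesis .
qed


text \<open>
  The factor that bounds the squared Lipschitz modulus of the coefficients by the penalty.
\<close>

definition gap_factor :: "nat set \<Rightarrow> real" where
  "gap_factor I = 2 * (1 + real (card I)) * (1 + (\<Sum>i\<in>I. 1 / gap_weight i))"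

lemma moment_distance_square:
  assumes m: "\<mu> \<in> exp_class \<delta> R" "\<nu> \<in> exp_class \<delta> R" and \<delta>: "\<delta> > 0" and I: "finite I"
  shows "(\<bar>t\<bar> + (\<Sum>i\<in>I. \<bar>moment \<mu> i - moment \<nu> i\<bar>))\<^sup>2 \<le> gap_factor I * (t\<^sup>2 + moment_gap \<mu> \<nu>)"
proof -
  let ?d = "\<lambda>i. \<bar>moment \<mu> i - moment \<nu> i\<bar>"
  define n where "n = real (card I)"
  have n: "n \<ge> 0" by (simp add: n_def)
  have D: "moment_gap \<mu> \<nu> \<ge> 0" by (rule moment_gap_nonneg[OF m \<delta>])
  have W: "(\<Sum>i\<in>I. 1 / gap_weight i) \<ge> 0" by (intro sum_nonneg) (simp add: less_imp_le gap_weight_pos)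
  have s: "(\<Sum>i\<in>I. ?d i)\<^sup>2 \<le> n * (\<Sum>i\<in>I. (?d i)\<^sup>2)"
    using Cauchy_Schwarz_ineq_sum[of "\<lambda>_. 1" ?d I] by (simp add: n_def)
  have "(\<Sum>i\<in>I. (?d i)\<^sup>2) \<le> (\<Sum>i\<in>I. (1 / gap_weight i) * moment_gap \<mu> \<nu>)"
    using moment_diff_le_moment_gap[OF m \<delta>] gap_weight_pos by (intro sum_mono) (simp add: field_simps)
  hence q: "(\<Sum>i\<in>I. (?d i)\<^sup>2) \<le> (\<Sum>i\<in>I. 1 / gap_weight i) * moment_gap \<mu> \<nu>" by (simp add: sum_distrib_right)
  let ?Q = "(\<Sum>i\<in>I. 1 / gap_weight i) * moment_gap \<mu> \<nu>"
  have x: "(\<Sum>i\<in>I. ?d i)\<^sup>2 \<le> n * ?Q" using s mult_left_mono[OF q n] by linarith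
  have nt: "n * t\<^sup>2 \<ge> 0" "?Q \<ge> 0" using n W D by auto
  have "(\<bar>t\<bar> + y)\<^sup>2 \<le> 2 * (t\<^sup>2 + y\<^sup>2)" for y
    using sum_squares_bound[of "\<bar>t\<bar>" y] by (simp add: power2_sum)
  hence "(\<bar>t\<bar> + (\<Sum>i\<in>I. ?d i))\<^sup>2 \<le> 2 * (t\<^sup>2 + (\<Sum>i\<in>I. ?d i)\<^sup>2)" .
  also have "\<dots> \<le> 2 * (t\<^sup>2 + n * ?Q)" by (intro mult_left_mono add_left_mono x) simp
  also have "\<dots> \<le> 2 * ((1 + n) * (t\<^sup>2 + ?Q))" using nt by (simp add: algebra_simps)
  also have "\<dots> \<le> 2 * ((1 + n) * ((1 + (\<Sum>i\<in>I. 1 / gap_weight i)) * (t\<^sup>2 + moment_gap \<mu> \<nu>)))"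
  proof -
    have "(\<Sum>i\<in>I. 1 / gap_weight i) * t\<^sup>2 \<ge> 0" using W by simp
    hence "t\<^sup>2 + ?Q \<le> (1 + (\<Sum>i\<in>I. 1 / gap_weight i)) * (t\<^sup>2 + moment_gap \<mu> \<nu>)"
      using D by (simp add: algebra_simps)
    thus ?thesis using n by (intro mult_left_mono) auto
  qed
  finally show ?thesis by (simp only: gap_factor_def n_def mult.assoc)
qed

text \<open>
  Half of the Lipschitz constant of the Hamiltonian with respect to \<open>\<kappa>\<close> times the penalty; the first
  two summands come from the drift and the last one from the diffusion.
\<close>

definition transfer_const :: "real \<Rightarrow> real \<Rightarrow> real \<Rightarrow> real \<Rightarrow> real \<Rightarrow> real" where
  "transfer_const B \<kappa>0 \<delta> R q = B + \<kappa>0 / 2 * (1 + \<delta>\<^sup>2 * moment_bound_norm \<delta> R * q)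
     + 1/2 * (B\<^sup>2 + B * \<kappa>0 * (1 + (\<delta>\<^sup>2)\<^sup>2 * moment_bound_norm \<delta> R * q))"

text \<open>
  The contribution of one measure argument, with \<open>b\<close> and \<open>s\<close> standing for the drift and diffusion
  coefficients at the two states. Increments of the integrals meet bounded coefficients, and
  increments of the coefficients, of size \<open>r\<close>, meet integrals that are small after multiplication by
  \<open>r\<close>.
\<close>

lemma coefficient_terms_diff:
  fixes b b' B \<kappa>0 :: real
  assumes m: "\<mu> \<in> exp_class \<delta> R" "\<nu> \<in> exp_class \<delta> R" and \<delta>: "\<delta> > 0" and \<kappa>: "\<kappa> > 0"
    and r: "r \<ge> 0" "r\<^sup>2 \<le> q * g" and g: "moment_gap \<mu> \<nu> \<le> g" and k0: "\<kappa>0 > 0" and B: "B \<ge> 0"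
    and b: "\<bar>b\<bar> \<le> B" "\<bar>b'\<bar> \<le> B" "\<bar>b - b'\<bar> \<le> \<kappa>0 * r"
    and s: "\<bar>s\<bar> \<le> B" "\<bar>s'\<bar> \<le> B" "\<bar>s - s'\<bar> \<le> \<kappa>0 * r"
  shows "b * (LINT y|\<mu>. gap_gradient \<kappa> \<mu> \<nu> y) + 1/2 * s\<^sup>2 * (LINT y|\<mu>. deriv (gap_gradient \<kappa> \<mu> \<nu>) y)
    \<le> b' * (LINT y|\<nu>. gap_gradient \<kappa> \<mu> \<nu> y) + 1/2 * s'\<^sup>2 * (LINT y|\<nu>. deriv (gap_gradient \<kappa> \<mu> \<nu>) y)
      + transfer_const B \<kappa>0 \<delta> R q * (\<kappa> * g)"
proof -
  let ?M = "LINT y|\<mu>. gap_gradient \<kappa> \<mu> \<nu> y" and ?M' = "LINT y|\<mu>. deriv (gap_gradient \<kappa> \<mu> \<nu>) y"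
  let ?L = "LINT y|\<nu>. gap_gradient \<kappa> \<mu> \<nu> y" and ?L' = "LINT y|\<nu>. deriv (gap_gradient \<kappa> \<mu> \<nu>) y"
  let ?A = "1 + \<delta>\<^sup>2 * moment_bound_norm \<delta> R * q" and ?A' = "1 + (\<delta>\<^sup>2)\<^sup>2 * moment_bound_norm \<delta> R * q"
  have R: "R \<ge> 0" using exp_class_ge_1[OF m(1) \<delta>] by simp
  have S: "moment_bound_norm \<delta> R \<ge> 0"
    unfolding moment_bound_norm_def by (intro suminf_nonneg summable_gap_weight_moment_bound \<delta> R) (simp add: less_imp_le gap_weight_pos)
  note E = gap_gradient_estimates[OF m \<delta> \<kappa>]
  have aux: "\<kappa> / 2 * (moment_gap \<mu> \<nu> + c * moment_bound_norm \<delta> R * r\<^sup>2) \<le> \<kappa> / 2 * ((1 + c * moment_bound_norm \<delta> R * q) * g)"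
    if "c \<ge> 0" for c
  proof -
    have "c * moment_bound_norm \<delta> R * r\<^sup>2 \<le> c * moment_bound_norm \<delta> R * (q * g)"
      using that S r(2) by (intro mult_left_mono mult_nonneg_nonneg)
    thus ?thesis using \<kappa> g by (intro mult_left_mono) (auto simp: algebra_simps)
  qed
  have "\<bar>b - b'\<bar> * \<bar>?L\<bar> \<le> \<kappa>0 * (\<kappa> / 2 * (?A * g))"
  proof -
    have "\<bar>b - b'\<bar> * \<bar>?L\<bar> \<le> \<kappa>0 * (r * \<bar>?L\<bar>)"
      using mult_right_mono[OF b(3), of "\<bar>?L\<bar>"] by (simp add: mult.assoc)
    also have "\<dots> \<le> \<kappa>0 * (\<kappa> / 2 * (?A * g))"
      using k0 order_trans[OF E(3)[OF r(1)] aux[of "\<delta>\<^sup>2"]] by (intro mult_left_mono) auto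
    finally show ?thesis .
  qed
  moreover have "\<bar>s\<^sup>2 - s'\<^sup>2\<bar> * \<bar>?L'\<bar> \<le>
      (2 * B * \<kappa>0) * (\<kappa> / 2 * (?A' * g))"
  proof -
    have "\<bar>s\<^sup>2 - s'\<^sup>2\<bar> = \<bar>s + s'\<bar> * \<bar>s - s'\<bar>" by (simp add: power2_eq_square abs_mult[symmetric] algebra_simps)
    also have "\<dots> \<le> (2 * B) * (\<kappa>0 * r)" using s B by (intro mult_mono) auto
    finally have ss: "\<bar>s\<^sup>2 - s'\<^sup>2\<bar> \<le> (2 * B) * (\<kappa>0 * r)" .
    have "\<bar>s\<^sup>2 - s'\<^sup>2\<bar> * \<bar>?L'\<bar> \<le>
        (2 * B * \<kappa>0) * (r * \<bar>?L'\<bar>)"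
      using mult_right_mono[OF ss, of "\<bar>?L'\<bar>"] by (simp add: mult.assoc)
    also have "\<dots> \<le> (2 * B * \<kappa>0) * (\<kappa> / 2 * (?A' * g))"
      using k0 B order_trans[OF E(4)[OF r(1)] aux[of "(\<delta>\<^sup>2)\<^sup>2"]] by (intro mult_left_mono) auto
    finally show ?thesis .
  qed
  moreover have "\<bar>s\<^sup>2\<bar> \<le> B\<^sup>2" using power_mono[OF s(1), of 2] by simp
  moreover have "\<kappa> * moment_gap \<mu> \<nu> \<le> \<kappa> * g" using g \<kappa> by simp
  ultimately have
    "b * ?M - b' * ?L \<le>
       B * (\<kappa> * g) + \<kappa>0 * (\<kappa> / 2 * (?A * g))"
    "s\<^sup>2 * ?M' - s'\<^sup>2 * ?L' \<le>
       B\<^sup>2 * (\<kappa> * g) + (2 * B * \<kappa>0) * (\<kappa> / 2 * (?A' * g))"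
    using product_perturbation[OF b(1) order_trans[OF E(1)]]
      product_perturbation[of "s\<^sup>2" "B\<^sup>2", OF _ order_trans[OF E(2)]] by blast+
  moreover have "transfer_const B \<kappa>0 \<delta> R q * (\<kappa> * g)
    = (B * (\<kappa> * g) + \<kappa>0 * (\<kappa> / 2 * (?A * g)))
      + 1/2 * (B\<^sup>2 * (\<kappa> * g) + (2 * B * \<kappa>0) * (\<kappa> / 2 * (?A' * g)))"
  proof -
    have "(B + \<kappa>0 / 2 * A + 1/2 * (B\<^sup>2 + B * \<kappa>0 * A')) * (\<kappa> * g)
      = (B * (\<kappa> * g) + \<kappa>0 * (\<kappa> / 2 * (A * g))) + 1/2 * (B\<^sup>2 * (\<kappa> * g) + (2 * B * \<kappa>0) * (\<kappa> / 2 * (A' * g)))"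
      for A A' by (simp add: algebra_simps)
    thus ?thesis unfolding transfer_const_def .
  qed
  moreover have "x + 1/2 * y \<le> x' + 1/2 * y' + z" if "x - x' \<le> p" "y - y' \<le> q'" "z = p + 1/2 * q'"
    for x x' y y' z p q' :: real using that by linarith
  ultimately show ?thesis unfolding mult.assoc[of "1/2"] by blast
qed

lemma hamiltonian_eq_INF:
  assumes U: "bounded U" "closed U" and a: "a \<in> U"
    and ind: "\<And>\<phi> \<gamma> z. \<phi> \<in> {b1, b2, \<sigma>1, \<sigma>2} \<Longrightarrow> \<gamma> \<in> Pspace 2 (UNIV \<times> U) \<Longrightarrow> z \<in> UNIV \<times> U \<Longrightarrow>
      \<phi> t z \<gamma> = \<phi> t (0, a) \<gamma>"
    and p: "continuous_on UNIV p1" "continuous_on UNIV (deriv p1)"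
      "integrable \<mu>1 p1" "integrable \<mu>1 (deriv p1)"
      "continuous_on UNIV p2" "continuous_on UNIV (deriv p2)"
      "integrable \<mu>2 p2" "integrable \<mu>2 (deriv p2)"
    and ne: "Pi_set U \<mu>1 \<noteq> {}"
  shows "hamiltonian U b1 b2 \<sigma>1 \<sigma>2 t \<mu>1 \<mu>2 p1 p2 =
    (INF \<gamma>\<in>Pi_set U \<mu>2. control_value a b1 b2 \<sigma>1 \<sigma>2 t \<mu>1 \<mu>2 p1 p2 \<gamma>)"
proof -
  have eq: "generator_integral U b2 \<sigma>2 t p1 \<gamma>2 \<gamma>1 + generator_integral U b1 \<sigma>1 t p2 \<gamma>2 \<gamma>2 =
      control_value a b1 b2 \<sigma>1 \<sigma>2 t \<mu>1 \<mu>2 p1 p2 \<gamma>2"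
    if "\<gamma>1 \<in> Pi_set U \<mu>1" "\<gamma>2 \<in> Pi_set U \<mu>2" for \<gamma>1 \<gamma>2
  proof -
    have P: "\<gamma>2 \<in> Pspace 2 (UNIV \<times> U)" using that(2) by (simp add: Pi_set_def)
    show ?thesis unfolding control_value_def
      by (intro arg_cong2[where f="(+)"] generator_integral_eq[OF U that(1) p(1-4)]
          generator_integral_eq[OF U that(2) p(5-8)] ind[OF _ P]) auto
  qed
  show ?thesis unfolding hamiltonian_def
  proof (rule arg_cong[where f=Inf], intro equalityI subsetI)
    fix x assume "x \<in> control_value a b1 b2 \<sigma>1 \<sigma>2 t \<mu>1 \<mu>2 p1 p2 ` Pi_set U \<mu>2"
    then obtain \<gamma>2 where g2: "\<gamma>2 \<in> Pi_set U \<mu>2" "x = control_value a b1 b2 \<sigma>1 \<sigma>2 t \<mu>1 \<mu>2 p1 p2 \<gamma>2" by auto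
    obtain \<gamma>1 where g1: "\<gamma>1 \<in> Pi_set U \<mu>1" using ne by auto
    show "x \<in> (\<lambda>(\<gamma>1, \<gamma>2). generator_integral U b2 \<sigma>2 t p1 \<gamma>2 \<gamma>1 + generator_integral U b1 \<sigma>1 t p2 \<gamma>2 \<gamma>2) `
        (Pi_set U \<mu>1 \<times> Pi_set U \<mu>2)"
      by (rule image_eqI[of _ _ "(\<gamma>1, \<gamma>2)"]) (use g1 g2 eq[OF g1 g2(1)] in auto)
  qed (auto simp: eq)
qed

text \<open>
  Given \<open>\<gamma>' \<in> \<Pi>\<^bsub>\<nu>\<^sub>2\<^esub>\<close>, the product of \<open>\<mu>\<^sub>2\<close> with the control marginal of \<open>\<gamma>'\<close> lies in \<open>\<Pi>\<^bsub>\<mu>\<^sub>2\<^esub>\<close>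
  and has the same control marginal, so the Lipschitz condition in the moments applies to the pair.
  The infimum on the left is a genuine lower bound because the coefficients are bounded.
\<close>

lemma hamiltonian_diff:
  assumes U: "bounded U" "closed U" and a: "a \<in> U" and \<delta>: "\<delta> > 0"
    and ind: "\<And>\<phi> t \<gamma> z. \<phi> \<in> {b1, b2, \<sigma>1, \<sigma>2} \<Longrightarrow> t \<in> {0..T} \<Longrightarrow> \<gamma> \<in> Pspace 2 (UNIV \<times> U) \<Longrightarrow>
      z \<in> UNIV \<times> U \<Longrightarrow> \<phi> t z \<gamma> = \<phi> t (0, a) \<gamma>"
    and lip: "\<And>\<phi>. \<phi> \<in> {b1, b2, \<sigma>1, \<sigma>2} \<Longrightarrow> coefficient_moment_lipschitz T U \<kappa>0 I \<phi>"
    and k0: "\<kappa>0 > 0" and I: "finite I" and B0: "B \<ge> 0"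
    and B: "\<And>\<phi> t \<mu> \<gamma>. \<phi> \<in> {b1, b2, \<sigma>1, \<sigma>2} \<Longrightarrow> t \<in> {0..T} \<Longrightarrow> \<mu> \<in> exp_class \<delta> R \<Longrightarrow> \<gamma> \<in> Pi_set U \<mu> \<Longrightarrow>
      \<bar>\<phi> t (0, a) \<gamma>\<bar> \<le> B"
    and t: "t \<in> {0..T}" "s \<in> {0..T}" and \<kappa>: "\<kappa> > 0"
    and \<mu>: "\<mu>1 \<in> exp_class \<delta> R" "\<mu>2 \<in> exp_class \<delta> R"
    and \<nu>: "\<nu>1 \<in> exp_class \<delta> R" "\<nu>2 \<in> exp_class \<delta> R"
  shows "hamiltonian U b1 b2 \<sigma>1 \<sigma>2 t \<mu>1 \<mu>2 (gap_gradient \<kappa> \<mu>1 \<nu>1) (gap_gradient \<kappa> \<mu>2 \<nu>2)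
    \<le> hamiltonian U b1 b2 \<sigma>1 \<sigma>2 s \<nu>1 \<nu>2 (gap_gradient \<kappa> \<mu>1 \<nu>1) (gap_gradient \<kappa> \<mu>2 \<nu>2)
      + 2 * transfer_const B \<kappa>0 \<delta> R (gap_factor I)
        * (\<kappa> * ((t - s)\<^sup>2 + moment_gap \<mu>1 \<nu>1 + moment_gap \<mu>2 \<nu>2))"
    (is "?H t \<mu>1 \<mu>2 \<le> ?H s \<nu>1 \<nu>2 + 2 * ?K * (\<kappa> * ?g)")
proof -
  let ?p1 = "gap_gradient \<kappa> \<mu>1 \<nu>1" and ?p2 = "gap_gradient \<kappa> \<mu>2 \<nu>2"
  let ?h = "\<lambda>t \<mu>1 \<mu>2. control_value a b1 b2 \<sigma>1 \<sigma>2 t \<mu>1 \<mu>2 ?p1 ?p2"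
  have ne: "Pi_set U \<alpha> \<noteq> {}" if "\<alpha> \<in> exp_class \<delta> R" for \<alpha>
    using product_in_Pi_set(1)[OF U that \<delta> return_control_laws[OF U(2) a]] by blast
  have H: "?H t \<alpha>1 \<alpha>2 = (INF \<gamma>\<in>Pi_set U \<alpha>2. ?h t \<alpha>1 \<alpha>2 \<gamma>)"
    if "t \<in> {0..T}" "\<alpha>1 \<in> exp_class \<delta> R" "\<alpha>2 \<in> exp_class \<delta> R" for t \<alpha>1 \<alpha>2
  proof (rule hamiltonian_eq_INF[OF U a _ _ _ _ _ _ _ _ _ ne[OF that(2)]])
    show "\<phi> t z \<gamma> = \<phi> t (0, a) \<gamma>" if "\<phi> \<in> {b1, b2, \<sigma>1, \<sigma>2}" "\<gamma> \<in> Pspace 2 (UNIV \<times> U)" "z \<in> UNIV \<times> U" for \<phi> \<gamma> z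
      by (rule ind[OF that(1) \<open>t \<in> {0..T}\<close> that(2,3)])
  qed (rule gap_gradient_properties(1,2)[OF \<mu>(1) \<nu>(1) \<delta>] gap_gradient_properties(1,2)[OF \<mu>(2) \<nu>(2) \<delta>]
      gap_gradient_integrals(1,3)[OF \<mu>(1) \<nu>(1) that(2) \<delta>] gap_gradient_integrals(1,3)[OF \<mu>(2) \<nu>(2) that(3) \<delta>])+
  have D: "moment_gap \<mu>1 \<nu>1 \<ge> 0" "moment_gap \<mu>2 \<nu>2 \<ge> 0"
    using moment_gap_nonneg[OF \<mu>(1) \<nu>(1) \<delta>] moment_gap_nonneg[OF \<mu>(2) \<nu>(2) \<delta>] by auto
  define r where "r = \<bar>t - s\<bar> + (\<Sum>i\<in>I. \<bar>moment \<mu>2 i - moment \<nu>2 i\<bar>)"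
  have r0: "r \<ge> 0" by (simp add: r_def sum_nonneg)
  have mw: "gap_factor I \<ge> 0"
    by (auto simp: gap_factor_def less_imp_le gap_weight_pos intro!: mult_nonneg_nonneg add_nonneg_nonneg sum_nonneg)
  have "r\<^sup>2 \<le> gap_factor I * ((t - s)\<^sup>2 + moment_gap \<mu>2 \<nu>2)"
    unfolding r_def by (rule moment_distance_square[OF \<mu>(2) \<nu>(2) \<delta> I])
  also have "\<dots> \<le> gap_factor I * ?g" using D mw by (intro mult_left_mono) auto
  finally have r2: "r\<^sup>2 \<le> gap_factor I * ?g" .
  have g: "moment_gap \<mu>1 \<nu>1 \<le> ?g" "moment_gap \<mu>2 \<nu>2 \<le> ?g" using D by auto
  have "?H t \<mu>1 \<mu>2 - 2 * ?K * (\<kappa> * ?g) \<le> (INF \<gamma>\<in>Pi_set U \<nu>2. ?h s \<nu>1 \<nu>2 \<gamma>)"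
  proof (rule cINF_greatest[OF ne[OF \<nu>(2)]])
    fix \<gamma>' assume g': "\<gamma>' \<in> Pi_set U \<nu>2"
    note P' = Pi_set_control_laws[OF U g']
    define \<gamma> where "\<gamma> = \<mu>2 \<Otimes>\<^sub>M distr \<gamma>' borel snd"
    have \<gamma>: "\<gamma> \<in> Pi_set U \<mu>2" "distr \<gamma> borel snd = distr \<gamma>' borel snd"
      using product_in_Pi_set[OF U \<mu>(2) \<delta> P'(1)] by (auto simp: \<gamma>_def)
    note P = Pi_set_control_laws[OF U \<gamma>(1)]
    have bd: "\<bar>\<phi> t (0, a) \<gamma>\<bar> \<le> B" "\<bar>\<phi> s (0, a) \<gamma>'\<bar> \<le> B"
      "\<bar>\<phi> t (0, a) \<gamma> - \<phi> s (0, a) \<gamma>'\<bar> \<le> \<kappa>0 * r" if "\<phi> \<in> {b1, b2, \<sigma>1, \<sigma>2}" for \<phi>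
    proof -
      show "\<bar>\<phi> t (0, a) \<gamma>\<bar> \<le> B" by (rule B[OF that t(1) \<mu>(2) \<gamma>(1)])
      show "\<bar>\<phi> s (0, a) \<gamma>'\<bar> \<le> B" by (rule B[OF that t(2) \<nu>(2) g'])
      have i: "integrable (distr \<gamma> borel fst) (\<lambda>y. y ^ i)" "integrable (distr \<gamma>' borel fst) (\<lambda>y. y ^ i)" for i
        unfolding P(2) P'(2) using exp_class_abs_power(2)[OF \<mu>(2) \<delta>] exp_class_abs_power(2)[OF \<nu>(2) \<delta>] by auto
      from coefficient_moment_lipschitzD[OF lip[OF that] t a P(3) P'(3) \<gamma>(2) i]
      show "\<bar>\<phi> t (0, a) \<gamma> - \<phi> s (0, a) \<gamma>'\<bar> \<le> \<kappa>0 * r" by (simp add: r_def P(2) P'(2))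
    qed
    have "?H t \<mu>1 \<mu>2 \<le> ?h t \<mu>1 \<mu>2 \<gamma>"
      unfolding H[OF t(1) \<mu>]
    proof (rule cINF_lower[OF _ \<gamma>(1)])
      let ?c = "\<lambda>\<alpha> p. B * \<bar>LINT y|\<alpha>. p y\<bar> + 1/2 * B\<^sup>2 * \<bar>LINT y|\<alpha>. deriv p y\<bar>"
      have "- ?c \<mu>1 ?p1 - ?c \<mu>2 ?p2 \<le> ?h t \<mu>1 \<mu>2 \<beta>" if \<beta>: "\<beta> \<in> Pi_set U \<mu>2" for \<beta>
      proof -
        have lo: "- (B * \<bar>M\<bar> + 1/2 * B\<^sup>2 * \<bar>M'\<bar>) \<le> x * M + 1/2 * y\<^sup>2 * M'"
          if "\<bar>x\<bar> \<le> B" "\<bar>y\<bar> \<le> B" for x y M M' :: real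
        proof -
          have "\<bar>x * M\<bar> \<le> B * \<bar>M\<bar>" using that(1) by (simp add: abs_mult mult_right_mono)
          moreover have "\<bar>y\<^sup>2 * M'\<bar> \<le> B\<^sup>2 * \<bar>M'\<bar>"
            using power_mono[OF that(2), of 2] by (simp add: abs_mult mult_right_mono)
          ultimately show ?thesis by linarith
        qed
        have bb: "\<bar>\<phi> t (0, a) \<beta>\<bar> \<le> B" if "\<phi> \<in> {b1, b2, \<sigma>1, \<sigma>2}" for \<phi>
          by (rule B[OF that t(1) \<mu>(2) \<beta>])
        have "- ?c \<mu>1 ?p1 \<le> b2 t (0, a) \<beta> * (LINT y|\<mu>1. ?p1 y) + 1/2 * (\<sigma>2 t (0, a) \<beta>)\<^sup>2 * (LINT y|\<mu>1. deriv ?p1 y)"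
          by (rule lo[OF bb[of b2] bb[of \<sigma>2]]) auto
        moreover have "- ?c \<mu>2 ?p2 \<le> b1 t (0, a) \<beta> * (LINT y|\<mu>2. ?p2 y) + 1/2 * (\<sigma>1 t (0, a) \<beta>)\<^sup>2 * (LINT y|\<mu>2. deriv ?p2 y)"
          by (rule lo[OF bb[of b1] bb[of \<sigma>1]]) auto
        ultimately show ?thesis unfolding control_value_def by linarith
      qed
      thus "bdd_below (?h t \<mu>1 \<mu>2 ` Pi_set U \<mu>2)" by (rule bdd_belowI2)
    qed
    also have "?h t \<mu>1 \<mu>2 \<gamma> \<le> ?h s \<nu>1 \<nu>2 \<gamma>' + 2 * ?K * (\<kappa> * ?g)"
    proof -
      have mem: "b1 \<in> {b1, b2, \<sigma>1, \<sigma>2}" "b2 \<in> {b1, b2, \<sigma>1, \<sigma>2}"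
        "\<sigma>1 \<in> {b1, b2, \<sigma>1, \<sigma>2}" "\<sigma>2 \<in> {b1, b2, \<sigma>1, \<sigma>2}" by auto
      have c: "b2 t (0, a) \<gamma> * (LINT y|\<mu>1. ?p1 y) + 1/2 * (\<sigma>2 t (0, a) \<gamma>)\<^sup>2 * (LINT y|\<mu>1. deriv ?p1 y)
        \<le> b2 s (0, a) \<gamma>' * (LINT y|\<nu>1. ?p1 y) + 1/2 * (\<sigma>2 s (0, a) \<gamma>')\<^sup>2 * (LINT y|\<nu>1. deriv ?p1 y)
          + ?K * (\<kappa> * ?g)"
        "b1 t (0, a) \<gamma> * (LINT y|\<mu>2. ?p2 y) + 1/2 * (\<sigma>1 t (0, a) \<gamma>)\<^sup>2 * (LINT y|\<mu>2. deriv ?p2 y)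
        \<le> b1 s (0, a) \<gamma>' * (LINT y|\<nu>2. ?p2 y) + 1/2 * (\<sigma>1 s (0, a) \<gamma>')\<^sup>2 * (LINT y|\<nu>2. deriv ?p2 y)
          + ?K * (\<kappa> * ?g)"
        by (rule coefficient_terms_diff[OF \<mu>(1) \<nu>(1) \<delta> \<kappa> r0 r2 g(1) k0 B0 bd[OF mem(2)] bd[OF mem(4)]],
            rule coefficient_terms_diff[OF \<mu>(2) \<nu>(2) \<delta> \<kappa> r0 r2 g(2) k0 B0 bd[OF mem(1)] bd[OF mem(3)]])
      have "A + D \<le> A' + D' + 2 * k * G" if "A \<le> A' + k * G" "D \<le> D' + k * G" for A A' D D' k G :: real
      proof -
        have "2 * k * G = k * G + k * G" by simp
        thus ?thesis using that by linarith
      qed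
      from this[OF c] show ?thesis unfolding control_value_def .
    qed
    finally show "?H t \<mu>1 \<mu>2 - 2 * ?K * (\<kappa> * ?g) \<le> ?h s \<nu>1 \<nu>2 \<gamma>'" by simp
  qed
  thus ?thesis unfolding H[OF t(2) \<nu>] by linarith
qed

section \<open>Comparison\<close>

theorem theorem5p2:
  fixes T C\<^sub>0 C \<kappa>\<^sub>0 \<delta> :: real
    and W :: "(real \<Rightarrow> real) measure"
    and U :: "real set"
    and I :: "nat set"
    and N :: nat
    and b\<^sub>1 b\<^sub>2 \<sigma>\<^sub>1 \<sigma>\<^sub>2 :: coefficient
    and \<Phi> :: "real \<Rightarrow> real measure \<Rightarrow> real"
    and u v :: "state \<Rightarrow> real"
  assumes "T > 0"
    and "wiener_measure T W"
    and "U \<noteq> {}" "bounded U" "closed U"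
    and "C\<^sub>0 > 0" "C > 0" "\<forall>\<phi>\<in>{b\<^sub>1, b\<^sub>2, \<sigma>\<^sub>1, \<sigma>\<^sub>2}. coefficient_regular T U W C\<^sub>0 C \<phi>"
    and "terminal_regular \<Phi>"
    and "\<kappa>\<^sub>0 > 0" "finite I"
      "\<forall>\<phi>\<in>{b\<^sub>1, b\<^sub>2, \<sigma>\<^sub>1, \<sigma>\<^sub>2}. coefficient_moment_lipschitz T U \<kappa>\<^sub>0 I \<phi>"
    and "\<delta> > 0" "terminal_growth \<delta> \<Phi>"
    and "\<forall>\<phi>\<in>{b\<^sub>1, b\<^sub>2, \<sigma>\<^sub>1, \<sigma>\<^sub>2}. \<forall>t\<in>{0..T}. \<forall>\<gamma>\<in>Pspace 2 (UNIV \<times> U).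
           \<forall>z\<in>UNIV \<times> U. \<forall>z'\<in>UNIV \<times> U. \<phi> t z \<gamma> = \<phi> t z' \<gamma>"
    and "viscosity_subsolution T U b\<^sub>1 b\<^sub>2 \<sigma>\<^sub>1 \<sigma>\<^sub>2 \<Phi> C\<^sub>0 \<delta> N u"
    and "viscosity_supersolution T U b\<^sub>1 b\<^sub>2 \<sigma>\<^sub>1 \<sigma>\<^sub>2 \<Phi> C\<^sub>0 \<delta> N v"
    and "\<forall>\<mu>\<^sub>1 \<mu>\<^sub>2. (T, \<mu>\<^sub>1, \<mu>\<^sub>2) \<in> O_closed T C\<^sub>0 \<delta> N \<longrightarrow> u (T, \<mu>\<^sub>1, \<mu>\<^sub>2) \<le> v (T, \<mu>\<^sub>1, \<mu>\<^sub>2)"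
  shows "\<forall>z\<in>O_closed T C\<^sub>0 \<delta> N. u z \<le> v z"
proof (rule ccontr)
  let ?O = "O_closed T C\<^sub>0 \<delta> N" and ?E = "O_dom T C\<^sub>0 \<delta> N"
  let ?H = "hamiltonian U b\<^sub>1 b\<^sub>2 \<sigma>\<^sub>1 \<sigma>\<^sub>2"
  note T = assms(1) and U = assms(4,5) and C0 = assms(6) and reg = assms(8) and k0 = assms(10)
    and I = assms(11) and lip = assms(12) and \<delta> = assms(13) and ind = assms(15)
    and sub = assms(16) and super = assms(17) and terminal = assms(18)
  assume "\<not> (\<forall>z\<in>?O. u z \<le> v z)"
  then obtain z\<^sub>0 where z0: "z\<^sub>0 \<in> ?O" "v z\<^sub>0 < u z\<^sub>0" by (auto simp: not_le)
  obtain a where a: "a \<in> U" using assms(3) by blast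
  let ?\<Phi> = "{b\<^sub>1, b\<^sub>2, \<sigma>\<^sub>1, \<sigma>\<^sub>2}"
  define R where "R = real N * exp (K_star C\<^sub>0 \<delta> * T)"
  have uc: "continuous_map (O_topology T C\<^sub>0 \<delta> N) euclideanreal u"
    and vc: "continuous_map (O_topology T C\<^sub>0 \<delta> N) euclideanreal v"
    using sub super by (auto simp: viscosity_subsolution_def viscosity_supersolution_def)
  have term': "u z \<le> v z" if "z \<in> ?O" "fst z = T" for z
    using terminal that by (cases z) auto
  have "\<forall>\<phi>\<in>?\<Phi>. \<exists>B. \<forall>t\<in>{0..T}. \<forall>\<mu>\<in>exp_class \<delta> R. \<forall>\<gamma>\<in>Pi_set U \<mu>. \<bar>\<phi> t (0, a) \<gamma>\<bar> \<le> B"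
  proof
    fix \<phi> assume "\<phi> \<in> ?\<Phi>"
    with reg lip have "coefficient_regular T U W C\<^sub>0 C \<phi>" "coefficient_moment_lipschitz T U \<kappa>\<^sub>0 I \<phi>" by blast+
    from coefficient_bounded[OF U a T this k0 \<delta>]
    show "\<exists>B. \<forall>t\<in>{0..T}. \<forall>\<mu>\<in>exp_class \<delta> R. \<forall>\<gamma>\<in>Pi_set U \<mu>. \<bar>\<phi> t (0, a) \<gamma>\<bar> \<le> B" .
  qed
  then obtain \<beta> where \<beta>: "\<And>\<phi> t \<mu> \<gamma>. \<phi> \<in> ?\<Phi> \<Longrightarrow> t \<in> {0..T} \<Longrightarrow> \<mu> \<in> exp_class \<delta> R \<Longrightarrow> \<gamma> \<in> Pi_set U \<mu> \<Longrightarrow>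
      \<bar>\<phi> t (0, a) \<gamma>\<bar> \<le> \<beta> \<phi>" by (metis (no_types, lifting) bchoice)
  define B where "B = (\<Sum>\<phi>\<in>?\<Phi>. \<bar>\<beta> \<phi>\<bar>)"
  have B0: "B \<ge> 0" by (simp add: B_def sum_nonneg)
  have B: "\<bar>\<phi> t (0, a) \<gamma>\<bar> \<le> B" if "\<phi> \<in> ?\<Phi>" "t \<in> {0..T}" "\<mu> \<in> exp_class \<delta> R" "\<gamma> \<in> Pi_set U \<mu>" for \<phi> t \<mu> \<gamma>
  proof -
    have "\<bar>\<phi> t (0, a) \<gamma>\<bar> \<le> \<bar>\<beta> \<phi>\<bar>" using \<beta>[OF that] by linarith
    also have "\<dots> \<le> B" unfolding B_def by (rule member_le_sum[OF that(1)]) auto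
    finally show ?thesis .
  qed
  have ind': "\<phi> t z \<gamma> = \<phi> t (0, a) \<gamma>"
    if "\<phi> \<in> ?\<Phi>" "t \<in> {0..T}" "\<gamma> \<in> Pspace 2 (UNIV \<times> U)" "z \<in> UNIV \<times> U" for \<phi> t \<gamma> z
    by (rule ind[THEN bspec, OF that(1), THEN bspec, OF that(2), THEN bspec, OF that(3), THEN bspec, OF that(4),
          THEN bspec]) (use a in simp)
  have lip': "coefficient_moment_lipschitz T U \<kappa>\<^sub>0 I \<phi>" if "\<phi> \<in> ?\<Phi>" for \<phi> using lip that by blast
  define K where "K = 2 * transfer_const B \<kappa>\<^sub>0 \<delta> R (gap_factor I)"
  obtain \<rho> where \<rho>: "\<rho> > 0" "\<And>\<eta>. \<eta> > 0 \<Longrightarrow> \<exists>\<kappa>>0. \<exists>z\<in>?E. \<exists>w\<in>?E.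
      \<kappa> * state_gap z w < \<eta> \<and>
      (\<forall>z'\<in>?O. \<forall>w'\<in>?O.
        u z' - v w' + \<rho> * fst z' - \<kappa> / 2 * state_gap z' w' \<le>
        u z - v w + \<rho> * fst z - \<kappa> / 2 * state_gap z w)"
    using doubling[OF \<delta> C0 T uc vc term' z0] by blast
  have "\<rho> / (\<bar>K\<bar> + 1) > 0" using \<rho>(1) by (intro divide_pos_pos) auto
  from \<rho>(2)[OF this] obtain \<kappa> z w where \<kappa>: "\<kappa> > 0"
    and zw: "z \<in> ?E" "w \<in> ?E"
    and gap: "\<kappa> * state_gap z w < \<rho> / (\<bar>K\<bar> + 1)"
    and mx: "\<And>z' w'. z' \<in> ?O \<Longrightarrow> w' \<in> ?O \<Longrightarrow>
        u z' - v w' + \<rho> * fst z' - \<kappa> / 2 * state_gap z' w' \<le>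
        u z - v w + \<rho> * fst z - \<kappa> / 2 * state_gap z w" by blast
  obtain t \<mu>\<^sub>1 \<mu>\<^sub>2 where z: "z = (t, \<mu>\<^sub>1, \<mu>\<^sub>2)" by (cases z)
  obtain s \<nu>\<^sub>1 \<nu>\<^sub>2 where w: "w = (s, \<nu>\<^sub>1, \<nu>\<^sub>2)" by (cases w)
  let ?p\<^sub>1 = "gap_gradient \<kappa> \<mu>\<^sub>1 \<nu>\<^sub>1" and ?p\<^sub>2 = "gap_gradient \<kappa> \<mu>\<^sub>2 \<nu>\<^sub>2"
  have sub_closed: "?E \<subseteq> ?O" by (auto simp: O_dom_def)
  have zc: "z \<in> ?O" and wc: "w \<in> ?O" using zw sub_closed by auto
  have t: "t \<in> {0..T}" and \<mu>: "\<mu>\<^sub>1 \<in> exp_class \<delta> R" "\<mu>\<^sub>2 \<in> exp_class \<delta> R"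
    using O_closed_exp_class[OF \<delta> C0 zc] by (auto simp: z R_def)
  have s: "s \<in> {0..T}" and \<nu>: "\<nu>\<^sub>1 \<in> exp_class \<delta> R" "\<nu>\<^sub>2 \<in> exp_class \<delta> R"
    using O_closed_exp_class[OF \<delta> C0 wc] by (auto simp: w R_def)
  have E: "\<alpha>\<^sub>1 \<in> exp_class \<delta> R \<and> \<alpha>\<^sub>2 \<in> exp_class \<delta> R" if "(r, \<alpha>\<^sub>1, \<alpha>\<^sub>2) \<in> ?E" for r \<alpha>\<^sub>1 \<alpha>\<^sub>2
    using O_closed_exp_class[OF \<delta> C0, of "(r, \<alpha>\<^sub>1, \<alpha>\<^sub>2)"] that sub_closed by (auto simp: R_def)
  have "(- \<rho> + \<kappa> * (t - s), ?p\<^sub>1, ?p\<^sub>2) \<in> J_plus T ?E u (t, \<mu>\<^sub>1, \<mu>\<^sub>2)"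
  proof (rule quadratic_jet[OF \<delta> \<kappa> E \<nu>])
    show "(t, \<mu>\<^sub>1, \<mu>\<^sub>2) \<in> ?E" using zw(1) by (simp add: z)
    fix r \<alpha>\<^sub>1 \<alpha>\<^sub>2 assume "(r, \<alpha>\<^sub>1, \<alpha>\<^sub>2) \<in> ?E"
    hence "(r, \<alpha>\<^sub>1, \<alpha>\<^sub>2) \<in> ?O" using sub_closed by blast
    from mx[OF this wc]
    show "u (r, \<alpha>\<^sub>1, \<alpha>\<^sub>2) - (- \<rho> * r + \<kappa> / 2 * ((r - s)\<^sup>2 + moment_gap \<alpha>\<^sub>1 \<nu>\<^sub>1 + moment_gap \<alpha>\<^sub>2 \<nu>\<^sub>2)) \<le>
      u (t, \<mu>\<^sub>1, \<mu>\<^sub>2) - (- \<rho> * t + \<kappa> / 2 * ((t - s)\<^sup>2 + moment_gap \<mu>\<^sub>1 \<nu>\<^sub>1 + moment_gap \<mu>\<^sub>2 \<nu>\<^sub>2))"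
      by (simp add: z w state_gap_def)
  qed
  with sub zw(1) have le1: "- (- \<rho> + \<kappa> * (t - s)) -
      ?H t \<mu>\<^sub>1 \<mu>\<^sub>2 ?p\<^sub>1 ?p\<^sub>2 \<le> 0"
    unfolding viscosity_subsolution_def z by blast
  \<comment> \<open>the same maximum seen from \<open>w\<close>, for \<open>- v\<close> and with the roles of the base point exchanged\<close>
  have jw: "(0 + \<kappa> * (s - t), gap_gradient \<kappa> \<nu>\<^sub>1 \<mu>\<^sub>1, gap_gradient \<kappa> \<nu>\<^sub>2 \<mu>\<^sub>2) \<in> J_plus T ?E (\<lambda>z. - v z) (s, \<nu>\<^sub>1, \<nu>\<^sub>2)"
  proof (rule quadratic_jet[OF \<delta> \<kappa> E \<mu>])
    show "(s, \<nu>\<^sub>1, \<nu>\<^sub>2) \<in> ?E" using zw(2) by (simp add: w)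
    fix r \<alpha>\<^sub>1 \<alpha>\<^sub>2 assume "(r, \<alpha>\<^sub>1, \<alpha>\<^sub>2) \<in> ?E"
    hence "(r, \<alpha>\<^sub>1, \<alpha>\<^sub>2) \<in> ?O" using sub_closed by blast
    from mx[OF zc this]
    show "- v (r, \<alpha>\<^sub>1, \<alpha>\<^sub>2) - (0 * r + \<kappa> / 2 * ((r - t)\<^sup>2 + moment_gap \<alpha>\<^sub>1 \<mu>\<^sub>1 + moment_gap \<alpha>\<^sub>2 \<mu>\<^sub>2)) \<le>
      - v (s, \<nu>\<^sub>1, \<nu>\<^sub>2) - (0 * s + \<kappa> / 2 * ((s - t)\<^sup>2 + moment_gap \<nu>\<^sub>1 \<mu>\<^sub>1 + moment_gap \<nu>\<^sub>2 \<mu>\<^sub>2))"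
      by (simp add: z w state_gap_def moment_gap_commute[of \<mu>\<^sub>1] moment_gap_commute[of \<mu>\<^sub>2] power2_commute[of t])
  qed
  have "(- (0 + \<kappa> * (s - t)), ?p\<^sub>1, ?p\<^sub>2) \<in> J_minus T ?E v (s, \<nu>\<^sub>1, \<nu>\<^sub>2)"
    unfolding J_minus_def
    by (rule image_eqI[OF _ jw])
       (simp add: gap_gradient_properties(3)[OF \<mu>(1) \<nu>(1) \<delta>] gap_gradient_properties(3)[OF \<mu>(2) \<nu>(2) \<delta>])
  with super zw(2) have le2: "- (- (0 + \<kappa> * (s - t))) -
      ?H s \<nu>\<^sub>1 \<nu>\<^sub>2 ?p\<^sub>1 ?p\<^sub>2 \<ge> 0"
    unfolding viscosity_supersolution_def w by blast
  have "?H t \<mu>\<^sub>1 \<mu>\<^sub>2 ?p\<^sub>1 ?p\<^sub>2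
    \<le> ?H s \<nu>\<^sub>1 \<nu>\<^sub>2 ?p\<^sub>1 ?p\<^sub>2 + K * (\<kappa> * state_gap z w)"
    unfolding K_def state_gap_def z w fst_conv snd_conv
  proof (rule hamiltonian_diff[OF U a \<delta> _ _ k0 I B0 _ t s \<kappa> \<mu> \<nu>])
    show "\<phi> t z \<gamma> = \<phi> t (0, a) \<gamma>"
      if "\<phi> \<in> ?\<Phi>" "t \<in> {0..T}" "\<gamma> \<in> Pspace 2 (UNIV \<times> U)" "z \<in> UNIV \<times> U" for \<phi> t \<gamma> z
      using that by (rule ind')
    show "coefficient_moment_lipschitz T U \<kappa>\<^sub>0 I \<phi>" if "\<phi> \<in> ?\<Phi>" for \<phi> using that by (rule lip')
    show "\<bar>\<phi> t (0, a) \<gamma>\<bar> \<le> B" if "\<phi> \<in> ?\<Phi>" "t \<in> {0..T}" "\<mu> \<in> exp_class \<delta> R" "\<gamma> \<in> Pi_set U \<mu>" for \<phi> t \<mu> \<gamma>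
      using that by (rule B)
  qed
  moreover have "K * (\<kappa> * state_gap z w) < \<rho>"
  proof -
    have g0: "\<kappa> * state_gap z w \<ge> 0" using \<kappa> state_gap_nonneg[OF \<delta> C0 zc wc] by simp
    have "K * (\<kappa> * state_gap z w) \<le> (\<bar>K\<bar> + 1) * (\<kappa> * state_gap z w)"
      using g0 by (intro mult_right_mono) auto
    also have "\<dots> < (\<bar>K\<bar> + 1) * (\<rho> / (\<bar>K\<bar> + 1))"
      using gap by (intro mult_strict_left_mono) auto
    also have "\<dots> = \<rho>" by simp
    finally show ?thesis .
  qed
  ultimately show False using le1 le2 by (simp add: algebra_simps)
qed

end
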